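(* Let $\mathbf{k}$ be a field and let $w$ be a permutation with Rothe diagram $D(w)$. Then the character $\mathfrak{S}_{D(w)}$ of the flagged Schur module $E_\bullet^{D(w)}$ is equal to the Schubert polynomial $\mathfrak{S}_w$.
   Context: Permutations $w$ are permutations of $\{1,2,\dots\}$ fixing all but finitely many integers. The Rothe diagram is $D(w)=\{(i,j): j<w(i),\ i<w^{-1}(j)\}$ (row $i$, column $j$); its $j$th column is the set $a^{(j)}=\{i:(i,j)\in D(w)\}$. Schubert polynomials: the usual ones, given for $w\in S_N$ by $\mathfrak{S}_{[N,N-1,\dots,1]}=x_1^{N-1}x_2^{N-2}\cdots x_{N-1}$ and $\partial_k\mathfrak{S}_w=\mathfrak{S}_{ws_k}$ if $w(k)>w(k+1)$ and $\partial_k\mathfrak{S}_w=0$ otherwise, where $\partial_kf=(f-s_kf)/(x_k-x_{k+1})$. By a theorem of Nadeau, Spink and Tewari (which the paper takes as the working definition), they are equivalently characterized, as homogeneous polynomials of degree the length of $w$, by $\mathfrak{S}_{\mathrm{id}}=1$ and $\mathfrak{S}_w=\mathsf{R}_1(\mathfrak{S}_w)+\sum_{k:\,w(k)>w(k+1)}x_k\,\mathsf{R}_{k+1}(\mathfrak{S}_{ws_k})$, where $\mathsf{R}_k$ is the ring endomorphism of $\mathbb{Z}[x_1,x_2,\dots]$ with $x_i\mapsto x_i$ for $i<k$, $x_k\mapsto0$, $x_i\mapsto x_{i-1}$ for $i>k$. Flagged Schur modules. Let $D=[a^{(1)},\dots,a^{(m)}]$ be a diagram, i.e. a finite tuple of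 finite subsets of $\mathbb{Z}_{>0}$ (columns). Let $n$ be at least the largest row index of a box of $D$, let $E$ have basis $z_1,\dots,z_n$ over $\mathbf{k}$, and for $0\le i\le n$ let $E_i=E/\langle z_{i+1},\dots,z_n\rangle$. Put $TE^D=\bigwedge^{r_1}E\otimes\cdots\otimes\bigwedge^{r_m}E$ with $r_j=|a^{(j)}|$; it has basis $z_\tau=\bigotimes_j z_{b^{(j)}_1}\wedge\cdots\wedge z_{b^{(j)}_{r_j}}$, where $\tau=(b^{(1)},\dots,b^{(m)})$, $b^{(j)}=\{b^{(j)}_1<\dots<b^{(j)}_{r_j}\}\subseteq\{1,\dots,n\}$. The $D$-exchange relations are the elements of the kernel of $TE^D\to\mathbf{k}[z_{pq}]_{1\le p,q\le n}$, $z_\tau\mapsto\prod_j\Delta_{a^{(j)},b^{(j)}}$, where $\Delta_{a,b}$ is the minor of the generic matrix $(z_{pq})$ on rows $a$ and columns $b$. For $a=\{a_1<\dots<a_r\}$, let $E_\bullet^a$ be the quotient of $\bigwedge^rE$ by the sum over $0\le i<r$ of the images of $\bigwedge^iE\otimes\bigwedge^{r-i}\ker(E\to E_{a_{i+1}})$; put $TE_\bullet^D=\bigotimes_jE_\bullet^{a^{(j)}}$. The flagged Schur module $E_\bullet^D$ is the quotient of $TE_\bullet^D$ by the image of the $D$-exchange relations. Its character is $\mathfrak{S}_D=\sum_\lambda\dim (E^D_\bullet)_\lambda\,x^\lambda\in\mathbb{Z}[x_1,x_2,\dots]$, with respect to the torus of diagonal matrices $\mathrm{diag}(t_1,\dots,t_n)$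 acting by $z_j\mapsto t_jz_j$. It does not depend on $n$. *)

theory Defs
  imports
    "HOL-Library.Poly_Mapping"
    "HOL-Combinatorics.Permutations"
    "Jordan_Normal_Form.Determinant"
begin

section \<open>Polynomials and free modules\<close>

text \<open>
  A polynomial over \<open>'a\<close> with variables indexed by \<open>'v\<close> is a finitely supported map from exponent
  vectors to coefficients.
\<close>

type_synonym ('v, 'a) poly_ring = "('v \<Rightarrow>\<^sub>0 nat) \<Rightarrow>\<^sub>0 'a"

definition pvar :: "'v \<Rightarrow> ('v, 'a::comm_ring_1) poly_ring" where
  "pvar v = Poly_Mapping.single (Poly_Mapping.single v 1) 1"

definition pconst :: "'a::comm_ring_1 \<Rightarrow> ('v, 'a) poly_ring" where
  "pconst c = Poly_Mapping.single 0 c"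

definition psubst :: "('v \<Rightarrow> ('u, 'a) poly_ring) \<Rightarrow> ('v, 'a::comm_ring_1) poly_ring \<Rightarrow> ('u, 'a) poly_ring"
  where "psubst \<sigma> f =
    (\<Sum>m\<in>Poly_Mapping.keys f.
       pconst (Poly_Mapping.lookup f m) *
       (\<Prod>v\<in>Poly_Mapping.keys m. \<sigma> v ^ Poly_Mapping.lookup m v))"

text \<open>\<open>'b \<Rightarrow>\<^sub>0 'a\<close> is also the free \<open>'a\<close>-module on the basis \<open>'b\<close>; its basis vectors are
  \<open>Poly_Mapping.single b 1\<close>.\<close>

definition fm_scale :: "'a::comm_ring_1 \<Rightarrow> ('b \<Rightarrow>\<^sub>0 'a) \<Rightarrow> ('b \<Rightarrow>\<^sub>0 'a)" where
  "fm_scale c v = Poly_Mapping.map (\<lambda>x. c * x) v"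

lemma lookup_fm_scale [simp]:
  "Poly_Mapping.lookup (fm_scale c v) b = c * Poly_Mapping.lookup v b"
  unfolding fm_scale_def by (simp add: Poly_Mapping.map.rep_eq when_def)

global_interpretation fm: Modules.module "fm_scale :: 'a::comm_ring_1 \<Rightarrow> ('b \<Rightarrow>\<^sub>0 'a) \<Rightarrow> ('b \<Rightarrow>\<^sub>0 'a)"
  by unfold_locales (auto intro!: poly_mapping_eqI simp: lookup_add algebra_simps)


section \<open>Schubert polynomials\<close>

definition fin_perm :: "(nat \<Rightarrow> nat) \<Rightarrow> bool" where
  "fin_perm w \<longleftrightarrow> w permutes {1..} \<and> finite {i. w i \<noteq> i}"

definition longest_perm :: "nat \<Rightarrow> nat \<Rightarrow> nat" where
  "longest_perm N i = (if 1 \<le> i \<and> i \<le> N then N + 1 - i else i)"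

definition swap_vars :: "nat \<Rightarrow> (nat, int) poly_ring \<Rightarrow> (nat, int) poly_ring" where
  "swap_vars k f = psubst (\<lambda>i. pvar (Transposition.transpose k (k + 1) i)) f"

text \<open>\<open>(f - s\<^sub>k f) / (x\<^sub>k - x\<^bsub>k+1\<^esub>)\<close>; the division is exact, and its result is unique because the
  polynomial ring is an integral domain.\<close>

definition divided_difference :: "nat \<Rightarrow> (nat, int) poly_ring \<Rightarrow> (nat, int) poly_ring" where
  "divided_difference k f = (THE g. (pvar k - pvar (k + 1)) * g = f - swap_vars k f)"

definition is_schubert_family :: "((nat \<Rightarrow> nat) \<Rightarrow> (nat, int) poly_ring) \<Rightarrow> bool" where
  "is_schubert_family S \<longleftrightarrow>
     (\<forall>N. S (longest_perm N) = (\<Prod>i = 1..N. pvar i ^ (N - i))) \<and>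
     (\<forall>w k. fin_perm w \<and> 1 \<le> k \<longrightarrow>
        divided_difference k (S w) =
          (if w k > w (k + 1) then S (w \<circ> Transposition.transpose k (k + 1)) else 0))"

text \<open>The defining properties determine the values at all finitary permutations, by descending from
  the longest elements; only the irrelevant values at other functions are left to the choice.\<close>

definition schubert :: "(nat \<Rightarrow> nat) \<Rightarrow> (nat, int) poly_ring" where
  "schubert = (SOME S. is_schubert_family S)"


section \<open>Diagrams\<close>

definition rothe_diagram :: "(nat \<Rightarrow> nat) \<Rightarrow> (nat \<times> nat) set" where
  "rothe_diagram w = {(i, j). 1 \<le> i \<and> 1 \<le> j \<and> j < w i \<and> i < inv_into UNIV w j}"

definition diagram_columns :: "nat \<Rightarrow> (nat \<times> nat) set \<Rightarrow> nat set list" where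
  "diagram_columns m B = map (\<lambda>j. {i. (i, j) \<in> B}) [1..<m + 1]"


section \<open>Exterior powers and tensor products\<close>

text \<open>
  The exterior algebra on \<open>z\<^sub>1, z\<^sub>2, \<dots>\<close> has the basis \<open>z\<^bsub>b1\<^esub> \<and> \<dots> \<and> z\<^bsub>br\<^esub>\<close> for
  \<open>b1 < \<dots> < br\<close>, encoded by the finite set \<open>b = {b1, \<dots>, br}\<close>; in particular \<open>z\<^sub>i\<close> is
  \<open>Poly_Mapping.single {i} 1\<close>.
\<close>

type_synonym 'k ext_alg = "nat set \<Rightarrow>\<^sub>0 'k"

definition wedge_sign :: "nat set \<Rightarrow> nat set \<Rightarrow> 'k::comm_ring_1" where
  "wedge_sign b c = (if b \<inter> c = {} then (- 1) ^ card {(i, j). i \<in> b \<and> j \<in> c \<and> j < i} else 0)"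

definition wedge :: "'k::comm_ring_1 ext_alg \<Rightarrow> 'k ext_alg \<Rightarrow> 'k ext_alg" where
  "wedge u v = (\<Sum>b\<in>Poly_Mapping.keys u. \<Sum>c\<in>Poly_Mapping.keys v.
     Poly_Mapping.single (b \<union> c)
       (wedge_sign b c * Poly_Mapping.lookup u b * Poly_Mapping.lookup v c))"

definition basis_span :: "nat set \<Rightarrow> 'k::field ext_alg set" where
  "basis_span I = fm.span ((\<lambda>i. Poly_Mapping.single {i} 1) ` I)"

text \<open>The image of \<open>\<And>\<^sup>r U\<close> in the exterior algebra, for a space \<open>U\<close> of vectors of degree one.\<close>

definition ext_power :: "nat \<Rightarrow> 'k::field ext_alg set \<Rightarrow> 'k ext_alg set" where
  "ext_power r U =
     fm.span {foldr wedge us (Poly_Mapping.single {} 1) | us. length us = r \<and> set us \<subseteq> U}"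

text \<open>\<open>E\<close> is \<open>basis_span {1..n}\<close>, and the kernel of \<open>E \<rightarrow> E\<^sub>i\<close> is spanned by \<open>z\<^bsub>i+1\<^esub>, \<dots>, z\<^sub>n\<close>.\<close>

definition flag_kernel :: "nat \<Rightarrow> nat \<Rightarrow> 'k::field ext_alg set" where
  "flag_kernel n i = basis_span {i + 1..n}"

text \<open>Tensors of \<open>m\<close> elements of the exterior algebra: the basis vector \<open>z\<^bsub>b1\<^esub> \<otimes> \<dots> \<otimes> z\<^bsub>bm\<^esub>\<close> is
  encoded by the list \<open>[b1, \<dots>, bm]\<close>.\<close>

fun tensor :: "'k::comm_ring_1 ext_alg list \<Rightarrow> (nat set list \<Rightarrow>\<^sub>0 'k)" where
  "tensor [] = Poly_Mapping.single [] 1"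
| "tensor (v # vs) = (\<Sum>b\<in>Poly_Mapping.keys v. \<Sum>\<tau>\<in>Poly_Mapping.keys (tensor vs).
     Poly_Mapping.single (b # \<tau>) (Poly_Mapping.lookup v b * Poly_Mapping.lookup (tensor vs) \<tau>))"

text \<open>The spaces of tuples of vectors from which the pure tensors of \<open>TE\<^sup>D\<close> are formed.\<close>

definition ext_tuples :: "nat \<Rightarrow> nat set list \<Rightarrow> 'k::field ext_alg list set" where
  "ext_tuples n D = {vs. list_all2 (\<lambda>v a. v \<in> ext_power (card a) (basis_span {1..n})) vs D}"

definition TE :: "nat \<Rightarrow> nat set list \<Rightarrow> (nat set list \<Rightarrow>\<^sub>0 'k::field) set" where
  "TE n D = fm.span (tensor ` ext_tuples n D)"


section \<open>The flagged Schur module\<close>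

text \<open>The minor of the generic matrix \<open>(z\<^bsub>pq\<^esub>)\<close> on rows \<open>a\<close> and columns \<open>b\<close>, where
  \<open>card a = card b\<close>.\<close>

definition generic_minor :: "nat set \<Rightarrow> nat set \<Rightarrow> (nat \<times> nat, 'k::comm_ring_1) poly_ring" where
  "generic_minor a b =
     det (mat (card a) (card a)
       (\<lambda>(i, j). pvar (sorted_list_of_set a ! i, sorted_list_of_set b ! j)))"

definition minor_map ::
  "nat set list \<Rightarrow> (nat set list \<Rightarrow>\<^sub>0 'k::comm_ring_1) \<Rightarrow> (nat \<times> nat, 'k) poly_ring" where
  "minor_map D f = (\<Sum>\<tau>\<in>Poly_Mapping.keys f.
     pconst (Poly_Mapping.lookup f \<tau>) * (\<Prod>j<length D. generic_minor (D ! j) (\<tau> ! j)))"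

definition exchange_relations :: "nat \<Rightarrow> nat set list \<Rightarrow> (nat set list \<Rightarrow>\<^sub>0 'k::field) set" where
  "exchange_relations n D = {f \<in> TE n D. minor_map D f = 0}"

text \<open>The kernel of \<open>\<And>\<^sup>r E \<rightarrow> E\<^sup>a\<close>. The list is indexed from 0, so the entry \<open>i\<close> of
  \<open>sorted_list_of_set a\<close> is \<open>a\<^bsub>i+1\<^esub>\<close>.\<close>

definition flag_relations :: "nat \<Rightarrow> nat set \<Rightarrow> 'k::field ext_alg set" where
  "flag_relations n a = fm.span (\<Union>i<card a.
     {wedge u v | u v. u \<in> ext_power i (basis_span {1..n}) \<and>
        v \<in> ext_power (card a - i) (flag_kernel n (sorted_list_of_set a ! i))})"

text \<open>The tensor product of the quotients \<open>\<And>\<^sup>r E / F\<close> is the quotient of \<open>TE\<^sup>D\<close> by the pure tensors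
  with at least one factor in the corresponding \<open>F\<close>.\<close>

definition tensor_flag_relations :: "nat \<Rightarrow> nat set list \<Rightarrow> (nat set list \<Rightarrow>\<^sub>0 'k::field) set" where
  "tensor_flag_relations n D = fm.span (tensor `
     {vs \<in> ext_tuples n D. \<exists>j<length D. vs ! j \<in> flag_relations n (D ! j)})"

definition schur_relations :: "nat \<Rightarrow> nat set list \<Rightarrow> (nat set list \<Rightarrow>\<^sub>0 'k::field) set" where
  "schur_relations n D = fm.span (tensor_flag_relations n D \<union> exchange_relations n D)"

definition coset :: "'v::ab_group_add set \<Rightarrow> 'v \<Rightarrow> 'v set" where
  "coset R v = (\<lambda>r. v + r) ` R"

definition flagged_schur_module ::
  "nat \<Rightarrow> nat set list \<Rightarrow> (nat set list \<Rightarrow>\<^sub>0 'k::field) set set" where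
  "flagged_schur_module n D = coset (schur_relations n D) ` TE n D"


section \<open>Weight spaces and the character\<close>

text \<open>
  Over a finite field the rational points of the torus do not separate weights (over the field with
  two elements there is only one point), so weights have to be taken with respect to the torus as an
  algebraic group. This is expressed through its generic point \<open>diag(t\<^sub>1, \<dots>, t\<^sub>n)\<close>: a vector \<open>v\<close>
  has weight \<open>\<lambda>\<close> if \<open>t \<cdot> v = t\<^sup>\<lambda> v\<close> after extension of scalars from \<open>'k\<close> to the polynomial ring in
  the \<open>t\<^sub>i\<close>.
\<close>

definition extend_scalars ::
  "(nat set list \<Rightarrow>\<^sub>0 'k::comm_ring_1) \<Rightarrow> (nat set list \<Rightarrow>\<^sub>0 (nat, 'k) poly_ring)" where
  "extend_scalars v = Poly_Mapping.map pconst v"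

definition torus_act ::
  "(nat set list \<Rightarrow>\<^sub>0 'k::comm_ring_1) \<Rightarrow> (nat set list \<Rightarrow>\<^sub>0 (nat, 'k) poly_ring)" where
  "torus_act v = (\<Sum>\<tau>\<in>Poly_Mapping.keys v. Poly_Mapping.single \<tau>
     (pconst (Poly_Mapping.lookup v \<tau>) * (\<Prod>b\<leftarrow>\<tau>. \<Prod>i\<in>b. pvar i)))"

definition weight_space ::
  "nat \<Rightarrow> nat set list \<Rightarrow> (nat \<Rightarrow>\<^sub>0 nat) \<Rightarrow> (nat set list \<Rightarrow>\<^sub>0 'k::field) set set" where
  "weight_space n D l = {C \<in> flagged_schur_module n D. \<forall>v\<in>C.
     torus_act v - fm_scale (Poly_Mapping.single l 1) (extend_scalars v)
       \<in> fm.span (extend_scalars ` schur_relations n D)}"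

text \<open>\<open>B\<close> consists of representatives, one for each element, of a basis of the space \<open>Q\<close> of cosets
  of \<open>R\<close>.\<close>

definition is_coset_basis ::
  "('b \<Rightarrow>\<^sub>0 'k::field) set \<Rightarrow> ('b \<Rightarrow>\<^sub>0 'k) set set \<Rightarrow> ('b \<Rightarrow>\<^sub>0 'k) set \<Rightarrow> bool" where
  "is_coset_basis R Q B \<longleftrightarrow> finite B \<and> coset R ` fm.span B = Q \<and>
     (\<forall>c. (\<Sum>b\<in>B. fm_scale (c b) b) \<in> R \<longrightarrow> (\<forall>b\<in>B. c b = 0))"

definition coset_dim :: "('b \<Rightarrow>\<^sub>0 'k::field) set \<Rightarrow> ('b \<Rightarrow>\<^sub>0 'k) set set \<Rightarrow> nat" where
  "coset_dim R Q = (THE d. \<exists>B. is_coset_basis R Q B \<and> card B = d)"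

text \<open>All weights have nonnegative entries, since the entries of a basis tensor do. \<open>Sum_any\<close> is
  the sum over all \<open>l\<close>, of which only finitely many contribute.\<close>

definition schur_character :: "'k::field itself \<Rightarrow> nat \<Rightarrow> nat set list \<Rightarrow> (nat, int) poly_ring" where
  "schur_character _ n D = Sum_any (\<lambda>l. Poly_Mapping.single l
     (int (coset_dim (schur_relations n D :: (nat set list \<Rightarrow>\<^sub>0 'k) set) (weight_space n D l))))"

end

theory Submission
  imports Defs "HOL-Library.Product_Lexorder"
begin

text \<open>
  Let \<open>c\<^sub>w(\<mu>)\<close> be the coefficient of \<open>x\<^sup>\<mu>\<close> in the Schubert polynomial of \<open>w\<close>, and let \<open>k\<close> be the largest
  index with \<open>\<mu>\<^sub>k \<noteq> 0\<close>. Comparing coefficients in the definition of the divided difference gives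
  \<open>c\<^sub>w(\<mu>) = c\<^sub>w(s\<^sub>k \<mu>)\<close> if \<open>w(k) < w(k+1)\<close>, and \<open>c\<^sub>w(\<mu>) = c\<^sub>w(s\<^sub>k \<mu>) + c\<^sub>v(\<mu> - e\<^sub>k)\<close> with \<open>v = w s\<^sub>k\<close> if
  \<open>w(k) > w(k+1)\<close>. By induction along this recursion, the weight space of weight \<open>\<mu>\<close> has dimension
  \<open>c\<^sub>w(\<mu>)\<close>.

  Upper bound: basis tensors of weight \<open>s\<^sub>k \<mu>\<close> become basis tensors of weight \<open>\<mu>\<close> by replacing \<open>z\<^bsub>k+1\<^esub>\<close> by
  \<open>z\<^sub>k\<close>. The relations are preserved up to tensors that became admissible; modulo the exchange
  relations, these are multiples of \<open>z\<^sub>k\<close> in the column \<open>w(k+1)\<close>, and this multiplication maps the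
  relations for \<open>v\<close> to relations for \<open>w\<close>. Tensors of exterior powers are treated as elements of one large
  exterior algebra with a generator for each column and each index, in which the relations are products
  of sums of generators.

  Lower bound: the products of minors of a generic lower triangular matrix satisfy all the relations. On
  the products that come from \<open>v\<close> one can split off the diagonal entry \<open>z\<^bsub>kk\<^esub>\<close>; the substitution with
  \<open>z\<^bsub>kk\<^esub> = 0\<close> and \<open>z\<^bsub>pk\<^esub>\<close> replaced by \<open>z\<^bsub>p,k+1\<^esub>\<close> kills these and recovers the products for \<open>s\<^sub>k \<mu>\<close>.
\<close>

\<comment> \<open>The two bounds look at different relations. The upper bound draws only on those
  exchange relations that come from products with too many factors on two columns, while the
  triangular minors of the lower bound satisfy all of them. Equal counts then close the gap. The
  obstacle is the multiplication by \<open>z_k\<close> in the column \<open>j0 = w(k+1)\<close>. Row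
  \<open>k\<close> belongs to this column for \<open>w\<close> but not for \<open>v\<close>, so a
  relation of \<open>v\<close> between \<open>j0\<close> and a column \<open>j\<close> without row
  \<open>k\<close> is one factor short of a relation of \<open>w\<close>. The missing factor comes
  from widening the new factor \<open>({j0}, k)\<close> to \<open>({j0, j}, k)\<close>, which is
  harmless if all rows of column \<open>j\<close> are smaller than \<open>k\<close>. Otherwise
  column \<open>j1 = w(k)\<close> mediates: it contains the rows of column \<open>j\<close> smaller
  than \<open>k\<close> and is itself contained in column \<open>j0\<close>. Products of sums of
  generators are expanded without symmetrization or denominators, so both bounds hold over any
  commutative ring; a field enters only with the module itself.\<close>
alias keys = Poly_Mapping.keys
alias lookup = Poly_Mapping.lookup
alias single = Poly_Mapping.single

section \<open>Linear and exterior algebra over a commutative ring\<close>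

section \<open>Free modules\<close>

abbreviation flin :: "(('b \<Rightarrow>\<^sub>0 'a::comm_ring_1) \<Rightarrow> ('c \<Rightarrow>\<^sub>0 'a)) \<Rightarrow> bool" where
  "flin f \<equiv> Modules.module_hom fm_scale fm_scale f"

lemma flinI:
  assumes "\<And>u v. f (u + v) = f u + f v" "\<And>c v. f (fm_scale c v) = fm_scale c (f v)"
  shows "flin f"
  using assms by unfold_locales auto

lemmas flin_add = module_hom.add
lemmas flin_scale = module_hom.scale
lemmas flin_zero = module_hom.zero
lemmas flin_sum = module_hom.sum

lemma fm_scale_single [simp]: "fm_scale c (single b d) = single b (c * d)"
  by (rule poly_mapping_eqI) (simp add: lookup_single when_def)

lemma fm_scale_eq_pconst_mult: "fm_scale c f = pconst c * (f :: ('v, 'a::comm_ring_1) poly_ring)"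
  unfolding fm_scale_def pconst_def by (rule mult_map_scale_conv_mult)

lemma poly_mapping_expand:
  assumes "finite A" "keys v \<subseteq> A"
  shows "v = (\<Sum>b\<in>A. fm_scale (lookup v b) (single b 1))"
proof (rule poly_mapping_eqI)
  fix k
  have "lookup v k = (\<Sum>b\<in>A. if b = k then lookup v k else 0)"
    using assms by (auto simp: in_keys_iff)
  also have "\<dots> = lookup (\<Sum>b\<in>A. fm_scale (lookup v b) (single b 1)) k"
    unfolding lookup_sum by (rule sum.cong) (auto simp: lookup_single when_def)
  finally show "lookup v k = lookup (\<Sum>b\<in>A. fm_scale (lookup v b) (single b 1)) k" .
qed

text \<open>Agreement is asked only on the support of \<open>v\<close>, so that hypotheses about
  \<open>v\<close>, such as a missing index or a given shape, can be used for the basis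
  vectors.\<close>

lemma flin_eqI:
  assumes "flin f" "flin g" "\<And>b. b \<in> keys v \<Longrightarrow> f (single b 1) = g (single b 1)"
  shows "f v = g v"
proof -
  have e: "v = (\<Sum>b\<in>keys v. fm_scale (lookup v b) (single b 1))"
    by (rule poly_mapping_expand) auto
  show ?thesis
    by (subst e, subst (3) e)
       (simp only: flin_sum[OF assms(1)] flin_sum[OF assms(2)] flin_scale[OF assms(1)]
          flin_scale[OF assms(2)] assms(3) cong: sum.cong)
qed

lemma flin_span:
  assumes "flin f" "v \<in> fm.span S" "\<And>x. x \<in> S \<Longrightarrow> f x \<in> fm.span T"
  shows "f v \<in> fm.span T"
  using assms(2)
proof (induction rule: fm.span_induct_alt)
  case base
  show ?case using flin_zero[OF assms(1)] by (simp add: fm.span_zero)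
next
  case (step c x y)
  then show ?case
    using assms(3) by (simp add: flin_add[OF assms(1)] flin_scale[OF assms(1)] fm.span_add fm.span_scale)
qed

lemma span_subset_trans: "v \<in> fm.span S \<Longrightarrow> S \<subseteq> fm.span T \<Longrightarrow> v \<in> fm.span T"
  by (meson fm.span_minimal fm.subspace_span subsetD)

lemma span_single_iff: "v \<in> fm.span ((\<lambda>b. single b 1) ` S) \<longleftrightarrow> keys v \<subseteq> S"
  for v :: "'b \<Rightarrow>\<^sub>0 'a::comm_ring_1"
proof
  assume "v \<in> fm.span ((\<lambda>b. single b 1) ` S)"
  then show "keys v \<subseteq> S"
  proof (induction rule: fm.span_induct_alt)
    case base
    show ?case by simp
  next
    case (step c x y)
    then show ?case
      by (auto simp: in_keys_iff lookup_add lookup_single when_def split: if_splits)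
  qed
next
  assume "keys v \<subseteq> S"
  then have "(\<Sum>b\<in>keys v. fm_scale (lookup v b) (single b 1)) \<in> fm.span ((\<lambda>b. single b 1) ` S)"
    by (intro fm.span_sum fm.span_scale fm.span_base) auto
  then show "v \<in> fm.span ((\<lambda>b. single b 1) ` S)"
    by (subst poly_mapping_expand[of "keys v"]) auto
qed

definition lext :: "('b \<Rightarrow> ('c \<Rightarrow>\<^sub>0 'a)) \<Rightarrow> ('b \<Rightarrow>\<^sub>0 'a::comm_ring_1) \<Rightarrow> ('c \<Rightarrow>\<^sub>0 'a)" where
  "lext g v = (\<Sum>b\<in>keys v. fm_scale (lookup v b) (g b))"

lemma lext_superset:
  "finite A \<Longrightarrow> keys v \<subseteq> A \<Longrightarrow> lext g v = (\<Sum>b\<in>A. fm_scale (lookup v b) (g b))"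
  unfolding lext_def by (rule sum.mono_neutral_left) (auto simp: in_keys_iff)

lemma flin_lext: "flin (lext g)"
proof (rule flinI)
  fix u v :: "'b \<Rightarrow>\<^sub>0 'a"
  have "keys (u + v) \<subseteq> keys u \<union> keys v" by (rule keys_add)
  then show "lext g (u + v) = lext g u + lext g v"
    by (subst (1 2 3) lext_superset[of "keys u \<union> keys v"])
       (auto simp: lookup_add fm.scale_left_distrib sum.distrib)
next
  fix c and v :: "'b \<Rightarrow>\<^sub>0 'a"
  have "keys (fm_scale c v) \<subseteq> keys v" by (auto simp: in_keys_iff)
  then show "lext g (fm_scale c v) = fm_scale c (lext g v)"
    by (subst (1 2) lext_superset[of "keys v"]) (auto simp: fm.scale_sum_right)
qed

lemma lext_single [simp]: "lext g (single b c) = fm_scale c (g b)"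
  by (subst lext_superset[of "{b}"]) auto

lemma flin_comp: "flin f \<Longrightarrow> flin g \<Longrightarrow> flin (\<lambda>v. f (g v))"
  by (rule flinI) (simp_all add: flin_add flin_scale)

lemma flin_sum_fun: "(\<And>i. i \<in> I \<Longrightarrow> flin (f i)) \<Longrightarrow> flin (\<lambda>v. \<Sum>i\<in>I. f i v)"
proof (rule flinI)
  assume f: "\<And>i. i \<in> I \<Longrightarrow> flin (f i)"
  fix u v c
  show "(\<Sum>i\<in>I. f i (u + v)) = (\<Sum>i\<in>I. f i u) + (\<Sum>i\<in>I. f i v)"
    unfolding sum.distrib[symmetric] by (rule sum.cong) (auto simp: flin_add[OF f])
  show "(\<Sum>i\<in>I. f i (fm_scale c v)) = fm_scale c (\<Sum>i\<in>I. f i v)"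
    unfolding fm.scale_sum_right by (rule sum.cong) (auto simp: flin_scale[OF f])
qed

lemma flin_scale_fun: "flin f \<Longrightarrow> flin (\<lambda>v. fm_scale c (f v))"
  by (rule flinI) (simp_all add: flin_add flin_scale fm.scale_right_distrib mult.commute)

section \<open>Anticommuting operators\<close>

locale anticommuting =
  fixes Y :: "'i \<Rightarrow> 'v::ab_group_add \<Rightarrow> 'v"
  assumes add: "Y x (u + v) = Y x u + Y x v"
    and square: "Y x (Y x v) = 0"
    and swap: "Y x (Y y v) = - Y y (Y x v)"
begin

lemma zero [simp]: "Y x 0 = 0"
  using add[of x 0 0] by simp

lemma minus [simp]: "Y x (- v) = - Y x v"
  using add[of x v "- v"] by (simp add: eq_neg_iff_add_eq_0 add.commute)

lemma foldr_minus [simp]: "foldr Y xs (- v) = - foldr Y xs v"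
  by (induction xs) auto

lemma foldr_move:
  "foldr Y (xs @ x # ys) v =
    (if even (length xs) then foldr Y (x # xs @ ys) v else - foldr Y (x # xs @ ys) v)"
  by (induction xs) (auto simp: swap[of _ x])

lemma foldr_member: "x \<in> set xs \<Longrightarrow> Y x (foldr Y xs v) = 0"
proof (induction xs)
  case (Cons a xs)
  then show ?case by (cases "x = a") (simp_all add: square swap[of x a])
qed simp

lemma foldr_not_distinct: "\<not> distinct xs \<Longrightarrow> foldr Y xs v = 0"
  by (induction xs) (auto simp: foldr_member)

lemma foldr_mset:
  "mset xs = mset ys \<Longrightarrow> foldr Y xs v = foldr Y ys v \<or> foldr Y xs v = - foldr Y ys v"
proof (induction xs arbitrary: ys)
  case Nil
  then show ?case by simp
next
  case (Cons x xs)
  then have "x \<in> set ys" by (metis list.set_intros(1) set_mset_mset)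
  then obtain ys1 ys2 where ys: "ys = ys1 @ x # ys2" by (meson split_list)
  with Cons.prems have "mset xs = mset (ys1 @ ys2)" by simp
  from Cons.IH[OF this]
  have "foldr Y xs v = foldr Y (ys1 @ ys2) v \<or> foldr Y xs v = - foldr Y (ys1 @ ys2) v" .
  then show ?case
    unfolding ys foldr_move by auto
qed

end

text \<open>The pigeonhole principle of exterior algebras: expanding the combinations gives words
  with more than \<open>card P\<close> letters from \<open>P\<close>, and a repeated letter kills a
  word. The prefix \<open>ps\<close> of distinct letters is the part already expanded, which lets
  the induction run over \<open>cs\<close>.\<close>

lemma anticommuting_product_eq_0:
  assumes "anticommuting e" "\<And>p. flin (e p)" "finite P"
    and "distinct ps" "set ps \<subseteq> P" "card P < length ps + length cs"
  shows "foldr e ps (foldr (\<lambda>c v. \<Sum>p\<in>P. fm_scale (c p) (e p v)) cs v) = 0"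
  using assms(4-)
proof (induction cs arbitrary: ps)
  case Nil
  then show ?case
    by (metis add.right_neutral assms(3) card_mono distinct_card leD list.size(3))
next
  case (Cons c cs)
  interpret anticommuting e by fact
  let ?w = "foldr (\<lambda>c v. \<Sum>p\<in>P. fm_scale (c p) (e p v)) cs v"
  have fl: "flin (foldr e ps)"
    by (induction ps) (auto intro: flin_comp assms(2) flinI simp: id_def comp_def)
  have "foldr e ps (\<Sum>p\<in>P. fm_scale (c p) (e p ?w)) = (\<Sum>p\<in>P. fm_scale (c p) (foldr e (ps @ [p]) ?w))"
    by (simp add: flin_sum[OF fl] flin_scale[OF fl])
  also have "\<dots> = 0"
  proof (rule sum.neutral, rule ballI)
    fix p assume p: "p \<in> P"
    have "foldr e (ps @ [p]) ?w = 0"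
    proof (cases "p \<in> set ps")
      case True
      then show ?thesis by (intro foldr_not_distinct) auto
    next
      case False
      then show ?thesis using Cons.prems p by (intro Cons.IH) auto
    qed
    then show "fm_scale (c p) (foldr e (ps @ [p]) ?w) = 0" by simp
  qed
  finally show ?case by simp
qed

section \<open>Creation operators\<close>

text \<open>The vectors \<open>single \<tau> 1\<close> form a basis of the exterior algebra on a linearly ordered type, and
  \<open>theta x\<close> is the multiplication by \<open>x\<close> from the left.\<close>

definition theta :: "'i::linorder \<Rightarrow> ('i set \<Rightarrow>\<^sub>0 'a::comm_ring_1) \<Rightarrow> ('i set \<Rightarrow>\<^sub>0 'a)" where
  "theta x = lext (\<lambda>\<tau>. if x \<in> \<tau> \<or> infinite \<tau> then 0
     else single (insert x \<tau>) ((- 1) ^ card {y \<in> \<tau>. y < x}))"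

lemma flin_theta: "flin (theta x)"
  unfolding theta_def by (rule flin_lext)

lemma theta_single:
  "theta x (single \<tau> c) = (if x \<in> \<tau> \<or> infinite \<tau> then 0
     else single (insert x \<tau>) (c * (- 1) ^ card {y \<in> \<tau>. y < x}))"
  by (simp add: theta_def)

text \<open>Only \<open>D - {x}\<close> can contribute to the coefficient at \<open>D\<close>;
  identities between operators thereby become sign checks for a fixed \<open>D\<close>.\<close>

lemma lookup_theta:
  "lookup (theta x v) D =
    (if x \<in> D \<and> finite D then (- 1) ^ card {y \<in> D. y < x} * lookup v (D - {x}) else 0)"
proof -
  have "lookup (theta x v) D = (\<Sum>b\<in>keys v. lookup v b *
      lookup (if x \<in> b \<or> infinite b then 0 else single (insert x b) ((- 1) ^ card {y \<in> b. y < x})) D)"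
    by (simp add: theta_def lext_def lookup_sum)
  also have "\<dots> = (\<Sum>b\<in>keys v. if b = D - {x} then
      (if x \<in> D \<and> finite D then (- 1) ^ card {y \<in> D. y < x} * lookup v (D - {x}) else 0) else 0)"
  proof (rule sum.cong[OF refl])
    fix b
    let ?s = "if x \<in> D \<and> finite D then (- 1) ^ card {y \<in> D. y < x} * lookup v (D - {x}) else 0"
    show "lookup v b *
      lookup (if x \<in> b \<or> infinite b then 0 else single (insert x b) ((- 1) ^ card {y \<in> b. y < x})) D
      = (if b = D - {x} then ?s else 0)"
    proof (cases "x \<in> b \<or> infinite b")
      case True
      then have "b = D - {x} \<Longrightarrow> infinite D" by auto
      with True show ?thesis by auto
    next
      case False
      have eq: "insert x b = D \<longleftrightarrow> x \<in> D \<and> b = D - {x}" using False by blast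
      show ?thesis
      proof (cases "x \<in> D \<and> b = D - {x}")
        case True
        then have "{y \<in> b. y < x} = {y \<in> D. y < x}" by auto
        with True False eq show ?thesis by (simp add: mult.commute)
      next
        case nt: False
        then have "insert x b \<noteq> D" using eq by simp
        then have "lookup v b * lookup (single (insert x b) ((- 1) ^ card {y \<in> b. y < x})) D = 0"
          by (simp add: lookup_single)
        moreover have "(if b = D - {x} then ?s else 0) = 0" using nt by auto
        ultimately show ?thesis using False by (simp only: if_False)
      qed
    qed
  qed
  also have "\<dots> = (if x \<in> D \<and> finite D then (- 1) ^ card {y \<in> D. y < x} * lookup v (D - {x}) else 0)"
    by (simp add: in_keys_iff)
  finally show ?thesis .
qed

text \<open>Removing the smaller element lowers the position of the larger one by one, while
  removing the larger leaves the position of the smaller unchanged. This single difference is the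
  sign.\<close>

lemma theta_sign_swap:
  assumes "finite D" "x \<in> D" "y \<in> D" "x < (y::'i::linorder)"
  shows "(- 1 :: 'a::comm_ring_1) ^ card {z \<in> D. z < y} * (- 1) ^ card {z \<in> D - {y}. z < x} =
    - ((- 1) ^ card {z \<in> D. z < x} * (- 1) ^ card {z \<in> D - {x}. z < y})"
proof -
  have "{z \<in> D. z < y} = insert x {z \<in> D - {x}. z < y}" using assms by auto
  then have 1: "card {z \<in> D. z < y} = Suc (card {z \<in> D - {x}. z < y})" using assms(1) by simp
  have 2: "{z \<in> D - {y}. z < x} = {z \<in> D. z < x}" using assms by auto
  show ?thesis unfolding 1 2 by simp
qed

lemma theta_theta: "theta x (theta x v) = 0"
  by (rule poly_mapping_eqI) (simp add: lookup_theta)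

lemma theta_swap: "theta x (theta y v) = - theta y (theta x v)"
proof (cases "x = y")
  case True
  then show ?thesis by (simp add: theta_theta)
next
  case False
  show ?thesis
  proof (rule poly_mapping_eqI)
    fix D
    show "lookup (theta x (theta y v)) D = lookup (- theta y (theta x v)) D"
    proof (cases "finite D \<and> x \<in> D \<and> y \<in> D")
      case True
      have e: "D - {x} - {y} = D - {y} - {x}" by auto
      have "lookup (theta x (theta y v)) D
        = ((- 1) ^ card {z \<in> D. z < x} * (- 1) ^ card {z \<in> D - {x}. z < y}) * lookup v (D - {x} - {y})"
        using True False by (simp add: lookup_theta mult.assoc)
      also have "\<dots> = - ((- 1) ^ card {z \<in> D. z < y} * (- 1) ^ card {z \<in> D - {y}. z < x}) * lookup v (D - {y} - {x})"
      proof (cases "x < y")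
        case True
        then show ?thesis using \<open>finite D \<and> x \<in> D \<and> y \<in> D\<close> by (subst theta_sign_swap) (auto simp: e)
      next
        case False
        then have "y < x" using \<open>x \<noteq> y\<close> by auto
        then show ?thesis using \<open>finite D \<and> x \<in> D \<and> y \<in> D\<close> by (subst theta_sign_swap) (auto simp: e)
      qed
      also have "\<dots> = lookup (- theta y (theta x v)) D"
        using True False by (simp add: lookup_theta mult.assoc)
      finally show ?thesis .
    qed (auto simp: lookup_theta)
  qed
qed

lemma anticommuting_theta: "anticommuting theta"
  by (rule anticommuting.intro, rule flin_add[OF flin_theta], rule theta_theta, rule theta_swap)

definition comb :: "('i \<Rightarrow> 'a) \<Rightarrow> 'i set \<Rightarrow> ('i::linorder set \<Rightarrow>\<^sub>0 'a::comm_ring_1) \<Rightarrow> ('i set \<Rightarrow>\<^sub>0 'a)" where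
  "comb c I v = (\<Sum>i\<in>I. fm_scale (c i) (theta i v))"

lemma flin_comb: "flin (comb c I)"
proof -
  have "comb c I = (\<lambda>v. \<Sum>i\<in>I. fm_scale (c i) (theta i v))" by (simp add: comb_def fun_eq_iff)
  then show ?thesis by (simp add: flin_sum_fun flin_scale_fun flin_theta)
qed

lemma comb_theta_swap: "comb c I (theta x v) = - theta x (comb c I v)"
  by (simp add: comb_def flin_sum[OF flin_theta] flin_scale[OF flin_theta] theta_swap[of _ x] sum_negf)

lemma comb_swap: "comb c I (comb d J v) = - comb d J (comb c I v)"
  unfolding comb_def[of d J]
  by (simp add: flin_sum[OF flin_comb] flin_scale[OF flin_comb] comb_theta_swap sum_negf)

text \<open>Anticommutation alone shows only that twice the square is 0. Splitting off one generator
  at a time covers characteristic 2 as well.\<close>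

lemma comb_square: "comb c I (comb c I v) = 0"
proof (induction I arbitrary: v rule: infinite_finite_induct)
  case (insert x F)
  have e: "comb c (insert x F) v = fm_scale (c x) (theta x v) + comb c F v" for v
    using insert by (simp add: comb_def)
  show ?case
    unfolding e
    by (simp add: flin_add[OF flin_theta] flin_scale[OF flin_theta] theta_theta flin_add[OF flin_comb]
      flin_scale[OF flin_comb] comb_theta_swap insert.IH)
qed (auto simp: comb_def)

lemma anticommuting_comb: "anticommuting (\<lambda>l. comb (c l) (I l))"
  by (rule anticommuting.intro, rule flin_add[OF flin_comb], rule comb_square, rule comb_swap)

lemma comb_union: "finite I \<Longrightarrow> finite J \<Longrightarrow> I \<inter> J = {} \<Longrightarrow> comb c (I \<union> J) v = comb c I v + comb c J v"
  by (simp add: comb_def sum.union_disjoint)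

lemma comb_singleton [simp]: "comb c {x} v = fm_scale (c x) (theta x v)"
  by (simp add: comb_def)

lemma foldr_theta_sorted:
  "sorted_wrt (<) xs \<Longrightarrow> foldr theta xs (single {} 1) = single (set xs) (1::'a::comm_ring_1)"
proof (induction xs)
  case (Cons x xs)
  then have e: "{y \<in> set xs. y < x} = {}" and "x \<notin> set xs" by auto
  with Cons show ?case by (simp add: theta_single e)
qed simp

lemma foldr_theta:
  "foldr theta xs (single {} 1) = (if distinct xs then single (set xs) 1 else (0::_ \<Rightarrow>\<^sub>0 'a::comm_ring_1))
   \<or> foldr theta xs (single {} 1) = - (if distinct xs then single (set xs) 1 else (0::_ \<Rightarrow>\<^sub>0 'a::comm_ring_1))"
proof (cases "distinct xs")
  case True
  interpret anticommuting "theta :: 'b \<Rightarrow> (_ \<Rightarrow>\<^sub>0 'a) \<Rightarrow> _" by (rule anticommuting_theta)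
  have "sorted_wrt (<) (sort xs)" using True by (simp add: strict_sorted_iff)
  from foldr_theta_sorted[OF this]
  have e: "foldr theta (sort xs) (single {} 1) = single (set xs) (1::'a)" by simp
  show ?thesis using foldr_mset[of xs "sort xs" "single {} 1"] True unfolding e by simp
next
  case False
  interpret anticommuting "theta :: 'b \<Rightarrow> (_ \<Rightarrow>\<^sub>0 'a) \<Rightarrow> _" by (rule anticommuting_theta)
  show ?thesis using False foldr_not_distinct by auto
qed

text \<open>The sign for inserting a factor at its sorted position is the sign in \<open>theta\<close>.\<close>

lemma foldr_insert_sorted:
  assumes "anticommuting Y" "finite \<tau>" "x \<notin> \<tau>"
  shows "foldr Y (sorted_list_of_set (insert x \<tau>)) v =
    (if even (card {y \<in> \<tau>. y < x}) then Y x (foldr Y (sorted_list_of_set \<tau>) v)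
     else - Y x (foldr Y (sorted_list_of_set \<tau>) v))"
proof -
  interpret anticommuting Y by fact
  let ?l = "sorted_list_of_set {y \<in> \<tau>. y < x}" and ?r = "sorted_list_of_set {y \<in> \<tau>. x < y}"
  have "sorted_list_of_set \<tau> = ?l @ ?r"
    using assms(2,3) by (intro sorted_distinct_set_unique) (auto simp: sorted_append, metis linorder_neqE)
  moreover have "sorted_list_of_set (insert x \<tau>) = ?l @ x # ?r"
  proof -
    have "sorted_list_of_set (set (?l @ x # ?r)) = ?l @ x # ?r"
      using assms(2) by (intro sorted_list_of_set.idem_if_sorted_distinct) (auto simp: sorted_append)
    moreover have "set (?l @ x # ?r) = insert x \<tau>" using assms(2,3) by auto
    ultimately show ?thesis by (simp only:)
  qed
  ultimately show ?thesis using assms(2) by (simp add: foldr_move del: foldr.simps foldr_append) simp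
qed

section \<open>Upper bound: relations in the exterior algebra and spanning sets of tensors\<close>

section \<open>Products of column sums\<close>

text \<open>The set \<open>\<tau>\<close> of pairs \<open>(j, u)\<close> encodes the basis tensor with column \<open>j\<close> consisting of the \<open>z\<^sub>u\<close>,
  \<open>(j, u) \<in> \<tau>\<close>.\<close>

definition wt :: "(nat \<times> nat) set \<Rightarrow> (nat \<Rightarrow>\<^sub>0 nat)" where
  "wt \<tau> = (\<Sum>x\<in>\<tau>. single (snd x) 1)"

definition colset :: "nat \<Rightarrow> (nat \<times> nat) set \<Rightarrow> nat set" where
  "colset j \<tau> = {u. (j, u) \<in> \<tau>}"

text \<open>The counting form of the comparison of sorted entries: the r-th element of
  \<open>b\<close> is at most the r-th element of \<open>a\<close>, for every r. The first clause
  excludes the index 0, for which there is no \<open>z\<close>.\<close>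

definition flag_le :: "nat set \<Rightarrow> nat set \<Rightarrow> bool" where
  "flag_le b a \<longleftrightarrow> 0 \<notin> b \<and> card a = card b \<and> (\<forall>i. card (a \<inter> {..i}) \<le> card (b \<inter> {..i}))"

text \<open>All columns are tested: where \<open>a j\<close> is empty, column \<open>j\<close> of
  \<tau> has to be empty too.\<close>

definition flagged :: "(nat \<Rightarrow> nat set) \<Rightarrow> (nat \<times> nat) set \<Rightarrow> bool" where
  "flagged a \<tau> \<longleftrightarrow> (\<forall>j. flag_le (colset j \<tau>) (a j))"

text \<open>A factor \<open>(C, u)\<close> stands for the sum over the columns in \<open>C\<close> of the generators with index \<open>u\<close>.\<close>

definition fop :: "nat set \<times> nat \<Rightarrow> ((nat \<times> nat) set \<Rightarrow>\<^sub>0 'k::comm_ring_1) \<Rightarrow> ((nat \<times> nat) set \<Rightarrow>\<^sub>0 'k)" where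
  "fop l = comb (\<lambda>_. 1) (fst l \<times> {snd l})"

definition prodL :: "(nat set \<times> nat) list \<Rightarrow> ((nat \<times> nat) set \<Rightarrow>\<^sub>0 'k::comm_ring_1)" where
  "prodL L = foldr fop L (single {} 1)"

text \<open>The monomials that can occur when the product is expanded, each factor choosing one of
  its columns. Signs are ignored, so this is only an upper bound for the support, see
  \<open>keys_prodL\<close>.\<close>

fun mons :: "(nat set \<times> nat) list \<Rightarrow> (nat \<times> nat) set set" where
  "mons [] = {{}}"
| "mons (l # L) = {insert (c, snd l) \<tau> | c \<tau>. c \<in> fst l \<and> \<tau> \<in> mons L \<and> (c, snd l) \<notin> \<tau>}"

definition wtm :: "(nat set \<times> nat) multiset \<Rightarrow> (nat \<Rightarrow>\<^sub>0 nat)" where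
  "wtm X = (\<Sum>l\<in>#X. single (snd l) 1)"

definition cnt :: "(nat set \<Rightarrow> bool) \<Rightarrow> (nat set \<times> nat) multiset \<Rightarrow> nat" where
  "cnt p X = size (filter_mset (\<lambda>l. p (fst l)) X)"

text \<open>As predicates for \<open>cnt\<close>, \<open>inside J\<close> selects the factors
  certain to land in the columns \<open>J\<close>, and \<open>meets J\<close> those that can. The
  two counts enclose the degree of every monomial in \<open>J\<close>, see
  \<open>mons_count\<close>.\<close>

definition inside :: "nat set \<Rightarrow> nat set \<Rightarrow> bool" where "inside J C \<longleftrightarrow> C \<subseteq> J"

definition meets :: "nat set \<Rightarrow> nat set \<Rightarrow> bool" where "meets J C \<longleftrightarrow> C \<inter> J \<noteq> {}"

lemma cnt_empty [simp]: "cnt p {#} = 0"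
  by (simp add: cnt_def)

lemma cnt_add [simp]: "cnt p (add_mset l X) = (if p (fst l) then Suc (cnt p X) else cnt p X)"
  by (simp add: cnt_def)

lemma cnt_union [simp]: "cnt p (X + Y) = cnt p X + cnt p Y"
  by (simp add: cnt_def)

lemma cnt_Pair [simp]: "cnt p (image_mset (Pair C) Q) = (if p C then size Q else 0)"
  by (induction Q) auto

lemma cnt_eq_0: "(\<And>l. l \<in># X \<Longrightarrow> \<not> p (fst l)) \<Longrightarrow> cnt p X = 0"
  by (simp add: cnt_def filter_mset_eq_conv)

lemma cnt_mono: "(\<And>C. p C \<Longrightarrow> q C) \<Longrightarrow> cnt p X \<le> cnt q X"
  by (induction X) (auto simp: le_SucI)

lemma wtm_add [simp]: "wtm (add_mset l X) = single (snd l) 1 + wtm X"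
  by (simp add: wtm_def)

lemma wtm_empty [simp]: "wtm {#} = 0"
  by (simp add: wtm_def)

lemma wt_insert: "finite \<tau> \<Longrightarrow> x \<notin> \<tau> \<Longrightarrow> wt (insert x \<tau>) = single (snd x) 1 + wt \<tau>"
  by (simp add: wt_def)

lemma anticommuting_fop: "anticommuting fop"
  using anticommuting_comb[of "\<lambda>_ _. 1" "\<lambda>l. fst l \<times> {snd l}"] by (simp add: fop_def[abs_def])

lemma fop_single_col [simp]: "fop ({j}, u) = theta (j, u)"
  by (rule ext) (simp add: fop_def)

lemma fop_union: "finite C \<Longrightarrow> finite C' \<Longrightarrow> C \<inter> C' = {} \<Longrightarrow> fop (C \<union> C', u) v = fop (C, u) v + fop (C', u) v"
proof -
  assume "finite C" "finite C'" "C \<inter> C' = {}"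
  then show ?thesis
    using comb_union[of "C \<times> {u}" "C' \<times> {u}" "\<lambda>_. 1" v]
    by (simp add: fop_def Sigma_Un_distrib1 Times_Int_Times)
qed

lemma fop_empty [simp]: "fop ({}, u) v = 0"
  by (simp add: fop_def comb_def)

lemma prodL_Cons: "prodL (l # L) = fop l (prodL L)"
  by (simp add: prodL_def)

lemma prodL_mset: "mset L = mset L' \<Longrightarrow>
  prodL L = (prodL L' :: _ \<Rightarrow>\<^sub>0 'a::comm_ring_1) \<or> prodL L = (- prodL L' :: _ \<Rightarrow>\<^sub>0 'a)"
proof -
  assume a: "mset L = mset L'"
  interpret anticommuting "fop :: _ \<Rightarrow> (_ \<Rightarrow>\<^sub>0 'a) \<Rightarrow> _" by (rule anticommuting_fop)
  show ?thesis using foldr_mset[OF a, of "single {} 1"] by (simp add: prodL_def)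
qed

lemma mons_finite: "\<tau> \<in> mons L \<Longrightarrow> finite \<tau>"
  by (induction L arbitrary: \<tau>) auto

lemma mons_wt: "\<tau> \<in> mons L \<Longrightarrow> wt \<tau> = wtm (mset L)"
proof (induction L arbitrary: \<tau>)
  case (Cons l L)
  then obtain c \<sigma> where "\<tau> = insert (c, snd l) \<sigma>" "\<sigma> \<in> mons L" "(c, snd l) \<notin> \<sigma>" by auto
  then show ?case using Cons.IH[of \<sigma>] by (simp add: wt_insert mons_finite)
qed (simp add: wt_def)

lemma keys_prodL: "keys (prodL L) \<subseteq> mons L"
proof (induction L)
  case Nil
  then show ?case by (simp add: prodL_def)
next
  case (Cons l L)
  show ?case
  proof
    fix D assume "D \<in> keys (prodL (l # L) :: _ \<Rightarrow>\<^sub>0 'a)"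
    then have "(\<Sum>i\<in>fst l \<times> {snd l}. lookup (theta i (prodL L :: _ \<Rightarrow>\<^sub>0 'a)) D) \<noteq> 0"
      by (simp add: in_keys_iff prodL_Cons fop_def comb_def lookup_sum)
    then obtain i where i: "i \<in> fst l \<times> {snd l}" "lookup (theta i (prodL L :: _ \<Rightarrow>\<^sub>0 'a)) D \<noteq> 0"
      by (meson sum.neutral)
    then have "i \<in> D" "lookup (prodL L :: _ \<Rightarrow>\<^sub>0 'a) (D - {i}) \<noteq> 0"
      by (auto simp: lookup_theta split: if_splits)
    then have "i \<in> D" "D - {i} \<in> mons L"
      using Cons.IH by (auto simp: in_keys_iff)
    then show "D \<in> mons (l # L)"
      using i(1) by (auto intro!: exI[of _ "fst i"] exI[of _ "D - {i}"])
  qed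
qed

lemma mons_count:
  assumes "\<tau> \<in> mons L"
  shows "cnt (inside J) (mset L) \<le> card {x \<in> \<tau>. fst x \<in> J}"
    and "card {x \<in> \<tau>. fst x \<in> J} \<le> cnt (meets J) (mset L)"
  using assms
proof (induction L arbitrary: \<tau>)
  case (Cons l L)
  {
    case 1
    then obtain c \<sigma> where \<tau>: "\<tau> = insert (c, snd l) \<sigma>" and \<sigma>: "\<sigma> \<in> mons L" "(c, snd l) \<notin> \<sigma>" "c \<in> fst l"
      by auto
    have e: "{x \<in> \<tau>. fst x \<in> J} = (if c \<in> J then insert (c, snd l) {x \<in> \<sigma>. fst x \<in> J} else {x \<in> \<sigma>. fst x \<in> J})"
      by (auto simp: \<tau>)
    show ?case unfolding e using Cons.IH(1)[OF \<sigma>(1)] mons_finite[OF \<sigma>(1)] \<sigma> by (auto simp: inside_def meets_def)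
  next
    case 2
    then obtain c \<sigma> where \<tau>: "\<tau> = insert (c, snd l) \<sigma>" and \<sigma>: "\<sigma> \<in> mons L" "(c, snd l) \<notin> \<sigma>" "c \<in> fst l"
      by auto
    have e: "{x \<in> \<tau>. fst x \<in> J} = (if c \<in> J then insert (c, snd l) {x \<in> \<sigma>. fst x \<in> J} else {x \<in> \<sigma>. fst x \<in> J})"
      by (auto simp: \<tau>)
    show ?case unfolding e using Cons.IH(2)[OF \<sigma>(1)] mons_finite[OF \<sigma>(1)] \<sigma> by (auto simp: inside_def meets_def)
  }
qed auto

lemma mons_single_factor: "({j}, k) \<in> set L \<Longrightarrow> \<tau> \<in> mons L \<Longrightarrow> (j, k) \<in> \<tau>"
  by (induction L arbitrary: \<tau>) auto

lemma finite_colset: "finite \<tau> \<Longrightarrow> finite (colset j \<tau>)"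
  unfolding colset_def by (rule finite_imageD[of "Pair j"]) (auto intro: finite_subset inj_onI)

lemma card_cols:
  assumes "finite \<tau>" "finite J"
  shows "card {x \<in> \<tau>. fst x \<in> J} = (\<Sum>j\<in>J. card (colset j \<tau>))"
proof -
  have "{x \<in> \<tau>. fst x \<in> J} = Sigma J (\<lambda>j. colset j \<tau>)" by (auto simp: colset_def)
  then show ?thesis using assms by (simp add: card_SigmaI finite_colset)
qed

section \<open>Exchange relations\<close>

text \<open>For more than \<open>card (a i \<union> a j)\<close> factors with columns \<open>{i, j}\<close>, the product lies in the kernel of
  the map to products of minors, whose image involves only that many rows in these columns.\<close>

definition exch :: "(nat \<Rightarrow> nat set) \<Rightarrow> (nat set \<times> nat) multiset \<Rightarrow> bool" where
  "exch a X \<longleftrightarrow> (\<forall>l\<in>#X. finite (fst l)) \<and>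
    (\<exists>i j. i \<noteq> j \<and> card (a i \<union> a j) < cnt ((=) {i, j}) X)"

text \<open>The relations of weight \<mu>, lifted to the exterior algebra: basis tensors killed by
  the flag, and products lying in the kernel of the map to minors. That both become relations of the
  module is \<open>transfer_gens\<close>.\<close>

definition gens :: "(nat \<Rightarrow> nat set) \<Rightarrow> (nat \<Rightarrow>\<^sub>0 nat) \<Rightarrow> ((nat \<times> nat) set \<Rightarrow>\<^sub>0 'k::comm_ring_1) set" where
  "gens a \<mu> = {single \<tau> 1 | \<tau>. finite \<tau> \<and> wt \<tau> = \<mu> \<and> \<not> flagged a \<tau>} \<union>
     {prodL L | L. wtm (mset L) = \<mu> \<and> exch a (mset L)}"

text \<open>Reordering factors changes only the sign, so a multiset of factors is the right
  argument. The guard excludes infinite column sets, for which the sum in \<open>fop\<close> is 0 by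
  convention and not additive under unions.\<close>

definition vanishes :: "'k::comm_ring_1 itself \<Rightarrow> (nat \<Rightarrow> nat set) \<Rightarrow> (nat set \<times> nat) multiset \<Rightarrow> bool" where
  "vanishes K a X \<longleftrightarrow> (\<forall>l\<in>#X. finite (fst l)) \<longrightarrow>
     (\<forall>L. mset L = X \<longrightarrow> (prodL L :: _ \<Rightarrow>\<^sub>0 'k) \<in> fm.span (gens a (wtm X)))"

lemma vanishesI:
  assumes "(\<And>l. l \<in> set L \<Longrightarrow> finite (fst l)) \<Longrightarrow> (prodL L :: _ \<Rightarrow>\<^sub>0 'k::comm_ring_1) \<in> fm.span (gens a (wtm X))"
    and "mset L = X"
  shows "vanishes TYPE('k) a X"
  unfolding vanishes_def
proof (intro impI allI)
  fix L' assume f: "\<forall>l\<in>#X. finite (fst l)" and L': "mset L' = X"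
  have "(prodL L :: _ \<Rightarrow>\<^sub>0 'k) \<in> fm.span (gens a (wtm X))" using f assms(2) by (intro assms(1)) auto
  then show "(prodL L' :: _ \<Rightarrow>\<^sub>0 'k) \<in> fm.span (gens a (wtm X))"
    using prodL_mset[of L' L, where ?'a='k] L' assms(2) by (auto simp: fm.span_neg)
qed

lemma vanishesD:
  assumes "vanishes TYPE('k) a (mset L)" "\<And>l. l \<in> set L \<Longrightarrow> finite (fst l)"
  shows "(prodL L :: _ \<Rightarrow>\<^sub>0 'k::comm_ring_1) \<in> fm.span (gens a (wtm (mset L)))"
  using assms unfolding vanishes_def by auto

lemma vanishes_union:
  assumes "vanishes TYPE('k::comm_ring_1) a (add_mset (C, u) X)" "vanishes TYPE('k) a (add_mset (C', u) X)" "C \<inter> C' = {}"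
  shows "vanishes TYPE('k) a (add_mset (C \<union> C', u) X)"
proof -
  obtain L where L: "mset L = X" using ex_mset by blast
  show ?thesis
  proof (rule vanishesI[of "(C \<union> C', u) # L"])
    assume f: "\<And>l. l \<in> set ((C \<union> C', u) # L) \<Longrightarrow> finite (fst l)"
    have "finite C" "finite C'" using f[of "(C \<union> C', u)"] by auto
    moreover have "(prodL ((C, u) # L) :: _ \<Rightarrow>\<^sub>0 'k) \<in> fm.span (gens a (wtm (mset ((C, u) # L))))"
      using assms(1) f \<open>finite C\<close> by (intro vanishesD) (auto simp: L)
    moreover have "(prodL ((C', u) # L) :: _ \<Rightarrow>\<^sub>0 'k) \<in> fm.span (gens a (wtm (mset ((C', u) # L))))"
      using assms(2) f \<open>finite C'\<close> by (intro vanishesD) (auto simp: L)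
    ultimately show "(prodL ((C \<union> C', u) # L) :: _ \<Rightarrow>\<^sub>0 'k) \<in> fm.span (gens a (wtm (add_mset (C \<union> C', u) X)))"
      using assms(3) by (simp add: prodL_Cons fop_union L fm.span_add)
  qed (simp add: L)
qed

lemma vanishes_diff:
  assumes "vanishes TYPE('k::comm_ring_1) a (add_mset (C \<union> C', u) X)" "vanishes TYPE('k) a (add_mset (C', u) X)"
    "C \<inter> C' = {}" "finite C'"
  shows "vanishes TYPE('k) a (add_mset (C, u) X)"
proof -
  obtain L where L: "mset L = X" using ex_mset by blast
  show ?thesis
  proof (rule vanishesI[of "(C, u) # L"])
    assume f: "\<And>l. l \<in> set ((C, u) # L) \<Longrightarrow> finite (fst l)"
    have "finite C" using f[of "(C, u)"] by auto
    moreover have "(prodL ((C \<union> C', u) # L) :: _ \<Rightarrow>\<^sub>0 'k) \<in> fm.span (gens a (wtm (mset ((C \<union> C', u) # L))))"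
      using assms(1,4) f \<open>finite C\<close> by (intro vanishesD) (auto simp: L)
    moreover have "(prodL ((C', u) # L) :: _ \<Rightarrow>\<^sub>0 'k) \<in> fm.span (gens a (wtm (mset ((C', u) # L))))"
      using assms(2,4) f by (intro vanishesD) (auto simp: L)
    ultimately show "(prodL ((C, u) # L) :: _ \<Rightarrow>\<^sub>0 'k) \<in> fm.span (gens a (wtm (add_mset (C, u) X)))"
      using assms(3,4) fm.span_diff by (fastforce simp add: prodL_Cons fop_union L)
  qed (simp add: L)
qed

text \<open>Every factor with columns \<open>C \<union> C'\<close> is a sum of two factors, so by
  multilinearity it suffices to treat each distribution of the indices \<open>Q\<close> over the two
  parts.\<close>

lemma vanishes_split:
  assumes "C \<inter> C' = {}"
    and "\<And>Q1 Q2. Q = Q1 + Q2 \<Longrightarrow>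
      vanishes TYPE('k::comm_ring_1) a (image_mset (Pair C) Q1 + image_mset (Pair C') Q2 + X)"
  shows "vanishes TYPE('k) a (image_mset (Pair (C \<union> C')) Q + X)"
  using assms(2)
proof (induction Q arbitrary: X)
  case empty
  then show ?case by simp
next
  case (add u Q)
  have "vanishes TYPE('k) a (image_mset (Pair (C \<union> C')) Q + add_mset (C, u) X)"
  proof (rule add.IH)
    fix Q1 Q2 assume "Q = Q1 + Q2"
    then show "vanishes TYPE('k) a (image_mset (Pair C) Q1 + image_mset (Pair C') Q2 + add_mset (C, u) X)"
      using add.prems[of "add_mset u Q1" Q2] by simp
  qed
  moreover have "vanishes TYPE('k) a (image_mset (Pair (C \<union> C')) Q + add_mset (C', u) X)"
  proof (rule add.IH)
    fix Q1 Q2 assume "Q = Q1 + Q2"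
    then show "vanishes TYPE('k) a (image_mset (Pair C) Q1 + image_mset (Pair C') Q2 + add_mset (C', u) X)"
      using add.prems[of Q1 "add_mset u Q2"] by simp
  qed
  ultimately show ?case
    using vanishes_union[where C = C and C' = C' and u = u and X = "image_mset (Pair (C \<union> C')) Q + X"] assms(1) by simp
qed

lemma vanishes_factor:
  assumes "\<And>c. vanishes TYPE('k::comm_ring_1) a (add_mset ({c}, u) X)"
  shows "vanishes TYPE('k) a (add_mset (C, u) X)"
proof (cases "finite C")
  case True
  then show ?thesis
  proof (induction C)
    case empty
    obtain L where L: "mset L = X" using ex_mset by blast
    show ?case
      by (rule vanishesI[of "({}, u) # L"]) (auto simp: prodL_Cons L fm.span_zero)
  next
    case (insert c C)
    then show ?case using vanishes_union[OF assms[of c] insert.IH] by simp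
  qed
next
  case False
  then show ?thesis by (auto simp: vanishes_def)
qed

text \<open>By multilinearity the factors in \<open>R\<close> may be taken to be single generators,
  whose contribution to the degree of each column is then known exactly.\<close>

lemma vanishes_singletons:
  assumes "\<And>R'. (\<And>l. l \<in># R' \<Longrightarrow> \<exists>c. fst l = {c}) \<Longrightarrow> vanishes TYPE('k::comm_ring_1) a (R' + X)"
  shows "vanishes TYPE('k) a (R + X)"
  using assms
proof (induction R arbitrary: X)
  case empty
  then show ?case by (metis empty_iff set_mset_empty)
next
  case (add l R)
  have "vanishes TYPE('k) a (add_mset ({c}, snd l) (R + X))" for c
  proof -
    have "vanishes TYPE('k) a (R + add_mset ({c}, snd l) X)"
    proof (rule add.IH)
      fix R' :: "(nat set \<times> nat) multiset"
      assume "\<And>l. l \<in># R' \<Longrightarrow> \<exists>c. fst l = {c}"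
      then show "vanishes TYPE('k) a (R' + add_mset ({c}, snd l) X)"
        using add.prems[of "add_mset ({c}, snd l) R'"] by (metis add_mset_add_single fst_conv insert_iff set_mset_add_mset_insert union_mset_add_mset_left union_mset_add_mset_right)
    qed
    then show ?thesis by simp
  qed
  then have "vanishes TYPE('k) a (add_mset (fst l, snd l) (R + X))" by (rule vanishes_factor)
  then show ?case by simp
qed

lemma vanishes_not_flagged:
  assumes "\<And>\<tau>. \<tau> \<in> mons L \<Longrightarrow> \<not> flagged a \<tau>"
  shows "vanishes TYPE('k::comm_ring_1) a (mset L)"
proof (rule vanishesI[of L])
  have "keys (prodL L :: _ \<Rightarrow>\<^sub>0 'k) \<subseteq> mons L" by (rule keys_prodL)
  then have "(prodL L :: _ \<Rightarrow>\<^sub>0 'k) \<in> fm.span ((\<lambda>\<tau>. single \<tau> 1) ` mons L)"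
    by (simp add: span_single_iff)
  moreover have "(\<lambda>\<tau>. single \<tau> 1) ` mons L \<subseteq> gens a (wtm (mset L))"
    using assms by (auto simp: gens_def mons_finite mons_wt)
  ultimately show "(prodL L :: _ \<Rightarrow>\<^sub>0 'k) \<in> fm.span (gens a (wtm (mset L)))"
    using fm.span_mono by blast
qed simp

text \<open>The number of entries of a flagged tensor in the columns \<open>J\<close> is prescribed.
  If more factors are forced into \<open>J\<close>, or fewer can reach it, no monomial of the
  product is flagged.\<close>

lemma vanishes_degree:
  assumes "finite J"
    and "(\<Sum>j\<in>J. card (a j)) < cnt (inside J) X \<or> cnt (meets J) X < (\<Sum>j\<in>J. card (a j))"
  shows "vanishes TYPE('k::comm_ring_1) a X"
proof -
  obtain L where L: "mset L = X" using ex_mset by blast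
  have "\<not> flagged a \<tau>" if \<tau>: "\<tau> \<in> mons L" for \<tau>
  proof
    assume "flagged a \<tau>"
    then have "(\<Sum>j\<in>J. card (a j)) = card {x \<in> \<tau>. fst x \<in> J}"
      using assms(1) mons_finite[OF \<tau>] by (simp add: card_cols flagged_def flag_le_def)
    then show False using mons_count[OF \<tau>, of J] assms(2) L by auto
  qed
  then show ?thesis using vanishes_not_flagged[of L a] L by auto
qed

text \<open>The largest entry of a flagged column cannot exceed the largest row of
  \<open>a j\<close>.\<close>

lemma not_flagged_large_entry:
  assumes "finite \<tau>" "(j, k) \<in> \<tau>" "a j \<subseteq> {..<k}"
  shows "\<not> flagged a \<tau>"
proof
  assume "flagged a \<tau>"
  then have f: "card (a j) = card (colset j \<tau>)" "card (a j \<inter> {..k - 1}) \<le> card (colset j \<tau> \<inter> {..k - 1})" "0 \<notin> colset j \<tau>"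
    by (auto simp: flagged_def flag_le_def)
  have k: "k \<in> colset j \<tau>" using assms(2) by (simp add: colset_def)
  then have "k > 0" using f(3) by (cases k) auto
  have fin: "finite (colset j \<tau>)" using assms(1) by (rule finite_colset)
  have "a j \<inter> {..k - 1} = a j" using assms(3) by auto
  moreover have "card (colset j \<tau> \<inter> {..k - 1}) < card (colset j \<tau>)"
  proof (rule psubset_card_mono[OF fin])
    have "k \<notin> colset j \<tau> \<inter> {..k - 1}" using \<open>k > 0\<close> by auto
    then show "colset j \<tau> \<inter> {..k - 1} \<subset> colset j \<tau>" using k by blast
  qed
  ultimately show False using f by simp
qed

lemma vanishes_forced:
  assumes "({j}, k) \<in># X" "a j \<subseteq> {..<k}"
  shows "vanishes TYPE('k::comm_ring_1) a X"
proof -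
  obtain L where L: "mset L = X" using ex_mset by blast
  have "\<not> flagged a \<tau>" if \<tau>: "\<tau> \<in> mons L" for \<tau>
    using mons_single_factor[of j k L \<tau>] mons_finite[OF \<tau>] assms L \<tau> by (intro not_flagged_large_entry) auto
  then show ?thesis using vanishes_not_flagged[of L a] L by auto
qed

lemma vanishes_exch:
  assumes "i \<noteq> j" "card (a i \<union> a j) < cnt ((=) {i, j}) X"
  shows "vanishes TYPE('k::comm_ring_1) a X"
  unfolding vanishes_def
proof (intro impI allI)
  fix L assume "\<forall>l\<in>#X. finite (fst l)" "mset L = X"
  then have "(prodL L :: _ \<Rightarrow>\<^sub>0 'k) \<in> gens a (wtm X)"
    using assms unfolding gens_def exch_def by blast
  then show "(prodL L :: _ \<Rightarrow>\<^sub>0 'k) \<in> fm.span (gens a (wtm X))" by (rule fm.span_base)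
qed

text \<open>A factor \<open>(C, u)\<close> is the difference of \<open>(C \<union> {j}, u)\<close>
  and \<open>({j}, u)\<close>, and the latter would overfill column \<open>j\<close>. So letting
  other factors use a column that is already full changes nothing.\<close>

lemma vanishes_full_column:
  assumes "j \<notin> C" "finite C" "card (a j) \<le> cnt ((=) {j}) Y"
    and "vanishes TYPE('k::comm_ring_1) a (image_mset (Pair (C \<union> {j})) Q + Y)"
  shows "vanishes TYPE('k) a (image_mset (Pair C) Q + Y)"
  using assms(3,4)
proof (induction Q arbitrary: Y)
  case (add u Q)
  let ?Z = "image_mset (Pair (C \<union> {j})) Q + Y"
  have "cnt ((=) {j}) Y \<le> cnt (inside {j}) Y"
    by (rule cnt_mono) (auto simp: inside_def)
  then have "vanishes TYPE('k) a (add_mset ({j}, u) ?Z)"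
    using add.prems(1) by (intro vanishes_degree[of "{j}"]) (auto simp: inside_def)
  with add.prems(2) have "vanishes TYPE('k) a (add_mset (C, u) ?Z)"
    using assms(1) by - (rule vanishes_diff[where C' = "{j}"], simp_all)
  then have "vanishes TYPE('k) a (image_mset (Pair C) Q + add_mset (C, u) Y)"
    using add.prems(1) by (intro add.IH) auto
  then show ?case by simp
qed simp

text \<open>Write \<open>({j0}, k)\<close> as \<open>({j0, j}, k)\<close> minus
  \<open>({j}, k)\<close>. The first supplies one more factor with columns \<open>{j0, j}\<close>,
  which pays for row \<open>k\<close> in the union of the rows; the second puts the entry
  \<open>k\<close> into a column whose rows are all smaller.\<close>

lemma vanishes_two_columns:
  assumes "j \<noteq> j0" "finite (a j0)" "finite (a j)" "a j \<subseteq> {..<k}"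
    and "card ((a j0 - {k}) \<union> a j) < cnt ((=) {j0, j}) X"
  shows "vanishes TYPE('k::comm_ring_1) a (add_mset ({j0}, k) X)"
proof (rule vanishes_diff[where C' = "{j}"])
  have "card (a j0 \<union> a j) \<le> card (insert k ((a j0 - {k}) \<union> a j))"
    using assms(2,3) by (intro card_mono) auto
  also have "\<dots> \<le> Suc (card ((a j0 - {k}) \<union> a j))" by (rule card_insert_le_m1) auto
  finally show "vanishes TYPE('k) a (add_mset ({j0} \<union> {j}, k) X)"
    using assms(1,5) by (intro vanishes_exch[of j0 j]) auto
  show "vanishes TYPE('k) a (add_mset ({j}, k) X)"
    using assms(4) by (intro vanishes_forced[of j k]) auto
  show "{j0} \<inter> {j} = {}" using assms(1) by simp
qed simp

lemma image_Pair_filter: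
  "image_mset (Pair C) (image_mset snd (filter_mset (\<lambda>l. fst l = C) R)) = filter_mset (\<lambda>l. fst l = C) R"
proof (induction R)
  case (add x R)
  then show ?case by (cases x) simp
qed simp

lemma filter_two_values:
  assumes "a \<noteq> b"
  shows "R = filter_mset (\<lambda>l. f l = a) R + filter_mset (\<lambda>l. f l = b) R +
    filter_mset (\<lambda>l. f l \<noteq> a \<and> f l \<noteq> b) R"
proof (induction R)
  case (add x R)
  then show ?case using assms by (cases "f x = a"; cases "f x = b") simp_all
qed simp

text \<open>All factors \<open>({j1}, u)\<close> are turned into \<open>({j0}, u)\<close>, one at a time: the difference is \<open>({j0, j1}, u)\<close>,
  for which the relations of the columns \<open>j0\<close> and \<open>j1\<close> apply. In the end the relations of the columns
  \<open>j1\<close> and \<open>j\<close> apply.\<close>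

lemma vanishes_three_columns:
  assumes dist: "j0 \<noteq> j1" "j0 \<noteq> j" "j1 \<noteq> j"
    and fin: "finite (a j0)" "finite (a j)"
    and k: "k \<in> a j0" and sub: "a j1 \<subseteq> a j0 - {k}" and diff: "a j - (a j0 - {k}) = a j - a j1"
    and j1: "a j1 \<subseteq> {..<k}"
    and V: "card ((a j0 - {k}) \<union> a j) < size V"
  shows "vanishes TYPE('k::comm_ring_1) a (R + add_mset ({j0}, k) (image_mset (Pair {j0, j}) V))"
proof (rule vanishes_singletons)
  fix R :: "(nat set \<times> nat) multiset"
  assume sing: "\<And>l. l \<in># R \<Longrightarrow> \<exists>c. fst l = {c}"
  \<comment> \<open>Among the factors of \<open>R\<close>, \<beta> holds the entries in column
    \<open>j1\<close>, \<xi> those in column \<open>j0\<close>, and \<omega> the factors in the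
    remaining columns.\<close>
  define \<beta> where "\<beta> = image_mset snd (filter_mset (\<lambda>l. fst l = {j1}) R)"
  define \<xi> where "\<xi> = image_mset snd (filter_mset (\<lambda>l. fst l = {j0}) R)"
  define \<omega> where "\<omega> = filter_mset (\<lambda>l. fst l \<noteq> {j1} \<and> fst l \<noteq> {j0}) R"
  have R: "R = image_mset (Pair {j1}) \<beta> + image_mset (Pair {j0}) \<xi> + \<omega>"
    unfolding \<beta>_def \<xi>_def \<omega>_def image_Pair_filter by (rule filter_two_values) (use dist in simp)
  have \<omega>: "\<exists>c. fst l = {c} \<and> c \<noteq> j0 \<and> c \<noteq> j1" if "l \<in># \<omega>" for l
    using that sing[of l] unfolding \<omega>_def by auto
  have disj: "fst l \<inter> J = {} \<and> fst l \<noteq> {}" if J: "J \<subseteq> {j0, j1}" and l: "l \<in># \<omega>" for J l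
    using \<omega>[OF l] J by auto
  have none: "cnt (inside J) \<omega> = 0" "cnt (meets J) \<omega> = 0" if "J \<subseteq> {j0, j1}" for J
    by (rule cnt_eq_0; drule disj[OF that]; unfold inside_def meets_def; blast)+
  note none1 = none[of "{j0}", simplified] none[of "{j1}", simplified] none[OF subset_refl]
  note count = inside_def meets_def dist dist[symmetric] none1
  let ?A = "a j0 - {k}" and ?B = "a j1"
  have cA: "card (a j0) = Suc (card ?A)" using k fin by (metis card_Suc_Diff1)
  have finB: "finite ?B" "finite ?A" using sub fin finite_subset by auto
  have AB: "card ?B \<le> card ?A" using sub finB by (intro card_mono) auto
  show "vanishes TYPE('k) a (R + add_mset ({j0}, k) (image_mset (Pair {j0, j}) V))"
  \<comment> \<open>Only the factors from \<beta> can reach column \<open>j1\<close>, so the degree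
    decides unless they fill it exactly.\<close>
  proof (cases "size \<beta> = card ?B")
    case False
    show ?thesis
      unfolding R using False
      by (intro vanishes_degree[of "{j1}"]) (auto simp: count)
  next
    case \<beta>: True
    \<comment> \<open>The intermediate products: \<open>\<beta>1\<close> has moved to column
      \<open>j0\<close>, \<open>\<beta>2\<close> is still in column \<open>j1\<close>, and the
      factors from \<open>V\<close> and \<xi> are allowed to use \<open>j1\<close> in
      addition.\<close>
    let ?\<Psi> = "\<lambda>\<beta>1 \<beta>2. add_mset ({j0}, k) (image_mset (Pair {j0}) \<beta>1 + image_mset (Pair {j1}) \<beta>2
      + image_mset (Pair {j0, j1, j}) V + image_mset (Pair {j0, j1}) \<xi> + \<omega>)"
    have last: "vanishes TYPE('k) a (?\<Psi> \<beta> {#})"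
    proof -
      have "vanishes TYPE('k) a (image_mset (Pair ({j0} \<union> {j1, j})) V +
        (image_mset (Pair ({j0} \<union> {j1})) \<xi> + add_mset ({j0}, k) (image_mset (Pair {j0}) \<beta> + \<omega>)))"
      proof (rule vanishes_split)
        fix S S' assume S: "V = S + S'"
        have "vanishes TYPE('k) a (image_mset (Pair ({j0} \<union> {j1})) \<xi> + (image_mset (Pair {j0}) S + image_mset (Pair {j1, j}) S'
          + add_mset ({j0}, k) (image_mset (Pair {j0}) \<beta> + \<omega>)))"
        proof (rule vanishes_split)
          fix T T' assume T: "\<xi> = T + T'"
          show "vanishes TYPE('k) a (image_mset (Pair {j0}) T + image_mset (Pair {j1}) T' +
            (image_mset (Pair {j0}) S + image_mset (Pair {j1, j}) S' + add_mset ({j0}, k) (image_mset (Pair {j0}) \<beta> + \<omega>)))"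
            (is "vanishes _ _ ?X")
          \<comment> \<open>The degree in column \<open>j0\<close> bounds \<open>size S\<close> by
            \<open>card ?A - card ?B\<close>. Since \<open>a j\<close> has equally many rows outside
            \<open>?A\<close> and outside \<open>?B\<close>, more than
            \<open>card (?B \<union> a j)\<close> factors are left for the columns
            \<open>{j1, j}\<close>.\<close>
          proof (cases "card ?B + size S + size T = card ?A")
            case False
            then show ?thesis
              using \<beta> cA by (intro vanishes_degree[of "{j0}"]) (auto simp: count)
          next
            case True
            have "card (?B \<union> a j) = card ?B + card (a j - ?B)"
              using finB fin by (subst card_Un_disjoint[symmetric]) auto
            moreover have "card (?A \<union> a j) = card ?A + card (a j - ?A)"
              using finB fin by (subst card_Un_disjoint[symmetric]) auto
            ultimately have "card (?B \<union> a j) < size S'" using V S True diff by auto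
            then show ?thesis using dist by (intro vanishes_exch[of j1 j]) (auto simp: count)
          qed
        qed (simp add: dist)
        then show "vanishes TYPE('k) a (image_mset (Pair {j0}) S + image_mset (Pair {j1, j}) S' +
          (image_mset (Pair ({j0} \<union> {j1})) \<xi> + add_mset ({j0}, k) (image_mset (Pair {j0}) \<beta> + \<omega>)))"
          by (simp add: ac_simps insert_commute)
      qed (simp add: dist)
      then show ?thesis by (simp add: ac_simps insert_commute)
    qed
    have "\<beta> = \<beta>1 + \<beta>2 \<Longrightarrow> vanishes TYPE('k) a (?\<Psi> \<beta>1 \<beta>2)" for \<beta>1 \<beta>2
    proof (induction \<beta>2 arbitrary: \<beta>1)
      case empty
      then show ?case using last by simp
    next
      case (add u \<beta>2)
      let ?Y = "add_mset ({j0}, k) (image_mset (Pair {j0}) \<beta>1 + image_mset (Pair {j1}) \<beta>2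
        + image_mset (Pair {j0, j1, j}) V + image_mset (Pair {j0, j1}) \<xi> + \<omega>)"
      \<comment> \<open>The sum of both placements of \<open>u\<close>. Once \<open>V\<close> is
        split, the degree in \<open>{j0, j1}\<close> forces
        \<open>size S + size \<xi> = card ?A\<close>, so that with \<open>u\<close> there are
        \<open>card ?A + 1\<close> factors with columns \<open>{j0, j1}\<close>. As
        \<open>?A \<union> ?B = ?A\<close>, the relation for two columns applies with
        \<open>j1\<close> in the role of \<open>j\<close>.\<close>
      have "vanishes TYPE('k) a (image_mset (Pair ({j0, j1} \<union> {j})) V +
        add_mset ({j0}, k) (add_mset ({j0, j1}, u) (image_mset (Pair {j0}) \<beta>1 + image_mset (Pair {j1}) \<beta>2
          + image_mset (Pair {j0, j1}) \<xi> + \<omega>)))"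
      proof (rule vanishes_split)
        fix S S' assume S: "V = S + S'"
        show "vanishes TYPE('k) a (image_mset (Pair {j0, j1}) S + image_mset (Pair {j}) S' +
          add_mset ({j0}, k) (add_mset ({j0, j1}, u) (image_mset (Pair {j0}) \<beta>1 + image_mset (Pair {j1}) \<beta>2
          + image_mset (Pair {j0, j1}) \<xi> + \<omega>)))"
        proof (cases "size S + size \<xi> = card ?A")
          case True
          have "?A \<union> ?B = ?A" using sub by auto
          then have "vanishes TYPE('k) a (add_mset ({j0}, k) (image_mset (Pair {j0, j1}) S + image_mset (Pair {j}) S' +
            (add_mset ({j0, j1}, u) (image_mset (Pair {j0}) \<beta>1 + image_mset (Pair {j1}) \<beta>2
            + image_mset (Pair {j0, j1}) \<xi> + \<omega>))))"
            using dist fin finB j1 True by (intro vanishes_two_columns[of j1]) (auto simp: count)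
          then show ?thesis by (simp add: ac_simps insert_commute)
        next
          case False
          have "size \<beta>1 + size \<beta>2 + 1 = card ?B" using add.prems \<beta> by simp
          then show ?thesis
            using False cA
            by (intro vanishes_degree[of "{j0, j1}"]) (auto simp: count)
        qed
      qed (simp add: dist)
      then have "vanishes TYPE('k) a (add_mset ({j1} \<union> {j0}, u) ?Y)"
        by (simp add: ac_simps insert_commute add_mset_commute[of "({j0}, k)"])
      moreover have "vanishes TYPE('k) a (add_mset ({j0}, u) ?Y)"
        using add.IH[of "add_mset u \<beta>1"] add.prems by (simp add: ac_simps insert_commute add_mset_commute[of "({j0}, k)"])
      ultimately have "vanishes TYPE('k) a (add_mset ({j1}, u) ?Y)"
        using dist by - (rule vanishes_diff[where C' = "{j0}"], simp_all)
      then show ?case by (simp add: ac_simps insert_commute add_mset_commute[of "({j0}, k)"])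
    qed
    \<comment> \<open>With nothing moved, \<beta> fills column \<open>j1\<close>, and the permission
      to use \<open>j1\<close> can be withdrawn again from the factors of \<open>V\<close> and
      \<xi>.\<close>
    from this[of "{#}" \<beta>]
    have "vanishes TYPE('k) a (image_mset (Pair ({j0, j} \<union> {j1})) V + (image_mset (Pair ({j0} \<union> {j1})) \<xi> +
      add_mset ({j0}, k) (image_mset (Pair {j1}) \<beta> + \<omega>)))"
      by (simp add: ac_simps insert_commute)
    then have "vanishes TYPE('k) a (image_mset (Pair {j0, j}) V + (image_mset (Pair ({j0} \<union> {j1})) \<xi> +
      add_mset ({j0}, k) (image_mset (Pair {j1}) \<beta> + \<omega>)))"
      using dist \<beta> by - (rule vanishes_full_column[of j1], simp_all add: count)
    then have "vanishes TYPE('k) a (image_mset (Pair ({j0} \<union> {j1})) \<xi> + (image_mset (Pair {j0, j}) V +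
      add_mset ({j0}, k) (image_mset (Pair {j1}) \<beta> + \<omega>)))"
      by (simp add: ac_simps insert_commute)
    then have "vanishes TYPE('k) a (image_mset (Pair {j0}) \<xi> + (image_mset (Pair {j0, j}) V +
      add_mset ({j0}, k) (image_mset (Pair {j1}) \<beta> + \<omega>)))"
      using dist \<beta> by - (rule vanishes_full_column[of j1], simp_all add: count)
    then show ?thesis unfolding R by (simp add: ac_simps insert_commute)
  qed
qed

section \<open>Spanning sets\<close>

lemma flaggedD: "flagged a \<tau> \<Longrightarrow> flag_le (colset j \<tau>) (a j)"
  by (simp add: flagged_def)

text \<open>Only an upper bound on the number of tensors is kept; \<open>independent_at\<close> with
  the same \<open>c\<close> later makes it sharp. The bound is an integer because it will be a
  coefficient of \<open>schubert\<close>.\<close>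

definition spans :: "'k::comm_ring_1 itself \<Rightarrow> (nat \<Rightarrow> nat set) \<Rightarrow> (nat \<Rightarrow>\<^sub>0 nat) \<Rightarrow> int \<Rightarrow> bool" where
  "spans K a \<mu> c \<longleftrightarrow> (\<exists>B. finite B \<and> int (card B) \<le> c \<and> (\<forall>\<tau>\<in>B. finite \<tau> \<and> wt \<tau> = \<mu>) \<and>
     (\<forall>\<tau>. finite \<tau> \<longrightarrow> wt \<tau> = \<mu> \<longrightarrow>
        single \<tau> (1 :: 'k) \<in> fm.span ((\<lambda>\<tau>. single \<tau> 1) ` B \<union> gens a \<mu>)))"

definition sw :: "nat \<Rightarrow> (nat \<Rightarrow>\<^sub>0 nat) \<Rightarrow> (nat \<Rightarrow>\<^sub>0 nat)" where
  "sw k \<mu> = Poly_Mapping.map_key (transpose k (Suc k)) \<mu>"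

lemma lookup_sw [simp]: "lookup (sw k \<mu>) i = lookup \<mu> (transpose k (Suc k) i)"
  unfolding sw_def by (simp add: Poly_Mapping.map_key.rep_eq inj_transpose)

lemma sw_zero [simp]: "sw k 0 = 0"
  by (rule poly_mapping_eqI) simp

lemma sw_add: "sw k (\<mu> + \<nu>) = sw k \<mu> + sw k \<nu>"
  by (rule poly_mapping_eqI) (simp add: lookup_add)

lemma sw_single: "sw k (single i c) = single (transpose k (Suc k) i) c"
  by (rule poly_mapping_eqI) (auto simp: lookup_single when_def transpose_eq_iff)

lemma sw_sw [simp]: "sw k (sw k \<mu>) = \<mu>"
  by (rule poly_mapping_eqI) simp

lemma wt_lookup: "finite \<tau> \<Longrightarrow> lookup (wt \<tau>) u = card {x \<in> \<tau>. snd x = u}"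
  unfolding wt_def lookup_sum by (simp add: lookup_single when_def sum.If_cases Int_def)

lemma wt_keys: "finite \<tau> \<Longrightarrow> keys (wt \<tau>) = snd ` \<tau>"
  by (force simp: in_keys_iff wt_lookup)

definition ren :: "nat \<Rightarrow> nat \<times> nat \<Rightarrow> nat \<times> nat" where
  "ren k x = (fst x, transpose k (Suc k) (snd x))"

lemma ren_ren [simp]: "ren k (ren k x) = x"
  by (simp add: ren_def)

lemma inj_ren: "inj_on (ren k) A"
  by (metis inj_onI ren_ren)

lemma ren_image_ren [simp]: "ren k ` ren k ` \<tau> = \<tau>"
  by (simp add: image_image)

lemma ren_mem_image [simp]: "ren k x \<in> ren k ` \<tau> \<longleftrightarrow> x \<in> \<tau>"
  by (metis image_eqI imageE ren_ren)

lemma finite_ren [simp]: "finite (ren k ` \<tau>) \<longleftrightarrow> finite \<tau>"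
  by (metis finite_imageI ren_image_ren)

lemma colset_ren: "colset j (ren k ` \<tau>) = transpose k (Suc k) ` colset j \<tau>"
proof -
  have "(j, u) \<in> ren k ` \<tau> \<longleftrightarrow> (j, transpose k (Suc k) u) \<in> \<tau>" for u
    using ren_mem_image[of k "(j, transpose k (Suc k) u)" \<tau>] by (simp add: ren_def)
  moreover have "u \<in> transpose k (Suc k) ` A \<longleftrightarrow> transpose k (Suc k) u \<in> A" for u A
    by (metis image_eqI imageE transpose_involutory)
  ultimately show ?thesis by (auto simp: colset_def)
qed

lemma wt_ren: "wt (ren k ` \<tau>) = sw k (wt \<tau>)"
proof -
  have "wt (ren k ` \<tau>) = (\<Sum>x\<in>\<tau>. single (snd (ren k x)) 1)"
    unfolding wt_def by (simp only: sum.reindex[OF inj_ren] o_def)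
  also have "\<dots> = (\<Sum>x\<in>\<tau>. sw k (single (snd x) 1))"
    by (simp add: ren_def sw_single)
  also have "\<dots> = sw k (wt \<tau>)"
    unfolding wt_def by (induction \<tau> rule: infinite_finite_induct) (simp_all add: sw_add)
  finally show ?thesis .
qed

definition renL :: "nat \<Rightarrow> ((nat \<times> nat) set \<Rightarrow>\<^sub>0 'k::comm_ring_1) \<Rightarrow> ((nat \<times> nat) set \<Rightarrow>\<^sub>0 'k)" where
  "renL k = lext (\<lambda>\<tau>. single (ren k ` \<tau>) 1)"

lemma flin_renL: "flin (renL k)"
  unfolding renL_def by (rule flin_lext)

lemma renL_single [simp]: "renL k (single \<tau> c) = single (ren k ` \<tau>) c"
  by (simp add: renL_def)

text \<open>Renaming \<open>k + 1\<close> to \<open>k\<close> preserves the order, hence all signs, as long as \<open>k\<close> does not occur.\<close>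

lemma renL_theta:
  assumes "u \<noteq> k" "\<And>\<tau> x. \<tau> \<in> keys v \<Longrightarrow> x \<in> \<tau> \<Longrightarrow> snd x \<noteq> k"
  shows "renL k (theta (j, u) v) = theta (j, transpose k (Suc k) u) (renL k v)"
proof (rule flin_eqI[of "\<lambda>v. renL k (theta (j, u) v)" "\<lambda>v. theta (j, transpose k (Suc k) u) (renL k v)"])
  show "flin (\<lambda>v. renL k (theta (j, u) v))" "flin (\<lambda>v. theta (j, transpose k (Suc k) u) (renL k v))"
    by (rule flin_comp[OF flin_renL flin_theta] flin_comp[OF flin_theta flin_renL])+
next
  fix \<tau> assume \<tau>: "\<tau> \<in> keys v"
  have r: "(j, transpose k (Suc k) u) = ren k (j, u)" by (simp add: ren_def)
  have mono: "ren k y < ren k (j, u) \<longleftrightarrow> y < (j, u)" if "y \<in> \<tau>" for y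
    using assms(2)[OF \<tau> that] assms(1)
    by (cases y) (auto simp: ren_def less_prod_def' transpose_def)
  have "{y \<in> ren k ` \<tau>. y < ren k (j, u)} = ren k ` {y \<in> \<tau>. y < (j, u)}"
    using mono by auto
  then have "card {y \<in> ren k ` \<tau>. y < ren k (j, u)} = card {y \<in> \<tau>. y < (j, u)}"
    by (simp add: card_image inj_ren)
  then show "renL k (theta (j, u) (single \<tau> 1)) = theta (j, transpose k (Suc k) u) (renL k (single \<tau> 1))"
    unfolding r by (simp add: theta_single flin_zero[OF flin_renL])
qed

lemma mons_snd: "\<tau> \<in> mons L \<Longrightarrow> x \<in> \<tau> \<Longrightarrow> snd x \<in> snd ` set L"
  by (induction L arbitrary: \<tau>) auto

lemma renL_prodL:
  assumes "\<And>l. l \<in> set L \<Longrightarrow> snd l \<noteq> k"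
  shows "renL k (prodL L) = prodL (map (apsnd (transpose k (Suc k))) L)"
  using assms
proof (induction L)
  case Nil
  then show ?case by (simp add: prodL_def)
next
  case (Cons l L)
  obtain C u where l: "l = (C, u)" by (cases l)
  have av: "snd x \<noteq> k" if t: "\<tau> \<in> keys (prodL L :: _ \<Rightarrow>\<^sub>0 'a)" "x \<in> \<tau>" for \<tau> x
  proof -
    have "\<tau> \<in> mons L" using t(1) keys_prodL by blast
    then obtain l' where "l' \<in> set L" "snd x = snd l'" using mons_snd t(2) by blast
    then show ?thesis using Cons.prems[of l'] by simp
  qed
  have F: "fop (C, w) v = (\<Sum>j\<in>C. theta (j, w) v)" for w and v :: "_ \<Rightarrow>\<^sub>0 'a"
  proof -
    have "C \<times> {w} = (\<lambda>j. (j, w)) ` C" by auto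
    then show ?thesis by (simp add: fop_def comb_def sum.reindex inj_on_def)
  qed
  have "u \<noteq> k" using Cons.prems[of l] l by simp
  then have "renL k (fop (C, u) (prodL L)) = fop (C, transpose k (Suc k) u) (renL k (prodL L :: _ \<Rightarrow>\<^sub>0 'a))"
    unfolding F flin_sum[OF flin_renL] using av by (intro sum.cong renL_theta) auto
  then show ?case using Cons by (simp add: prodL_Cons l)
qed

lemma wtm_rename: "wtm (image_mset (apsnd (transpose k (Suc k))) X) = sw k (wtm X)"
  by (induction X) (auto simp: sw_add sw_single)

text \<open>In weight \<open>sw k \<mu>\<close> the index \<open>k\<close> does not occur, so
  renaming \<open>k + 1\<close> to \<open>k\<close> carries exchange products to exchange products.
  The only failure: lowering an entry can make a tensor flagged that was not flagged before.\<close>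

lemma renL_gens:
  assumes "x \<in> gens a (sw k \<mu>)" "lookup \<mu> (Suc k) = 0"
  shows "renL k x \<in> gens a \<mu> \<or>
    (\<exists>\<rho>. x = single (ren k ` \<rho>) 1 \<and> finite \<rho> \<and> wt \<rho> = \<mu> \<and> flagged a \<rho> \<and> \<not> flagged a (ren k ` \<rho>))"
  using assms(1)[unfolded gens_def]
proof (elim UnE CollectE exE conjE)
  fix \<tau> assume x: "x = single \<tau> 1" "finite \<tau>" "wt \<tau> = sw k \<mu>" "\<not> flagged a \<tau>"
  then have "x = single (ren k ` (ren k ` \<tau>)) 1" "finite (ren k ` \<tau>)" "wt (ren k ` \<tau>) = \<mu>"
    by (simp_all add: wt_ren)
  note r = this
  show ?thesis
  proof (cases "flagged a (ren k ` \<tau>)")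
    case True
    then show ?thesis using r x(4) by (intro disjI2 exI[of _ "ren k ` \<tau>"]) simp
  next
    case False
    then have "single (ren k ` \<tau>) 1 \<in> gens a \<mu>" using r unfolding gens_def by blast
    then show ?thesis unfolding x(1) renL_single by (rule disjI1)
  qed
next
  fix L assume x: "x = prodL L" "wtm (mset L) = sw k \<mu>" "exch a (mset L)"
  have k: "snd l \<noteq> k" if "l \<in> set L" for l
  proof
    assume "snd l = k"
    from \<open>l \<in> set L\<close> have "k \<in># image_mset snd (mset L)" using \<open>snd l = k\<close> by auto
    then obtain X where "mset L = add_mset l X"
      using \<open>l \<in> set L\<close> by (metis mset_add set_mset_mset)
    then have "lookup (wtm (mset L)) k > 0" using \<open>snd l = k\<close> by (simp add: lookup_add)
    then show False using x(2) assms(2) by simp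
  qed
  have cnt: "cnt p (image_mset (apsnd f) X) = cnt p X" for p f and X :: "(nat set \<times> nat) multiset"
    by (induction X) auto
  have "exch a (image_mset (apsnd (transpose k (Suc k))) (mset L))"
    using x(3) unfolding exch_def cnt by auto
  then have "renL k x \<in> gens a \<mu>"
    using x renL_prodL[OF k] wtm_rename[of k "mset L"] unfolding gens_def
    by (auto intro!: exI[of _ "map (apsnd (transpose k (Suc k))) L"])
  then show ?thesis by simp
qed

text \<open>The half of the recursion common to ascents and descents. The tensors that become
  admissible by the renaming remain as additional generators, to be excluded or reduced
  later.\<close>

lemma spans_lift:
  assumes "spans TYPE('k::comm_ring_1) a (sw k \<mu>) c" "lookup \<mu> (Suc k) = 0"
  obtains B where "finite B" "int (card B) \<le> c" "\<forall>\<tau>\<in>B. finite \<tau> \<and> wt \<tau> = \<mu>"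
    "\<And>\<tau>. finite \<tau> \<Longrightarrow> wt \<tau> = \<mu> \<Longrightarrow> single \<tau> (1::'k) \<in> fm.span ((\<lambda>\<tau>. single \<tau> 1) ` B \<union> gens a \<mu> \<union>
      (\<lambda>\<tau>. single \<tau> 1) ` {\<rho>. finite \<rho> \<and> wt \<rho> = \<mu> \<and> flagged a \<rho> \<and> \<not> flagged a (ren k ` \<rho>)})"
proof -
  obtain B where B: "finite B" "int (card B) \<le> c" "\<forall>\<tau>\<in>B. finite \<tau> \<and> wt \<tau> = sw k \<mu>"
    "\<And>\<tau>. finite \<tau> \<Longrightarrow> wt \<tau> = sw k \<mu> \<Longrightarrow> single \<tau> (1::'k) \<in> fm.span ((\<lambda>\<tau>. single \<tau> 1) ` B \<union> gens a (sw k \<mu>))"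
    using assms(1) unfolding spans_def by blast
  let ?S = "(\<lambda>\<tau>. single \<tau> (1::'k)) ` ((`) (ren k) ` B) \<union> gens a \<mu> \<union>
      (\<lambda>\<tau>. single \<tau> 1) ` {\<rho>. finite \<rho> \<and> wt \<rho> = \<mu> \<and> flagged a \<rho> \<and> \<not> flagged a (ren k ` \<rho>)}"
  show ?thesis
  proof (rule that[of "(`) (ren k) ` B"])
    show "finite ((`) (ren k) ` B)" using B by simp
    have "card ((`) (ren k) ` B) \<le> card B" by (rule card_image_le[OF B(1)])
    then show "int (card ((`) (ren k) ` B)) \<le> c" using B(2) by linarith
    show "\<forall>\<tau>\<in>(`) (ren k) ` B. finite \<tau> \<and> wt \<tau> = \<mu>" using B(3) by (auto simp: wt_ren)
  next
    fix \<tau> :: "(nat \<times> nat) set" assume \<tau>: "finite \<tau>" "wt \<tau> = \<mu>"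
    have "single (ren k ` \<tau>) (1::'k) \<in> fm.span ((\<lambda>\<tau>. single \<tau> 1) ` B \<union> gens a (sw k \<mu>))"
      using \<tau> by (intro B(4)) (auto simp: wt_ren)
    then have "renL k (single (ren k ` \<tau>) (1::'k)) \<in> fm.span ?S"
    proof (rule flin_span[OF flin_renL])
      fix x :: "_ \<Rightarrow>\<^sub>0 'k" assume "x \<in> (\<lambda>\<tau>. single \<tau> 1) ` B \<union> gens a (sw k \<mu>)"
      then show "renL k x \<in> fm.span ?S"
      proof
        assume "x \<in> (\<lambda>\<tau>. single \<tau> 1) ` B"
        then show ?thesis by (intro fm.span_base) auto
      next
        assume "x \<in> gens a (sw k \<mu>)"
        from renL_gens[OF this assms(2)] show ?thesis
        proof
          assume "renL k x \<in> gens a \<mu>"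
          then show ?thesis by (intro fm.span_base) auto
        next
          assume "\<exists>\<rho>. x = single (ren k ` \<rho>) 1 \<and> finite \<rho> \<and> wt \<rho> = \<mu> \<and> flagged a \<rho> \<and> \<not> flagged a (ren k ` \<rho>)"
          then show ?thesis by (intro fm.span_base) auto
        qed
      qed
    qed
    then show "single \<tau> (1::'k) \<in> fm.span ?S" by simp
  qed
qed

lemma transpose_atMost: "i \<noteq> k \<Longrightarrow> transpose k (Suc k) ` {..i} = {..i}"
  by (rule transpose_image_eq) auto

lemma transpose_image_iff: "u \<in> transpose k (Suc k) ` A \<longleftrightarrow> transpose k (Suc k) u \<in> A"
  by (metis image_eqI imageE transpose_involutory)

text \<open>Raising the entry \<open>k\<close> to \<open>k + 1\<close> changes the counts only at
  \<open>i = k\<close>. A violation there means that \<open>a\<close> has no row beyond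
  \<open>k\<close>, and the entry \<open>k\<close> of \<open>b\<close> then forces \<open>k\<close>
  to be a row of \<open>a\<close>.\<close>

lemma flag_le_lowered:
  assumes "flag_le b a" "\<not> flag_le (transpose k (Suc k) ` b) a" "b \<subseteq> {..k}" "0 < k" "finite a"
  shows "k \<in> b \<and> k \<in> a \<and> a \<subseteq> {..k}"
proof -
  let ?t = "transpose k (Suc k)"
  have fb: "finite b" using assms(3) finite_subset by blast
  have k: "k \<in> b"
  proof (rule ccontr)
    assume "k \<notin> b"
    then have "?t u = u" if "u \<in> b" for u using that assms(3) by (auto simp: transpose_def)
    then have "?t ` b = b" by (auto simp: image_iff)
    then show False using assms by simp
  qed
  have tb: "?t ` b = insert (Suc k) (b - {k})"
    using assms(3) k by (auto simp: transpose_def image_iff)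
  have card: "card (?t ` b) = card b" by (rule card_image) (rule inj_on_transpose)
  have "0 \<notin> ?t ` b" unfolding tb using assms(1) by (auto simp: flag_le_def)
  then obtain i where i: "card (?t ` b \<inter> {..i}) < card (a \<inter> {..i})"
    using assms(1,2) card by (auto simp: flag_le_def not_le)
  have ai: "card (a \<inter> {..i}) \<le> card (b \<inter> {..i})" "card a = card b" using assms(1) by (auto simp: flag_le_def)
  have "i = k"
  proof (rule ccontr)
    assume "i \<noteq> k"
    then consider "i < k" | "i > k" by linarith
    then have "card (?t ` b \<inter> {..i}) = card (b \<inter> {..i})"
    proof cases
      case 1
      then have "?t ` b \<inter> {..i} = b \<inter> {..i}" unfolding tb by auto
      then show ?thesis by simp
    next
      case 2
      then have "?t ` b \<inter> {..i} = ?t ` b" "b \<inter> {..i} = b" unfolding tb using assms(3) by auto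
      then show ?thesis using card by simp
    qed
    then show False using i ai by simp
  qed
  have "?t ` b \<inter> {..k} = b - {k}" unfolding tb using assms(3) by auto
  then have "card b - 1 < card (a \<inter> {..k})" using i \<open>i = k\<close> k fb by simp
  moreover have "card (a \<inter> {..k}) \<le> card a" using assms(5) by (intro card_mono) auto
  ultimately have "card (a \<inter> {..k}) = card a" using ai by linarith
  then have sub: "a \<subseteq> {..k}" using assms(5) by (metis card_subset_eq inf.absorb_iff1 inf_le1)
  have "k \<in> a"
  proof (rule ccontr)
    assume "k \<notin> a"
    then have "a \<subseteq> {..<k}" using sub by (auto simp: le_less)
    then have "a \<inter> {..k - 1} = a" by auto
    then have "card a \<le> card (b \<inter> {..k - 1})" using assms(1) unfolding flag_le_def by metis
    also have "\<dots> \<le> card (b - {k})" using fb assms(4) by (intro card_mono) auto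
    also have "\<dots> < card b" using k fb by (intro psubset_card_mono) auto
    finally show False using ai by simp
  qed
  then show ?thesis using k sub by simp
qed

lemma wt_subset_col: "finite \<tau> \<Longrightarrow> keys (wt \<tau>) \<subseteq> A \<Longrightarrow> colset j \<tau> \<subseteq> A"
  by (auto simp: wt_keys colset_def)

text \<open>By \<open>flag_le_lowered\<close> a newly admissible tensor requires a column whose last
  row is \<open>k\<close>. At an ascent every column with row \<open>k\<close> also has row
  \<open>k + 1\<close>, so there are none.\<close>

lemma spans_ascent:
  assumes "spans TYPE('k::comm_ring_1) a (sw k \<mu>) c" "keys \<mu> \<subseteq> {..k}" "0 < k" "\<And>j. finite (a j)"
    and asc: "\<And>j. k \<in> a j \<Longrightarrow> Suc k \<in> a j"
  shows "spans TYPE('k) a \<mu> c"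
proof -
  have "Suc k \<notin> keys \<mu>" using assms(2) by auto
  then have "lookup \<mu> (Suc k) = 0" by (simp add: in_keys_iff)
  from spans_lift[OF assms(1) this] obtain B where
    B: "finite B" "int (card B) \<le> c" "\<forall>\<tau>\<in>B. finite \<tau> \<and> wt \<tau> = \<mu>"
    "\<And>\<tau>. finite \<tau> \<Longrightarrow> wt \<tau> = \<mu> \<Longrightarrow> single \<tau> (1::'k) \<in> fm.span ((\<lambda>\<tau>. single \<tau> 1) ` B \<union> gens a \<mu> \<union>
      (\<lambda>\<tau>. single \<tau> 1) ` {\<rho>. finite \<rho> \<and> wt \<rho> = \<mu> \<and> flagged a \<rho> \<and> \<not> flagged a (ren k ` \<rho>)})"
    by blast
  have "{\<rho>. finite \<rho> \<and> wt \<rho> = \<mu> \<and> flagged a \<rho> \<and> \<not> flagged a (ren k ` \<rho>)} = {}"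
  proof (safe, goal_cases)
    case (1 \<rho>)
    then obtain j where "flag_le (colset j \<rho>) (a j)" "\<not> flag_le (transpose k (Suc k) ` colset j \<rho>) (a j)"
      by (auto simp: flagged_def colset_ren)
    from flag_le_lowered[OF this] have "k \<in> a j \<and> a j \<subseteq> {..k}"
      using assms 1 wt_subset_col by blast
    then show ?case using asc[of j] by auto
  qed
  note e = this
  show ?thesis unfolding spans_def using B(1-3) B(4)[unfolded e] by (intro exI[of _ B]) simp
qed

text \<open>Under the hypothesis the interchange can only replace \<open>k\<close> by the larger
  \<open>k + 1\<close>, so no count increases.\<close>

lemma card_transpose_Int_le:
  assumes "Suc k \<in> A \<Longrightarrow> k \<in> A" "finite A"
  shows "card (transpose k (Suc k) ` A \<inter> {..i}) \<le> card (A \<inter> {..i})"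
proof (cases "i = k")
  case False
  have "transpose k (Suc k) ` A \<inter> {..i} = transpose k (Suc k) ` (A \<inter> {..i})"
    using transpose_atMost[OF False] inj_transpose by (metis image_Int)
  then show ?thesis by (simp add: card_image_le assms(2))
next
  case True
  have "transpose k (Suc k) ` A \<inter> {..i} \<subseteq> A \<inter> {..i}"
    using assms(1) True by (auto simp: transpose_image_iff transpose_def split: if_splits)
  then show ?thesis using assms(2) by (intro card_mono) auto
qed

lemma prodL_singletons:
  assumes "distinct xs" "set xs = \<rho>"
  shows "single \<rho> (1::'k::comm_ring_1) = prodL (map (\<lambda>(c, u). ({c}, u)) xs) \<or>
    single \<rho> (1::'k) = - prodL (map (\<lambda>(c, u). ({c}, u)) xs)"
proof -
  have "prodL (map (\<lambda>(c, u). ({c}, u)) xs) = (foldr theta xs (single {} 1) :: _ \<Rightarrow>\<^sub>0 'k)"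
    by (induction xs) (auto simp: prodL_def)
  then show ?thesis using foldr_theta[of xs, where ?'a='k] assms by auto
qed

lemma prodL_mset_in_span:
  fixes W :: "((nat \<times> nat) set \<Rightarrow>\<^sub>0 'k::comm_ring_1) set"
  assumes "prodL L' \<in> fm.span W" "mset L = mset L'"
  shows "prodL L \<in> fm.span W"
  using prodL_mset[OF assms(2), where ?'a='k]
proof
  assume e: "prodL L = (prodL L' :: _ \<Rightarrow>\<^sub>0 'k)"
  show ?thesis unfolding e by (rule assms(1))
next
  assume e: "prodL L = (- prodL L' :: _ \<Rightarrow>\<^sub>0 'k)"
  show ?thesis unfolding e by (rule fm.span_neg[OF assms(1)])
qed

lemma prodL_Cons_in_span:
  fixes W :: "((nat \<times> nat) set \<Rightarrow>\<^sub>0 'k::comm_ring_1) set"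
  assumes "prodL ((C \<union> C', u) # L) \<in> fm.span W" "prodL ((C', u) # L) \<in> fm.span W"
    "finite C" "finite C'" "C \<inter> C' = {}"
  shows "prodL ((C, u) # L) \<in> fm.span W"
proof -
  have "prodL ((C, u) # L) = prodL ((C \<union> C', u) # L) - (prodL ((C', u) # L) :: _ \<Rightarrow>\<^sub>0 'k)"
    unfolding prodL_Cons fop_union[OF assms(3-5)] by simp
  then show ?thesis using fm.span_diff[OF assms(1,2)] by (simp only:)
qed

text \<open>The relations of a descent \<open>w(k) > w(k+1)\<close>: \<open>a\<close> and \<open>a'\<close> are the columns of the diagrams of
  \<open>w\<close> and \<open>w s\<^sub>k\<close>, and \<open>j0 = w(k+1)\<close>, \<open>j1 = w(k)\<close>.\<close>

locale descent =
  fixes a a' :: "nat \<Rightarrow> nat set" and k j0 j1 :: nat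
  assumes k_pos: "0 < k"
    and fin: "finite (a j)"
    and a'_other: "j \<noteq> j0 \<Longrightarrow> a' j = transpose k (Suc k) ` a j"
    and a'_j0: "a' j0 = a j0 - {k}"
    and k_j0: "k \<in> a j0" and j0_le: "a j0 \<subseteq> {..k}"
    and below: "j \<noteq> j0 \<Longrightarrow> Suc k \<in> a j \<Longrightarrow> k \<in> a j"
    and nested: "j \<noteq> j0 \<Longrightarrow> k \<in> a j \<Longrightarrow> Suc k \<notin> a j \<Longrightarrow> a j \<inter> {..k} \<subseteq> a j0"
    and j1_neq: "j1 \<noteq> j0" and j1_sub: "a j1 \<subseteq> a j0 - {k}"
    and j1_large: "j \<noteq> j0 \<Longrightarrow> k \<notin> a j \<Longrightarrow> \<not> a j \<subseteq> {..<k} \<Longrightarrow> j \<noteq> j1 \<and> a j \<inter> {..<k} \<subseteq> a j1"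
begin

lemma j0_minus: "a j0 - {k} \<subseteq> {..<k}"
proof
  fix u assume "u \<in> a j0 - {k}"
  then have "u \<le> k" "u \<noteq> k" using j0_le by auto
  then show "u \<in> {..<k}" by simp
qed

text \<open>Compare the unions of rows for \<open>a\<close> and \<open>a'\<close>. If
  \<open>k\<close> lies in column \<open>j\<close>, the union for \<open>a\<close> is no larger, and
  the relation of \<open>a'\<close> already is one of \<open>a\<close>. Otherwise column
  \<open>j\<close> is the same in both, and the union for \<open>a\<close> has the extra row
  \<open>k\<close>.\<close>

lemma vanishes_pair_j0:
  assumes j: "j \<noteq> j0" and c: "card (a' j0 \<union> a' j) < cnt ((=) {j0, j}) X"
  shows "vanishes TYPE('k::comm_ring_1) a (add_mset ({j0}, k) X)"
proof (cases "k \<in> a j")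
  case True
  have "card (a j0 \<union> a j) \<le> card (a' j0 \<union> a' j)"
  proof (cases "Suc k \<in> a j")
    case s: True
    then have "transpose k (Suc k) ` a j = a j"
      using True by (auto simp: transpose_image_iff transpose_def)
    then have "a' j0 \<union> a' j = a j0 \<union> a j" using a'_other[OF j] a'_j0 True by auto
    then show ?thesis by simp
  next
    case False
    have "a' j0 \<union> a' j = insert (Suc k) ((a j0 \<union> a j) - {k})"
      unfolding a'_other[OF j] a'_j0 using True False j0_le
      by (auto simp: transpose_image_iff transpose_def split: if_splits)
    moreover have "Suc k \<notin> a j0 \<union> a j" using False j0_le by auto
    ultimately show ?thesis
      using fin k_j0 by (simp add: card_Suc_Diff1)
  qed
  then show ?thesis using c j by (intro vanishes_exch[of j0 j]) auto
next
  case False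
  then have "Suc k \<notin> a j" using below[OF j] by auto
  then have "transpose k (Suc k) ` a j = a j"
    using False by (auto simp: transpose_image_iff transpose_def)
  then have a'j: "a' j = a j" using a'_other[OF j] by simp
  show ?thesis
  proof (cases "a j \<subseteq> {..<k}")
    case True
    then show ?thesis using j c fin a'_j0 a'j by (intro vanishes_two_columns[of j]) auto
  next
    \<comment> \<open>Column \<open>j\<close> has a row beyond \<open>k\<close>, so the entry
      \<open>k\<close> in column \<open>j\<close> is no longer excluded by the flag; column
      \<open>j1\<close> serves as intermediary.\<close>
    case large: False
    have j1: "j \<noteq> j1" "a j \<inter> {..<k} \<subseteq> a j1" using j1_large[OF j False large] by auto
    define V where "V = image_mset snd (filter_mset (\<lambda>l. fst l = {j0, j}) X)"
    define R where "R = filter_mset (\<lambda>l. fst l \<noteq> {j0, j}) X"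
    have X: "X = R + image_mset (Pair {j0, j}) V"
      unfolding R_def V_def image_Pair_filter by (metis multiset_partition add.commute)
    have "cnt ((=) {j0, j}) X = size V"
      unfolding V_def cnt_def by (simp add: eq_commute)
    then have V: "card ((a j0 - {k}) \<union> a j) < size V" using c a'j a'_j0 by simp
    have "a j - (a j0 - {k}) = a j - a j1" using j1(2) j1_sub j0_minus by blast
    moreover have "a j1 \<subseteq> {..<k}" using j1_sub j0_minus by blast
    ultimately have "vanishes TYPE('k) a (R + add_mset ({j0}, k) (image_mset (Pair {j0, j}) V))"
      using j1_neq j j1 fin k_j0 j1_sub V by (intro vanishes_three_columns[of j0 j1 j]) auto
    then show ?thesis unfolding X by simp
  qed
qed

lemma vanishes_descent:
  assumes "exch a' X"
  shows "vanishes TYPE('k::comm_ring_1) a (add_mset ({j0}, k) X)"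
proof -
  obtain i j where ij: "i \<noteq> j" "card (a' i \<union> a' j) < cnt ((=) {i, j}) X"
    using assms by (auto simp: exch_def)
  consider "i = j0" | "j = j0" | "i \<noteq> j0" "j \<noteq> j0" by blast
  then show ?thesis
  proof cases
    case 1
    then show ?thesis using ij by (intro vanishes_pair_j0[of j]) auto
  next
    case 2
    then show ?thesis using ij by (intro vanishes_pair_j0[of i]) (auto simp: Un_commute insert_commute)
  next
    case 3
    have "card (a' i \<union> a' j) = card (a i \<union> a j)"
      unfolding a'_other[OF 3(1)] a'_other[OF 3(2)] image_Un[symmetric]
      by (rule card_image) (rule inj_on_transpose)
    then show ?thesis using ij by (intro vanishes_exch[of i j]) auto
  qed
qed

text \<open>Read backwards: in column \<open>j0\<close> the entry \<open>k\<close> and the row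
  \<open>k\<close> are deleted together, which preserves the comparison of counts. In every other
  column \<open>a'\<close> has its rows at the same places or further down, which only weakens the
  flag condition.\<close>

lemma not_flagged_insert:
  assumes "finite \<tau>" "keys (wt \<tau>) \<subseteq> {..k}" "\<not> flagged a' \<tau>" "(j0, k) \<notin> \<tau>"
  shows "\<not> flagged a (insert (j0, k) \<tau>)"
proof
  assume fl: "flagged a (insert (j0, k) \<tau>)"
  have "flag_le (colset j \<tau>) (a' j)" for j
  proof (cases "j = j0")
    case False
    have f: "flag_le (colset j \<tau>) (a j)"
      using flaggedD[OF fl, of j] False by (simp add: colset_def)
    have "card (a' j) = card (a j)"
      unfolding a'_other[OF False] by (rule card_image) (rule inj_on_transpose)
    moreover have "card (a' j \<inter> {..i}) \<le> card (a j \<inter> {..i})" for i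
      unfolding a'_other[OF False] using below[OF False] fin by (intro card_transpose_Int_le) auto
    ultimately show ?thesis using f by (auto simp: flag_le_def intro: order_trans)
  next
    case True
    let ?b = "colset j0 \<tau>"
    have fb: "finite ?b" "k \<notin> ?b" using assms(1,4) finite_colset by (auto simp: colset_def)
    have f: "flag_le (insert k ?b) (a j0)"
    proof -
      have "colset j0 (insert (j0, k) \<tau>) = insert k ?b" by (auto simp: colset_def)
      then show ?thesis using flaggedD[OF fl, of j0] by simp
    qed
    have "card (a' j0 \<inter> {..i}) \<le> card (?b \<inter> {..i})" for i
    proof -
      have c: "card (a j0 \<inter> {..i}) \<le> card (insert k ?b \<inter> {..i})" using f by (auto simp: flag_le_def)
      show ?thesis
      proof (cases "k \<le> i")
        case True
        then have "a j0 \<inter> {..i} = insert k (a' j0 \<inter> {..i})" "insert k ?b \<inter> {..i} = insert k (?b \<inter> {..i})"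
          "k \<notin> a' j0" using k_j0 a'_j0 by auto
        then show ?thesis using c fb fin[of j0] a'_j0 by simp
      next
        case False
        then have "a j0 \<inter> {..i} = a' j0 \<inter> {..i}" "insert k ?b \<inter> {..i} = ?b \<inter> {..i}" using a'_j0 by auto
        then show ?thesis using c by simp
      qed
    qed
    moreover have "card (a' j0) = card ?b"
      using f fb k_j0 fin[of j0] by (simp add: a'_j0 flag_le_def)
    ultimately show ?thesis using f True by (auto simp: flag_le_def)
  qed
  then show False using assms(3) by (auto simp: flagged_def)
qed

lemma theta_gens:
  assumes "x \<in> gens a' \<mu>" "keys \<mu> \<subseteq> {..k}"
  shows "theta (j0, k) (x :: _ \<Rightarrow>\<^sub>0 'k::comm_ring_1) \<in> fm.span (gens a (single k 1 + \<mu>))"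
  using assms(1) unfolding gens_def[of a']
proof (elim UnE CollectE exE conjE)
  fix \<tau> assume x: "x = single \<tau> 1" "finite \<tau>" "wt \<tau> = \<mu>" "\<not> flagged a' \<tau>"
  show ?thesis
  proof (cases "(j0, k) \<in> \<tau>")
    case True
    then show ?thesis by (simp add: x(1) theta_single fm.span_zero)
  next
    case False
    have "single (insert (j0, k) \<tau>) (1::'k) \<in> gens a (single k 1 + \<mu>)"
      unfolding gens_def using not_flagged_insert[OF x(2) _ x(4) False] x assms(2) False
      by (auto simp: wt_insert)
    then have "fm_scale ((- 1) ^ card {y \<in> \<tau>. y < (j0, k)}) (single (insert (j0, k) \<tau>) (1::'k))
        \<in> fm.span (gens a (single k 1 + \<mu>))"
      by (intro fm.span_scale fm.span_base)
    then show ?thesis using False x(2) by (simp add: x(1) theta_single)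
  qed
next
  fix L assume x: "x = prodL L" "wtm (mset L) = \<mu>" "exch a' (mset L)"
  have "vanishes TYPE('k) a (mset (({j0}, k) # L))" using vanishes_descent[OF x(3)] by simp
  then have "(prodL (({j0}, k) # L) :: _ \<Rightarrow>\<^sub>0 'k) \<in> fm.span (gens a (wtm (mset (({j0}, k) # L))))"
    using x(3) by (intro vanishesD) (auto simp: exch_def)
  then show ?thesis using x by (simp add: prodL_Cons)
qed

text \<open>Column \<open>j\<close> of the diagram is contained in column \<open>j0\<close>. Hence
  spreading the entry \<open>k\<close> and all entries of column \<open>j0\<close> over
  \<open>{j0, j}\<close> gives more factors than
  \<open>card (a j0 \<union> a j) = card (a j0)\<close>, an exchange relation. Narrowing the factors
  back one at a time costs only tensors with \<open>k\<close> in column \<open>j0\<close> and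
  tensors with too few entries there.\<close>

lemma single_exchange:
  assumes \<rho>: "finite \<rho>" "wt \<rho> = \<mu>" "flagged a \<rho>" "keys \<mu> \<subseteq> {..k}" and j: "(j, k) \<in> \<rho>" "k \<in> a j" "a j \<subseteq> {..k}"
  shows "single \<rho> (1::'k::comm_ring_1) \<in>
    fm.span (gens a \<mu> \<union> (\<lambda>\<tau>. single \<tau> 1) ` {\<tau>. finite \<tau> \<and> wt \<tau> = \<mu> \<and> (j0, k) \<in> \<tau>})"
    (is "_ \<in> fm.span ?W")
proof (cases "(j0, k) \<in> \<rho>")
  case True
  then show ?thesis using \<rho> by (intro fm.span_base) auto
next
  case nj0: False
  then have jj0: "j \<noteq> j0" using j by auto
  have "Suc k \<notin> a j" using j(3) by auto
  then have aj: "a j \<subseteq> a j0" using nested[OF jj0 j(2)] j(3) by auto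
  have in_W: "(prodL L :: _ \<Rightarrow>\<^sub>0 'k) \<in> fm.span ?W"
    if "wtm (mset L) = \<mu>" "\<And>\<tau>. \<tau> \<in> mons L \<Longrightarrow> (j0, k) \<in> \<tau> \<or> \<not> flagged a \<tau>" for L
  proof -
    have "(prodL L :: _ \<Rightarrow>\<^sub>0 'k) \<in> fm.span ((\<lambda>\<tau>. single \<tau> 1) ` mons L)"
      using keys_prodL by (simp add: span_single_iff)
    moreover have "(\<lambda>\<tau>. single \<tau> 1) ` mons L \<subseteq> ?W"
    proof (rule image_subsetI)
      fix \<tau> assume \<tau>: "\<tau> \<in> mons L"
      then have f: "finite \<tau>" "wt \<tau> = \<mu>" using that(1) by (simp_all add: mons_finite mons_wt)
      show "single \<tau> (1::'k) \<in> ?W"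
      proof (cases "flagged a \<tau>")
        case True
        then show ?thesis using that(2)[OF \<tau>] f by (intro UnI2 imageI) simp
      next
        case False
        then show ?thesis using f unfolding gens_def by blast
      qed
    qed
    ultimately show ?thesis using fm.span_mono by blast
  qed
  define b where "b = sorted_list_of_set (colset j0 \<rho>)"
  define \<rho>' where "\<rho>' = \<rho> - {(j, k)} - Pair j0 ` colset j0 \<rho>"
  define r where "r = sorted_list_of_set \<rho>'"
  define R where "R = map (\<lambda>(c, u). ({c}, u)) r"
  have fin\<rho>: "finite (colset j0 \<rho>)" "finite \<rho>'" using \<rho>(1) finite_colset by (auto simp: \<rho>'_def)
  have sb: "set b = colset j0 \<rho>" "distinct b" and sr: "set r = \<rho>'" "distinct r"
    using fin\<rho> by (auto simp: b_def r_def)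
  have lb: "length b = card (a j0)"
    using \<rho>(3) sb by (metis distinct_card flagged_def flag_le_def)
  have R0: "cnt (meets {j0}) (mset R) = 0"
    unfolding R_def using sr by (intro cnt_eq_0) (auto simp: meets_def \<rho>'_def colset_def)
  let ?xs = "(j, k) # map (Pair j0) b @ r"
  have "set ?xs = \<rho>" using sb sr j(1) by (auto simp: \<rho>'_def colset_def)
  moreover have "distinct ?xs"
    using sb sr jj0 by (auto simp: distinct_map inj_on_def \<rho>'_def)
  ultimately have s: "single \<rho> (1::'k) = prodL (map (\<lambda>(c, u). ({c}, u)) ?xs) \<or>
    single \<rho> (1::'k) = - prodL (map (\<lambda>(c, u). ({c}, u)) ?xs)"
    by (intro prodL_singletons)
  have xs: "map (\<lambda>(c, u). ({c}, u)) ?xs = ({j}, k) # map (Pair {j0}) b @ R" by (simp add: R_def)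
  have wtR: "single k 1 + wtm (image_mset (Pair C) (mset p) + image_mset (Pair C') (mset q) + mset R) = \<mu>"
    if "mset p + mset q = mset b" for p q C C'
  proof -
    have w: "wtm (X + Y) = wtm X + wtm Y" for X Y by (simp add: wtm_def)
    have c: "wtm (image_mset (Pair C) X) = wtm (image_mset (Pair {j0}) X)" for C X by (induction X) auto
    have "wtm (mset (map (\<lambda>(c, u). ({c}, u)) xs)) = wt (set xs)" if "distinct xs" for xs
      using that by (induction xs) (auto simp: wt_insert wt_def[of "{}"])
    from this[of ?xs] \<open>set ?xs = \<rho>\<close> \<open>distinct ?xs\<close> have "single k 1 + (wtm (image_mset (Pair {j0}) (mset b)) + wtm (mset R)) = \<mu>"
      unfolding xs using \<rho>(2) by (simp add: w)
    then show ?thesis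
      unfolding that[symmetric] w c[of C] c[of C'] by (simp add: w add.assoc)
  qed
  have fR: "finite (fst l)" if "l \<in> set R" for l using that by (auto simp: R_def)
  \<comment> \<open>Here \<open>p\<close> lists the entries already narrowed back to column
    \<open>j0\<close> and \<open>q\<close> those still spread over both columns; for empty
    \<open>p\<close> this is the exchange relation itself.\<close>
  have main: "(prodL (({j0, j}, k) # map (Pair {j0}) p @ map (Pair {j0, j}) q @ R) :: _ \<Rightarrow>\<^sub>0 'k) \<in> fm.span ?W"
    if "mset p + mset q = mset b" for p q
    using that
  proof (induction p arbitrary: q)
    case Nil
    have "size (mset q) = size (mset b)" using Nil by simp
    then have lq: "length q = length b" by simp
    let ?L = "({j0, j}, k) # map (Pair {j0, j}) q @ R"
    have "card (a j0 \<union> a j) = card (a j0)" using aj by (simp add: Un_absorb2)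
    then have "vanishes TYPE('k) a (mset ?L)"
      using lb lq jj0 by (intro vanishes_exch[of j0 j]) simp_all
    then have "(prodL ?L :: _ \<Rightarrow>\<^sub>0 'k) \<in> fm.span (gens a (wtm (mset ?L)))"
      by (rule vanishesD) (use fR in auto)
    moreover have "wtm (mset ?L) = \<mu>" using wtR[of "[]" q "{j0}" "{j0, j}"] Nil by simp
    ultimately show ?case using fm.span_mono[of "gens a \<mu>" ?W] by auto
  next
    case (Cons v p)
    let ?Z = "({j0, j}, k) # map (Pair {j0}) p @ map (Pair {j0, j}) q @ R"
    have "(prodL (({j0} \<union> {j}, v) # ?Z) :: _ \<Rightarrow>\<^sub>0 'k) \<in> fm.span ?W"
    proof -
      let ?Z' = "({j0, j}, k) # map (Pair {j0}) p @ map (Pair {j0, j}) (v # q) @ R"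
      have "(prodL ?Z' :: _ \<Rightarrow>\<^sub>0 'k) \<in> fm.span ?W" using Cons.prems by (intro Cons.IH) auto
      moreover have "mset (({j0} \<union> {j}, v) # ?Z) = mset ?Z'" by (simp add: insert_commute)
      ultimately show ?thesis by (rule prodL_mset_in_span)
    qed
    moreover have "(prodL (({j}, v) # ?Z) :: _ \<Rightarrow>\<^sub>0 'k) \<in> fm.span ?W"
    proof -
      let ?Y = "({j}, v) # map (Pair {j0}) p @ map (Pair {j0, j}) q @ R"
      have "(prodL (({j0, j}, k) # ?Y) :: _ \<Rightarrow>\<^sub>0 'k) \<in> fm.span ?W"
      proof (rule in_W)
        have "wtm (mset (({j0, j}, k) # ?Y)) = single k 1 + wtm (image_mset (Pair {j0}) (mset (v # p)) + image_mset (Pair {j0,j}) (mset q) + mset R)"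
          by (simp add: ac_simps)
        then show "wtm (mset (({j0, j}, k) # ?Y)) = \<mu>" using wtR[of "v # p" q "{j0}" "{j0, j}"] Cons.prems by simp
      next
        fix \<tau> assume "\<tau> \<in> mons (({j0, j}, k) # ?Y)"
        then obtain c \<sigma> where \<tau>: "\<tau> = insert (c, k) \<sigma>" "c = j0 \<or> c = j" "\<sigma> \<in> mons ?Y" by auto
        \<comment> \<open>The entry \<open>v\<close> has gone to column \<open>j\<close>. If
          \<open>k\<close> goes there as well, at most \<open>length b - 1\<close> factors can reach
          column \<open>j0\<close>, too few for \<open>a j0\<close>.\<close>
        show "(j0, k) \<in> \<tau> \<or> \<not> flagged a \<tau>"
        proof (cases "c = j0")
          case False
          then have "{x \<in> \<tau>. fst x \<in> {j0}} = {x \<in> \<sigma>. fst x \<in> {j0}}" using \<tau> by auto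
          then have "card (colset j0 \<tau>) = card {x \<in> \<sigma>. fst x \<in> {j0}}"
            using card_cols[of \<tau> "{j0}"] mons_finite[OF \<tau>(3)] \<tau>(1) by simp
          also have "\<dots> \<le> cnt (meets {j0}) (mset ?Y)" by (rule mons_count(2)[OF \<tau>(3)])
          also have "\<dots> = length p + length q" using R0 jj0 by (simp add: meets_def)
          also have "\<dots> < length b" using Cons.prems by (metis add_Suc lessI mset.simps(2) size_add_mset size_mset size_union)
          finally show ?thesis using lb flaggedD[of a \<tau> j0] by (auto simp: flag_le_def)
        qed (use \<tau> in auto)
      qed
      moreover have "mset (({j}, v) # ?Z) = mset (({j0, j}, k) # ?Y)" by simp
      ultimately show ?thesis by (rule prodL_mset_in_span)
    qed
    ultimately have "(prodL (({j0}, v) # ?Z) :: _ \<Rightarrow>\<^sub>0 'k) \<in> fm.span ?W"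
      by (rule prodL_Cons_in_span) (use jj0 in auto)
    moreover have "mset (({j0, j}, k) # map (Pair {j0}) (v # p) @ map (Pair {j0, j}) q @ R) = mset (({j0}, v) # ?Z)" by simp
    ultimately show ?case by (rule prodL_mset_in_span)
  qed
  have "(prodL (({j} \<union> {j0}, k) # map (Pair {j0}) b @ R) :: _ \<Rightarrow>\<^sub>0 'k) \<in> fm.span ?W"
    using main[of b "[]"] by (simp add: insert_commute)
  moreover have "(prodL (({j0}, k) # map (Pair {j0}) b @ R) :: _ \<Rightarrow>\<^sub>0 'k) \<in> fm.span ?W"
  proof (rule in_W)
    show "wtm (mset (({j0}, k) # map (Pair {j0}) b @ R)) = \<mu>" using wtR[of b "[]" "{j0}" "{j0}"] by simp
  qed auto
  ultimately have "(prodL (({j}, k) # map (Pair {j0}) b @ R) :: _ \<Rightarrow>\<^sub>0 'k) \<in> fm.span ?W"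
    by (rule prodL_Cons_in_span) (use jj0 in auto)
  then show ?thesis using s unfolding xs by (auto intro: fm.span_neg)
qed

text \<open>The tensors made admissible by the renaming have the entry \<open>k\<close> in a column
  whose last row is \<open>k\<close>. By \<open>single_exchange\<close> they reduce to tensors
  containing \<open>(j0, k)\<close>, and these are counted by the second summand.\<close>

lemma spans_descent:
  assumes s1: "spans TYPE('k::comm_ring_1) a (sw k (single k 1 + \<mu>)) c1"
    and s2: "spans TYPE('k) a' \<mu> c2" and keys: "keys \<mu> \<subseteq> {..k}"
  shows "spans TYPE('k) a (single k 1 + \<mu>) (c1 + c2)"
proof -
  let ?\<mu> = "single k 1 + \<mu>"
  have keys': "keys ?\<mu> \<subseteq> {..k}" using keys keys_add[of "single k 1" \<mu>] by auto
  then have "Suc k \<notin> keys ?\<mu>" by auto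
  then have "lookup ?\<mu> (Suc k) = 0" by (simp add: in_keys_iff)
  from spans_lift[OF s1 this] obtain B1 where
    B1: "finite B1" "int (card B1) \<le> c1" "\<forall>\<tau>\<in>B1. finite \<tau> \<and> wt \<tau> = ?\<mu>"
    "\<And>\<tau>. finite \<tau> \<Longrightarrow> wt \<tau> = ?\<mu> \<Longrightarrow> single \<tau> (1::'k) \<in> fm.span ((\<lambda>\<tau>. single \<tau> 1) ` B1 \<union> gens a ?\<mu> \<union>
      (\<lambda>\<tau>. single \<tau> 1) ` {\<rho>. finite \<rho> \<and> wt \<rho> = ?\<mu> \<and> flagged a \<rho> \<and> \<not> flagged a (ren k ` \<rho>)})"
    by blast
  obtain B2 where B2: "finite B2" "int (card B2) \<le> c2" "\<forall>\<tau>\<in>B2. finite \<tau> \<and> wt \<tau> = \<mu>"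
    "\<And>\<tau>. finite \<tau> \<Longrightarrow> wt \<tau> = \<mu> \<Longrightarrow> single \<tau> (1::'k) \<in> fm.span ((\<lambda>\<tau>. single \<tau> 1) ` B2 \<union> gens a' \<mu>)"
    using s2 unfolding spans_def by blast
  define B where "B = B1 \<union> insert (j0, k) ` {\<tau> \<in> B2. (j0, k) \<notin> \<tau>}"
  let ?S = "(\<lambda>\<tau>. single \<tau> (1::'k)) ` B \<union> gens a ?\<mu>"
  \<comment> \<open>Deleting \<open>(j0, k)\<close> leaves a tensor of weight \<mu>, which is
    expanded by the spanning set for \<open>a'\<close>; \<open>theta_gens\<close> allows multiplying
    this expansion by the generator again.\<close>
  have mem: "single \<tau> (1::'k) \<in> fm.span ?S" if \<tau>: "finite \<tau>" "wt \<tau> = ?\<mu>" "(j0, k) \<in> \<tau>" for \<tau>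
  proof -
    let ?\<tau> = "\<tau> - {(j0, k)}"
    have i: "insert (j0, k) ?\<tau> = \<tau>" using \<tau> by auto
    have "wt \<tau> = single k 1 + wt ?\<tau>" using wt_insert[of ?\<tau> "(j0, k)"] \<tau> i by auto
    then have "wt ?\<tau> = \<mu>" using \<tau>(2) by simp
    with \<tau>(1) have "single ?\<tau> (1::'k) \<in> fm.span ((\<lambda>\<tau>. single \<tau> 1) ` B2 \<union> gens a' \<mu>)"
      by (intro B2(4)) auto
    then have t: "theta (j0, k) (single ?\<tau> (1::'k)) \<in> fm.span ?S"
    proof (rule flin_span[OF flin_theta])
      fix x :: "_ \<Rightarrow>\<^sub>0 'k" assume "x \<in> (\<lambda>\<tau>. single \<tau> 1) ` B2 \<union> gens a' \<mu>"
      then show "theta (j0, k) x \<in> fm.span ?S"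
      proof
        assume "x \<in> gens a' \<mu>"
        from theta_gens[OF this keys] show ?thesis using fm.span_mono[of "gens a ?\<mu>" ?S] by auto
      next
        assume "x \<in> (\<lambda>\<tau>. single \<tau> 1) ` B2"
        then obtain \<sigma> where \<sigma>: "\<sigma> \<in> B2" "x = single \<sigma> 1" by auto
        show ?thesis
        proof (cases "(j0, k) \<in> \<sigma>")
          case True
          then show ?thesis by (simp add: \<sigma> theta_single fm.span_zero)
        next
          case False
          then have "single (insert (j0, k) \<sigma>) (1::'k) \<in> ?S" using \<sigma> by (auto simp: B_def)
          then have "fm_scale ((- 1) ^ card {y \<in> \<sigma>. y < (j0, k)}) (single (insert (j0, k) \<sigma>) (1::'k)) \<in> fm.span ?S"
            by (intro fm.span_scale fm.span_base)
          then show ?thesis using False \<sigma> B2(3) by (simp add: theta_single)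
        qed
      qed
    qed
    have "fm_scale ((- 1) ^ card {y \<in> ?\<tau>. y < (j0, k)}) (theta (j0, k) (single ?\<tau> (1::'k))) \<in> fm.span ?S"
      by (rule fm.span_scale[OF t])
    then show ?thesis
      using \<tau>(1) by (simp add: theta_single i power_mult_distrib[symmetric] del: insert_Diff_single)
  qed
  show ?thesis
    unfolding spans_def
  proof (intro exI[of _ B] conjI allI impI)
    show "finite B" using B1 B2 by (simp add: B_def)
    have "card B \<le> card B1 + card (insert (j0, k) ` {\<tau> \<in> B2. (j0, k) \<notin> \<tau>})"
      unfolding B_def by (rule card_Un_le)
    also have "card (insert (j0, k) ` {\<tau> \<in> B2. (j0, k) \<notin> \<tau>}) \<le> card {\<tau> \<in> B2. (j0, k) \<notin> \<tau>}"
      using B2(1) by (intro card_image_le) auto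
    also have "\<dots> \<le> card B2" using B2(1) by (intro card_mono) auto
    finally show "int (card B) \<le> c1 + c2" using B1(2) B2(2) by linarith
    show "\<forall>\<tau>\<in>B. finite \<tau> \<and> wt \<tau> = ?\<mu>" using B1(3) B2(3) by (auto simp: B_def wt_insert)
  next
    fix \<tau> :: "(nat \<times> nat) set" assume \<tau>: "finite \<tau>" "wt \<tau> = ?\<mu>"
    from B1(4)[OF \<tau>] show "single \<tau> (1::'k) \<in> fm.span ?S"
    proof (rule span_subset_trans, intro subsetI)
      fix x :: "_ \<Rightarrow>\<^sub>0 'k"
      assume "x \<in> (\<lambda>\<tau>. single \<tau> 1) ` B1 \<union> gens a ?\<mu> \<union>
        (\<lambda>\<tau>. single \<tau> 1) ` {\<rho>. finite \<rho> \<and> wt \<rho> = ?\<mu> \<and> flagged a \<rho> \<and> \<not> flagged a (ren k ` \<rho>)}"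
      then consider (B1) "x \<in> (\<lambda>\<tau>. single \<tau> 1) ` B1" | (gens) "x \<in> gens a ?\<mu>"
        | (low) \<rho> where "x = single \<rho> 1" "finite \<rho>" "wt \<rho> = ?\<mu>" "flagged a \<rho>" "\<not> flagged a (ren k ` \<rho>)"
        by blast
      then show "x \<in> fm.span ?S"
      proof cases
        case B1
        then show ?thesis by (intro fm.span_base) (auto simp: B_def)
      next
        case gens
        then show ?thesis by (intro fm.span_base) auto
      next
        case \<rho>: low
        then obtain j where "flag_le (colset j \<rho>) (a j)" "\<not> flag_le (transpose k (Suc k) ` colset j \<rho>) (a j)"
          by (auto simp: flagged_def colset_ren)
        from flag_le_lowered[OF this] have "k \<in> colset j \<rho> \<and> k \<in> a j \<and> a j \<subseteq> {..k}"
          using wt_subset_col[OF \<rho>(2), of "{..k}" j] keys' \<rho>(3) k_pos fin by auto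
        then have "single \<rho> (1::'k) \<in>
          fm.span (gens a ?\<mu> \<union> (\<lambda>\<tau>. single \<tau> 1) ` {\<tau>. finite \<tau> \<and> wt \<tau> = ?\<mu> \<and> (j0, k) \<in> \<tau>})"
          using \<rho> keys' by (intro single_exchange[of \<rho> _ j]) (auto simp: colset_def)
        then have "single \<rho> (1::'k) \<in> fm.span ?S"
        proof (rule span_subset_trans, intro subsetI)
          fix y :: "_ \<Rightarrow>\<^sub>0 'k"
          assume "y \<in> gens a ?\<mu> \<union> (\<lambda>\<tau>. single \<tau> 1) ` {\<tau>. finite \<tau> \<and> wt \<tau> = ?\<mu> \<and> (j0, k) \<in> \<tau>}"
          then show "y \<in> fm.span ?S"
          proof
            assume "y \<in> gens a ?\<mu>"
            then show ?thesis by (intro fm.span_base) auto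
          next
            assume "y \<in> (\<lambda>\<tau>. single \<tau> 1) ` {\<tau>. finite \<tau> \<and> wt \<tau> = ?\<mu> \<and> (j0, k) \<in> \<tau>}"
            then show ?thesis using mem by blast
          qed
        qed
        then show ?thesis using \<rho>(1) by simp
      qed
    qed
  qed
qed

end

section \<open>Schubert polynomials: existence and the recursion for their coefficients\<close>

section \<open>Substitution in polynomials\<close>

lemma sum_single_keys: "(\<Sum>v\<in>keys m. single v (lookup m v)) = (m :: 'v \<Rightarrow>\<^sub>0 'a::comm_monoid_add)"
  by (rule poly_mapping_eqI) (simp add: lookup_sum lookup_single when_def in_keys_iff)

text \<open>Only additivity is asked for, so that maps whose target has other scalars, such as
  \<open>box_hom\<close>, are covered.\<close>

lemma additive_poly_mapping_eqI:
  assumes "\<And>u v. f (u + v) = f u + (f v :: 'd::ab_group_add)" "\<And>u v. g (u + v) = g u + g v"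
    and "\<And>b c. f (single b c) = g (single b c)"
  shows "f v = g (v :: 'b \<Rightarrow>\<^sub>0 'a::comm_ring_1)"
proof -
  have "f 0 = 0" "g 0 = 0" using assms(1)[of 0 0] assms(2)[of 0 0] by simp_all
  then have s: "f (\<Sum>b\<in>A. single b (lookup v b)) = g (\<Sum>b\<in>A. single b (lookup v b))" for A
    by (induction A rule: infinite_finite_induct) (simp_all add: assms)
  from s[of "keys v"] show ?thesis by (simp only: sum_single_keys)
qed

definition subst_mono :: "('v \<Rightarrow> ('u, 'a::comm_ring_1) poly_ring) \<Rightarrow> ('v \<Rightarrow>\<^sub>0 nat) \<Rightarrow> ('u, 'a) poly_ring" where
  "subst_mono \<sigma> m = (\<Prod>v\<in>keys m. \<sigma> v ^ lookup m v)"

lemma subst_mono_superset: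
  "finite A \<Longrightarrow> keys m \<subseteq> A \<Longrightarrow> subst_mono \<sigma> m = (\<Prod>v\<in>A. \<sigma> v ^ lookup m v)"
  unfolding subst_mono_def by (rule prod.mono_neutral_left) (auto simp: in_keys_iff)

lemma subst_mono_0 [simp]: "subst_mono \<sigma> 0 = 1"
  by (simp add: subst_mono_def)

lemma subst_mono_add: "subst_mono \<sigma> (m + n) = subst_mono \<sigma> m * subst_mono \<sigma> n"
proof -
  have "keys (m + n) \<subseteq> keys m \<union> keys n" by (rule keys_add)
  then show ?thesis
    by (subst (1 2 3) subst_mono_superset[of "keys m \<union> keys n"])
       (auto simp: lookup_add power_add prod.distrib)
qed

lemma pconst_0 [simp]: "pconst 0 = 0" and pconst_1 [simp]: "pconst 1 = 1"
  by (simp_all add: pconst_def)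

lemma pconst_add: "pconst (c + d) = pconst c + pconst d"
  by (simp add: pconst_def single_add)

lemma pconst_mult: "pconst (c * d) = pconst c * pconst d"
  by (simp add: pconst_def mult_single)

lemma psubst_superset:
  "finite A \<Longrightarrow> keys f \<subseteq> A \<Longrightarrow> psubst \<sigma> f = (\<Sum>m\<in>A. pconst (lookup f m) * subst_mono \<sigma> m)"
  unfolding psubst_def subst_mono_def[symmetric]
  by (rule sum.mono_neutral_left) (auto simp: in_keys_iff)

lemma psubst_add: "psubst \<sigma> (f + g) = psubst \<sigma> f + psubst \<sigma> g"
proof -
  have "keys (f + g) \<subseteq> keys f \<union> keys g" by (rule keys_add)
  then show ?thesis
    by (subst (1 2 3) psubst_superset[of "keys f \<union> keys g"])
       (auto simp: lookup_add pconst_add distrib_right sum.distrib)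
qed

lemma psubst_single: "psubst \<sigma> (single m c) = pconst c * subst_mono \<sigma> m"
  by (subst psubst_superset[of "{m}"]) auto

lemma psubst_mult: "psubst \<sigma> (f * g) = psubst \<sigma> f * psubst \<sigma> g"
proof (rule additive_poly_mapping_eqI[of "\<lambda>f. psubst \<sigma> (f * g)" "\<lambda>f. psubst \<sigma> f * psubst \<sigma> g"])
  fix m c
  show "psubst \<sigma> (single m c * g) = psubst \<sigma> (single m c) * psubst \<sigma> g"
  proof (rule additive_poly_mapping_eqI[of "\<lambda>g. psubst \<sigma> (single m c * g)" "\<lambda>g. psubst \<sigma> (single m c) * psubst \<sigma> g"])
    fix n d
    show "psubst \<sigma> (single m c * single n d) = psubst \<sigma> (single m c) * psubst \<sigma> (single n d)"
      by (simp add: mult_single psubst_single subst_mono_add pconst_mult ac_simps)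
  qed (simp_all add: psubst_add distrib_left)
qed (simp_all add: psubst_add distrib_right)

lemma psubst_one [simp]: "psubst \<sigma> 1 = 1"
  using psubst_single[of \<sigma> 0 1] by simp

lemma psubst_pconst [simp]: "psubst \<sigma> (pconst c) = pconst c"
  using psubst_single[of \<sigma> 0 c] by (simp add: pconst_def[symmetric])

lemma psubst_pvar [simp]: "psubst \<sigma> (pvar v) = \<sigma> v"
  by (simp add: pvar_def psubst_single subst_mono_def)

lemma psubst_0 [simp]: "psubst \<sigma> 0 = 0"
  by (simp add: psubst_def)

lemma psubst_uminus: "psubst \<sigma> (- f) = - psubst \<sigma> f"
  using psubst_add[of \<sigma> f "- f"] by (simp add: eq_neg_iff_add_eq_0 add.commute)

lemma psubst_diff: "psubst \<sigma> (f - g) = psubst \<sigma> f - psubst \<sigma> g"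
  using psubst_add[of \<sigma> f "- g"] by (simp add: psubst_uminus)

lemma pvar_power: "pvar v ^ n = single (single v n) 1"
  by (induction n) (simp_all add: pvar_def mult_single single_add[symmetric])

lemma prod_single: "(\<Prod>i\<in>A. single (f i) 1) = (single (\<Sum>i\<in>A. f i) 1 :: ('v, 'a::comm_ring_1) poly_ring)"
  by (induction A rule: infinite_finite_induct) (simp_all add: mult_single)

lemma subst_mono_pvar: "subst_mono (\<lambda>v. pvar (h v)) m = single (\<Sum>v\<in>keys m. single (h v) (lookup m v)) 1"
  unfolding subst_mono_def pvar_power by (rule prod_single)

lemma poly_ring_induct [case_names const var add mult]:
  fixes f :: "('v, 'a::comm_ring_1) poly_ring"
  assumes c: "\<And>c. P (pconst c)" and v: "\<And>v. P (pvar v)"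
    and a: "\<And>f g. P f \<Longrightarrow> P g \<Longrightarrow> P (f + g)" and m: "\<And>f g. P f \<Longrightarrow> P g \<Longrightarrow> P (f * g)"
  shows "P f"
proof -
  have P1: "P 1" and P0: "P 0" using c[of 1] c[of 0] by simp_all
  have pw: "P (pvar v ^ n)" for v n by (induction n) (auto intro: P1 m v)
  have pr: "P (\<Prod>v\<in>A. pvar v ^ g v)" for A g
    by (induction A rule: infinite_finite_induct) (auto intro: P1 m pw)
  have mon: "P (single n d)" for n d
  proof -
    have "subst_mono pvar n = (single n 1 :: ('v, 'a) poly_ring)"
      using subst_mono_pvar[of "\<lambda>v. v" n, where ?'b='a] by (simp only: sum_single_keys)
    then have "P (single n 1)" using pr[of "lookup n" "keys n"] by (simp add: subst_mono_def)
    then have "P (pconst d * single n 1)" by (rule m[OF c])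
    then show ?thesis by (simp add: pconst_def mult_single)
  qed
  have "P (\<Sum>b\<in>A. single b (lookup f b))" for A
    by (induction A rule: infinite_finite_induct) (auto intro: P0 a mon)
  from this[of "keys f"] show ?thesis by (simp only: sum_single_keys)
qed

section \<open>Divided differences\<close>

lemma lookup_swap_vars: "lookup (swap_vars k f) m = lookup f (sw k m)"
proof -
  define h where "h f = Poly_Mapping.map_key (sw k) f" for f :: "(nat, int) poly_ring"
  have inj: "inj (sw k)" by (metis injI sw_sw)
  have lh: "lookup (h f) m = lookup f (sw k m)" for f m
    unfolding h_def by (simp add: Poly_Mapping.map_key.rep_eq inj)
  have "swap_vars k f = h f"
  proof (rule additive_poly_mapping_eqI[of "swap_vars k" h])
    fix n c
    have "sw k (\<Sum>v\<in>A. single v (lookup n v)) = (\<Sum>v\<in>A. single (transpose k (Suc k) v) (lookup n v))" for A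
      by (induction A rule: infinite_finite_induct) (simp_all add: sw_add sw_single)
    from this[of "keys n"] have "(\<Sum>v\<in>keys n. single (transpose k (Suc k) v) (lookup n v)) = sw k n"
      by (simp only: sum_single_keys)
    then have "swap_vars k (single n c) = single (sw k n) c"
      by (simp add: swap_vars_def psubst_single subst_mono_pvar) (simp add: pconst_def mult_single)
    also have "\<dots> = h (single n c)"
      by (rule poly_mapping_eqI) (auto simp: lh lookup_single when_def)
    finally show "swap_vars k (single n c) = h (single n c)" .
  qed (auto simp: swap_vars_def psubst_add h_def map_key_plus inj)
  then show ?thesis by (simp add: lh)
qed

lemma swap_vars_add: "swap_vars k (f + g) = swap_vars k f + swap_vars k g"
  and swap_vars_mult: "swap_vars k (f * g) = swap_vars k f * swap_vars k g"
  and swap_vars_diff: "swap_vars k (f - g) = swap_vars k f - swap_vars k g"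
  and swap_vars_pvar: "swap_vars k (pvar i) = pvar (transpose k (Suc k) i)"
  and swap_vars_pconst: "swap_vars k (pconst c) = pconst c"
  by (simp_all add: swap_vars_def psubst_add psubst_mult psubst_diff)

lemma swap_vars_swap_vars [simp]: "swap_vars k (swap_vars k f) = f"
  by (rule poly_mapping_eqI) (simp add: lookup_swap_vars)

lemma sw_commute: "Suc k < l \<Longrightarrow> sw k (sw l m) = sw l (sw k m)"
  by (rule poly_mapping_eqI) (auto simp: transpose_def)

lemma sw_braid: "sw k (sw (Suc k) (sw k m)) = sw (Suc k) (sw k (sw (Suc k) m))"
  by (rule poly_mapping_eqI) (auto simp: transpose_def)

lemma swap_vars_commute: "Suc k < l \<Longrightarrow> swap_vars k (swap_vars l f) = swap_vars l (swap_vars k f)"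
  by (rule poly_mapping_eqI) (simp add: lookup_swap_vars sw_commute[of k l])

lemma swap_vars_braid:
  "swap_vars k (swap_vars (Suc k) (swap_vars k f)) = swap_vars (Suc k) (swap_vars k (swap_vars (Suc k) f))"
  by (rule poly_mapping_eqI) (simp add: lookup_swap_vars sw_braid)

lemma pvar_diff_neq_0: "i \<noteq> j \<Longrightarrow> pvar i - pvar j \<noteq> (0 :: (nat, int) poly_ring)"
proof
  assume "i \<noteq> j" "pvar i - pvar j = (0 :: (nat, int) poly_ring)"
  then have "lookup (pvar i :: (nat, int) poly_ring) (single i 1) = lookup (pvar j :: (nat, int) poly_ring) (single i 1)" by simp
  then have "single j (1::nat) = single i 1" by (simp add: pvar_def lookup_single when_def split: if_splits)
  then have "lookup (single j (1::nat)) i = 1" by simp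
  then show False using \<open>i \<noteq> j\<close> by (simp add: lookup_single)
qed

lemma divided_difference_exists:
  "\<exists>g. (pvar k - pvar (k + 1)) * g = f - swap_vars k f"
proof (induction f rule: poly_ring_induct)
  case (const c)
  then show ?case by (intro exI[of _ 0]) (simp add: swap_vars_pconst)
next
  case (var v)
  consider "v = k" | "v = k + 1" | "v \<noteq> k" "v \<noteq> k + 1" by blast
  then show ?case
  proof cases
    case 1
    then show ?thesis by (intro exI[of _ 1]) (simp add: swap_vars_pvar)
  next
    case 2
    then show ?thesis by (intro exI[of _ "- 1"]) (simp add: swap_vars_pvar)
  next
    case 3
    then show ?thesis by (intro exI[of _ 0]) (simp add: swap_vars_pvar transpose_def)
  qed
next
  case (add f g)
  then obtain f' g' where fg: "(pvar k - pvar (k + 1)) * f' = f - swap_vars k f" "(pvar k - pvar (k + 1)) * g' = g - swap_vars k g"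
    by blast
  have "(pvar k - pvar (k + 1)) * (f' + g') = f + g - swap_vars k (f + g)"
    unfolding distrib_left fg by (simp add: swap_vars_add)
  then show ?case by blast
next
  case (mult f g)
  then obtain f' g' where fg: "(pvar k - pvar (k + 1)) * f' = f - swap_vars k f" "(pvar k - pvar (k + 1)) * g' = g - swap_vars k g"
    by blast
  \<comment> \<open>The witness is the Leibniz rule for divided differences, twisted by the
    interchange of the variables.\<close>
  have "(pvar k - pvar (k + 1)) * (f' * g + swap_vars k f * g')
      = ((pvar k - pvar (k + 1)) * f') * g + swap_vars k f * ((pvar k - pvar (k + 1)) * g')"
    by (simp add: algebra_simps)
  also have "\<dots> = f * g - swap_vars k (f * g)"
    unfolding fg by (simp add: swap_vars_mult algebra_simps)
  finally show ?case by blast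
qed

lemma divided_difference_unique:
  assumes "(pvar k - pvar (k + 1)) * g = f - swap_vars k f"
  shows "divided_difference k f = g"
  unfolding divided_difference_def
proof (rule the_equality)
  show "(pvar k - pvar (k + 1)) * g = f - swap_vars k f" by (rule assms)
next
  fix h assume "(pvar k - pvar (k + 1)) * h = f - swap_vars k f"
  then have "(pvar k - pvar (k + 1)) * h = (pvar k - pvar (k + 1)) * g" using assms by simp
  then show "h = g" using pvar_diff_neq_0[of k "k + 1"] by (simp add: mult_cancel_left)
qed

lemma divided_difference_eq:
  "(pvar k - pvar (Suc k)) * divided_difference k f = f - swap_vars k f"
proof -
  obtain g where g: "(pvar k - pvar (k + 1)) * g = f - swap_vars k f" using divided_difference_exists by blast
  show ?thesis using g divided_difference_unique[OF g] by simp
qed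

lemma divided_difference_unique':
  "(pvar k - pvar (Suc k)) * g = f - swap_vars k f \<Longrightarrow> divided_difference k f = g"
  using divided_difference_unique[of k g f] by simp

lemma divided_difference_symmetric: "swap_vars k f = f \<Longrightarrow> divided_difference k f = 0"
  by (rule divided_difference_unique') simp

lemma divided_difference_pvar_mult: "swap_vars k f = f \<Longrightarrow> divided_difference k (pvar k * f) = f"
  by (rule divided_difference_unique') (simp add: swap_vars_mult swap_vars_pvar algebra_simps)

lemma swap_vars_divided_difference: "swap_vars k (divided_difference k f) = divided_difference k f"
proof -
  have "swap_vars k ((pvar k - pvar (Suc k)) * divided_difference k f) = swap_vars k f - f"
    by (subst divided_difference_eq) (simp add: swap_vars_diff)
  then have "(pvar k - pvar (Suc k)) * swap_vars k (divided_difference k f) = f - swap_vars k f"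
    by (simp add: swap_vars_mult swap_vars_diff swap_vars_pvar algebra_simps)
  then show ?thesis using divided_difference_unique' by metis
qed

lemma divided_difference_square: "divided_difference k (divided_difference k f) = 0"
  by (rule divided_difference_symmetric) (rule swap_vars_divided_difference)

text \<open>Multiplied by both denominators, either side is the alternating sum of \<open>f\<close>
  over the group generated by the two commuting interchanges; denominators cancel in an integral
  domain.\<close>

lemma divided_difference_commute:
  assumes "Suc k < l"
  shows "divided_difference k (divided_difference l f) = divided_difference l (divided_difference k f)"
proof -
  let ?a = "pvar k - pvar (Suc k) :: (nat, int) poly_ring" and ?b = "pvar l - pvar (Suc l) :: (nat, int) poly_ring"
  have sb: "swap_vars k ?b = ?b" "swap_vars l ?a = ?a"
    using assms by (simp_all add: swap_vars_diff swap_vars_pvar transpose_def)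
  have k: "?a * ?b * divided_difference k (divided_difference l f) =
      f - swap_vars l f - (swap_vars k f - swap_vars k (swap_vars l f))"
  proof -
    have "?a * ?b * divided_difference k (divided_difference l f) =
       ?b * (divided_difference l f - swap_vars k (divided_difference l f))"
      by (simp add: divided_difference_eq mult.assoc mult.left_commute)
    also have "\<dots> = (f - swap_vars l f) - swap_vars k (?b * divided_difference l f)"
      unfolding swap_vars_mult sb by (simp add: right_diff_distrib divided_difference_eq)
    finally show ?thesis by (simp add: divided_difference_eq swap_vars_diff)
  qed
  have l: "?a * ?b * divided_difference l (divided_difference k f) =
      f - swap_vars k f - (swap_vars l f - swap_vars l (swap_vars k f))"
  proof -
    have "?a * ?b * divided_difference l (divided_difference k f) =
       ?a * (divided_difference k f - swap_vars l (divided_difference k f))"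
      by (simp add: divided_difference_eq mult.assoc)
    also have "\<dots> = (f - swap_vars k f) - swap_vars l (?a * divided_difference k f)"
      unfolding swap_vars_mult sb by (simp add: right_diff_distrib divided_difference_eq)
    finally show ?thesis by (simp add: divided_difference_eq swap_vars_diff)
  qed
  have "?a * ?b * divided_difference k (divided_difference l f) = ?a * ?b * divided_difference l (divided_difference k f)"
    unfolding k l using swap_vars_commute[OF assms] by simp
  then show ?thesis using pvar_diff_neq_0[of k "Suc k"] pvar_diff_neq_0[of l "Suc l"] by simp
qed

text \<open>Multiplied by \<open>x * y * z\<close>, either side is the alternating sum of
  \<open>f\<close> over the six permutations of the three variables; the two sums differ only in the
  word for the longest permutation.\<close>

lemma divided_difference_braid:
  "divided_difference k (divided_difference (Suc k) (divided_difference k f)) =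
   divided_difference (Suc k) (divided_difference k (divided_difference (Suc k) f))"
proof -
  define x y z :: "(nat, int) poly_ring" where "x = pvar k - pvar (Suc k)" and "y = pvar (Suc k) - pvar (Suc (Suc k))"
    and "z = pvar k - pvar (Suc (Suc k))"
  let ?s = "swap_vars k" and ?t = "swap_vars (Suc k)" and ?d = "divided_difference k" and ?e = "divided_difference (Suc k)"
  have z: "z = x + y" by (simp add: x_def y_def z_def)
  have st: "?s y = z" "?t x = z" "?s z = y" "?t z = x"
    by (simp_all add: x_def y_def z_def swap_vars_diff swap_vars_pvar transpose_def)
  have Ed: "x * ?d f = f - ?s f" and Ee: "y * ?e f = f - ?t f" for f
    by (simp_all add: x_def y_def divided_difference_eq)
  have L: "x * y * z * ?d (?e (?d f)) = f - ?s f - (?t f - ?t (?s f)) + (?s (?t f) - ?s (?t (?s f)))"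
  proof -
    let ?g = "?d f"
    have 1: "y * ?e ?g = ?g - ?t ?g" by (rule Ee)
    have "z * ?s (?e ?g) = ?s (y * ?e ?g)" by (simp add: swap_vars_mult st)
    then have 2: "z * ?s (?e ?g) = ?g - ?s (?t ?g)"
      by (simp add: 1 swap_vars_diff swap_vars_divided_difference)
    have 3: "x * ?g = f - ?s f" by (rule Ed)
    have "z * ?t ?g = ?t (x * ?g)" by (simp add: swap_vars_mult st)
    then have 4: "z * ?t ?g = ?t f - ?t (?s f)" by (simp add: 3 swap_vars_diff)
    have "y * ?s (?t ?g) = ?s (?t (x * ?g))" by (simp add: swap_vars_mult st)
    then have 5: "y * ?s (?t ?g) = ?s (?t f) - ?s (?t (?s f))" by (simp add: 3 swap_vars_diff)
    have "x * y * z * ?d (?e ?g) = y * z * (x * ?d (?e ?g))" by (simp add: ac_simps)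
    also have "\<dots> = y * z * (?e ?g - ?s (?e ?g))" by (simp only: Ed)
    also have "\<dots> = z * (y * ?e ?g) - y * (z * ?s (?e ?g))" by (simp add: algebra_simps)
    also have "\<dots> = x * ?g - z * ?t ?g + y * ?s (?t ?g)" unfolding 1 2 by (simp add: z algebra_simps)
    finally show ?thesis unfolding 3 4 5 .
  qed
  have R: "x * y * z * ?e (?d (?e f)) = f - ?t f - (?s f - ?s (?t f)) + (?t (?s f) - ?t (?s (?t f)))"
  proof -
    let ?g = "?e f"
    have 1: "x * ?d ?g = ?g - ?s ?g" by (rule Ed)
    have "z * ?t (?d ?g) = ?t (x * ?d ?g)" by (simp add: swap_vars_mult st)
    then have 2: "z * ?t (?d ?g) = ?g - ?t (?s ?g)"
      by (simp add: 1 swap_vars_diff swap_vars_divided_difference)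
    have 3: "y * ?g = f - ?t f" by (rule Ee)
    have "z * ?s ?g = ?s (y * ?g)" by (simp add: swap_vars_mult st)
    then have 4: "z * ?s ?g = ?s f - ?s (?t f)" by (simp add: 3 swap_vars_diff)
    have "x * ?t (?s ?g) = ?t (?s (y * ?g))" by (simp add: swap_vars_mult st)
    then have 5: "x * ?t (?s ?g) = ?t (?s f) - ?t (?s (?t f))" by (simp add: 3 swap_vars_diff)
    have "x * y * z * ?e (?d ?g) = x * z * (y * ?e (?d ?g))" by (simp add: ac_simps)
    also have "\<dots> = x * z * (?d ?g - ?t (?d ?g))" by (simp only: Ee)
    also have "\<dots> = z * (x * ?d ?g) - x * (z * ?t (?d ?g))" by (simp add: algebra_simps)
    also have "\<dots> = y * ?g - z * ?s ?g + x * ?t (?s ?g)" unfolding 1 2 by (simp add: z algebra_simps)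
    finally show ?thesis unfolding 3 4 5 .
  qed
  have "x * y * z * ?d (?e (?d f)) = x * y * z * ?e (?d (?e f))"
    unfolding L R swap_vars_braid by simp
  moreover have "x \<noteq> 0" "y \<noteq> 0" "z \<noteq> 0" unfolding x_def y_def z_def by (rule pvar_diff_neq_0, simp)+
  ultimately show ?thesis by simp
qed

section \<open>Inversions\<close>

definition inversions :: "(nat \<Rightarrow> nat) \<Rightarrow> (nat \<times> nat) set" where
  "inversions w = {(i, j). i < j \<and> w j < w i}"

definition len :: "(nat \<Rightarrow> nat) \<Rightarrow> nat" where
  "len w = card (inversions w)"

abbreviation adj :: "nat \<Rightarrow> nat \<Rightarrow> nat" where
  "adj k \<equiv> transpose k (Suc k)"

lemma inversions_subset:
  assumes "w permutes {1..N}"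
  shows "inversions w \<subseteq> {1..N} \<times> {1..N}"
proof
  fix x assume "x \<in> inversions w"
  then obtain i j where x: "x = (i, j)" "i < j" "w j < w i" by (auto simp: inversions_def)
  have out: "w l = l" if "l \<notin> {1..N}" for l using assms that by (rule permutes_not_in)
  have inn: "w l \<in> {1..N} \<longleftrightarrow> l \<in> {1..N}" for l using assms by (rule permutes_in_image)
  have "i \<in> {1..N}"
  proof (rule ccontr)
    assume "i \<notin> {1..N}"
    then show False using x out[of i] out[of j] inn[of j] by (cases "j \<in> {1..N}") auto
  qed
  moreover have "j \<in> {1..N}"
  proof (rule ccontr)
    assume "j \<notin> {1..N}"
    then show False using x out[of j] inn[of i] \<open>i \<in> {1..N}\<close> by auto
  qed
  ultimately show "x \<in> {1..N} \<times> {1..N}" using x by simp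
qed

lemma finite_inversions: "w permutes {1..N} \<Longrightarrow> finite (inversions w)"
  using inversions_subset finite_subset by blast

lemma len_le: "w permutes {1..N} \<Longrightarrow> len w \<le> N * N"
  using card_mono[OF _ inversions_subset[of w N]] by (simp add: len_def card_cartesian_product)

lemma inversions_ascent:
  assumes "w k < w (Suc k)"
  shows "inversions (w \<circ> adj k) = insert (k, Suc k) (map_prod (adj k) (adj k) ` inversions w)"
proof (rule Set.set_eqI, rule iffI)
  fix x assume "x \<in> inversions (w \<circ> adj k)"
  then obtain i j where x: "x = (i, j)" "i < j" "w (adj k j) < w (adj k i)" by (auto simp: inversions_def)
  show "x \<in> insert (k, Suc k) (map_prod (adj k) (adj k) ` inversions w)"
  proof (cases "i = k \<and> j = Suc k")
    case False
    then have "adj k i < adj k j" using x(2) by (auto simp: transpose_def)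
    then have "(adj k i, adj k j) \<in> inversions w" using x by (simp add: inversions_def)
    then have "map_prod (adj k) (adj k) (adj k i, adj k j) \<in> map_prod (adj k) (adj k) ` inversions w" by (rule imageI)
    then show ?thesis using x by simp
  qed (use x in simp)
next
  fix x assume "x \<in> insert (k, Suc k) (map_prod (adj k) (adj k) ` inversions w)"
  then consider "x = (k, Suc k)" | i j where "x = (adj k i, adj k j)" "i < j" "w j < w i"
    by (auto simp: inversions_def)
  then show "x \<in> inversions (w \<circ> adj k)"
  proof cases
    case 1
    then show ?thesis using assms by (simp add: inversions_def)
  next
    case (2 i j)
    then have "\<not> (i = k \<and> j = Suc k)" using assms by auto
    then have "adj k i < adj k j" using 2 by (auto simp: transpose_def)
    then show ?thesis using 2 by (simp add: inversions_def)
  qed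
qed

lemma len_ascent:
  assumes "w permutes {1..N}" "w k < w (Suc k)"
  shows "len (w \<circ> adj k) = Suc (len w)"
proof -
  have "(k, Suc k) \<notin> map_prod (adj k) (adj k) ` inversions w"
  proof
    assume "(k, Suc k) \<in> map_prod (adj k) (adj k) ` inversions w"
    then obtain x where x: "x \<in> inversions w" "map_prod (adj k) (adj k) x = (k, Suc k)" by (metis imageE)
    obtain i j where "x = (i, j)" by (cases x)
    then have ij: "adj k i = k" "adj k j = Suc k" "i < j" using x by (simp_all add: inversions_def)
    then have "i = Suc k" "j = k" by (metis transpose_apply_first transpose_involutory, metis transpose_apply_second transpose_involutory)
    then show False using ij by simp
  qed
  moreover have "inj (map_prod (adj k) (adj k))" by (simp add: prod.inj_map)
  ultimately show ?thesis
    unfolding len_def inversions_ascent[OF assms(2)]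
    using finite_inversions[OF assms(1)] by (simp add: card_image[OF inj_on_subset])
qed

lemma comp_adj_adj [simp]: "w \<circ> adj k \<circ> adj k = w"
  by (simp add: fun_eq_iff)

lemma adj_permutes: "1 \<le> k \<Longrightarrow> k < N \<Longrightarrow> adj k permutes {1..N}"
  by (rule permutes_swap_id) auto

lemma comp_adj_permutes: "w permutes {1..N} \<Longrightarrow> 1 \<le> k \<Longrightarrow> k < N \<Longrightarrow> w \<circ> adj k permutes {1..N}"
  by (rule permutes_compose[OF adj_permutes])

lemma longest_perm_permutes: "longest_perm N permutes {1..N}"
proof (rule bij_imp_permutes)
  show "bij_betw (longest_perm N) {1..N} {1..N}"
    by (rule bij_betw_byWitness[of _ "longest_perm N"]) (auto simp: longest_perm_def)
qed (auto simp: longest_perm_def)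

text \<open>Strict decrease yields \<open>w l + l \<le> N + 1\<close> going up from 1 and the
  opposite inequality going down from \<open>N\<close>.\<close>

lemma no_ascent_longest_perm:
  assumes w: "w permutes {1..N}" and desc: "\<And>k. 1 \<le> k \<Longrightarrow> k < N \<Longrightarrow> \<not> w k < w (Suc k)"
  shows "w = longest_perm N"
proof
  fix i
  have inn: "1 \<le> w l \<and> w l \<le> N" if "1 \<le> l" "l \<le> N" for l
    using permutes_in_image[OF w, of l] that by simp
  have inj: "inj w" using w by (rule permutes_inj)
  have lt: "w (Suc k) < w k" if "1 \<le> k" "k < N" for k
    using desc[OF that] inj by (metis inj_eq linorder_neqE_nat n_not_Suc_n)
  have up: "w l + l \<le> N + 1" if "1 \<le> l" "l \<le> N" for l
    using that
  proof (induction l rule: nat_induct_at_least)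
    case base
    then show ?case using inn[of 1] by simp
  next
    case (Suc l)
    then show ?case using lt[of l] by simp
  qed
  have down: "d < N \<Longrightarrow> N + 1 \<le> w (N - d) + (N - d)" for d
  proof (induction d)
    case 0
    then show ?case using inn[of N] by simp
  next
    case (Suc d)
    then have "Suc (N - Suc d) = N - d" by simp
    then have "w (N - d) < w (N - Suc d)" using lt[of "N - Suc d"] Suc.prems by simp
    then show ?case using Suc by simp
  qed
  show "w i = longest_perm N i"
  proof (cases "1 \<le> i \<and> i \<le> N")
    case True
    then show ?thesis using up[of i] down[of "N - i"] by (simp add: longest_perm_def)
  next
    case False
    then show ?thesis using permutes_not_in[OF w, of i] by (auto simp: longest_perm_def)
  qed
qed

section \<open>Existence of Schubert polynomials\<close>

text \<open>Some descending path from the longest permutation to \<open>w\<close> produces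
  \<open>f\<close>. The path is left open; that neither it nor \<open>N\<close> matters is the
  content of \<open>descends_unique\<close> and \<open>descends_mono\<close>.\<close>

inductive descends :: "nat \<Rightarrow> (nat \<Rightarrow> nat) \<Rightarrow> (nat, int) poly_ring \<Rightarrow> bool" for N where
  top: "descends N (longest_perm N) (\<Prod>i = 1..N. pvar i ^ (N - i))"
| step: "descends N w f \<Longrightarrow> 1 \<le> k \<Longrightarrow> k < N \<Longrightarrow> w (Suc k) < w k \<Longrightarrow>
    descends N (w \<circ> adj k) (divided_difference k f)"

lemma descends_permutes: "descends N w f \<Longrightarrow> w permutes {1..N}"
  by (induction rule: descends.induct) (rule longest_perm_permutes, rule comp_adj_permutes)

lemma descends_from_ascent:
  assumes "descends N (w \<circ> adj k) f" "1 \<le> k" "k < N" "w k < w (Suc k)"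
  shows "descends N w (divided_difference k f)"
  using descends.step[OF assms(1,2,3)] assms(4) by simp

lemma descends_ex:
  assumes "w permutes {1..N}"
  shows "\<exists>f. descends N w f"
  using assms
proof (induction "N * N - len w" arbitrary: w rule: less_induct)
  case less
  show ?case
  proof (cases "\<exists>k. 1 \<le> k \<and> k < N \<and> w k < w (Suc k)")
    case True
    then obtain k where k: "1 \<le> k" "k < N" "w k < w (Suc k)" by blast
    have p: "w \<circ> adj k permutes {1..N}" using less.prems k by (intro comp_adj_permutes)
    have "N * N - len (w \<circ> adj k) < N * N - len w"
      using len_ascent[OF less.prems k(3)] len_le[OF p] by simp
    then obtain f where "descends N (w \<circ> adj k) f" using less.hyps p by blast
    then show ?thesis using descends_from_ascent k by blast
  next
    case False
    then have "w = longest_perm N" using less.prems by (intro no_ascent_longest_perm) auto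
    then show ?thesis using descends.top by blast
  qed
qed

lemma descends_cases:
  assumes "descends N w f"
  shows "(w = longest_perm N \<and> f = (\<Prod>i = 1..N. pvar i ^ (N - i))) \<or>
    (\<exists>k g. 1 \<le> k \<and> k < N \<and> w k < w (Suc k) \<and> descends N (w \<circ> adj k) g \<and> f = divided_difference k g)"
  using assms
proof cases
  case (step v g k)
  then have "v = w \<circ> adj k" by simp
  then show ?thesis using step by (intro disjI2 exI[of _ k] exI[of _ g]) simp
qed simp

lemma comp_adj_commute: "Suc k < l \<Longrightarrow> w \<circ> adj k \<circ> adj l = w \<circ> adj l \<circ> adj k"
  by (auto simp: fun_eq_iff transpose_def)

lemma comp_adj_braid: "w \<circ> adj k \<circ> adj (Suc k) \<circ> adj k = w \<circ> adj (Suc k) \<circ> adj k \<circ> adj (Suc k)"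
  by (auto simp: fun_eq_iff transpose_def)

lemma longest_perm_no_ascent: "1 \<le> k \<Longrightarrow> k < N \<Longrightarrow> \<not> longest_perm N k < longest_perm N (Suc k)"
  by (auto simp: longest_perm_def)

text \<open>Two descending paths that arrive at \<open>w\<close> through different last steps are joined above \<open>w\<close> by
  the commutation and braid relations.\<close>

lemma descends_unique:
  assumes "descends N w f" "descends N w g"
  shows "f = g"
  using assms
proof (induction "N * N - len w" arbitrary: w f g rule: less_induct)
  case less
  have w: "w permutes {1..N}" using less.prems(1) by (rule descends_permutes)
  have IH: "f' = g'" if "descends N (w \<circ> adj k) f'" "descends N (w \<circ> adj k) g'" "1 \<le> k" "k < N" "w k < w (Suc k)" for k f' g'
  proof (rule less.hyps[OF _ that(1,2)])
    show "N * N - len (w \<circ> adj k) < N * N - len w"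
      using len_ascent[OF w that(5)] len_le[OF comp_adj_permutes[OF w that(3,4)]] by simp
  qed
  have far: "divided_difference k f' = divided_difference l g'"
    if "Suc k < l" "1 \<le> k" "l < N" "w k < w (Suc k)" "w l < w (Suc l)"
      "descends N (w \<circ> adj k) f'" "descends N (w \<circ> adj l) g'" for k l f' g'
  proof -
    have "w \<circ> adj k \<circ> adj l permutes {1..N}" using w that by (intro comp_adj_permutes) auto
    then obtain h where h: "descends N (w \<circ> adj k \<circ> adj l) h" using descends_ex by blast
    then have h': "descends N (w \<circ> adj l \<circ> adj k) h" by (subst comp_adj_commute[OF that(1), symmetric])
    have "descends N (w \<circ> adj k) (divided_difference l h)"
      using that by (intro descends_from_ascent[OF h]) (auto simp: transpose_def)
    then have f': "f' = divided_difference l h" using that by (intro IH[of k]) auto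
    have "descends N (w \<circ> adj l) (divided_difference k h)"
      using that by (intro descends_from_ascent[OF h']) (auto simp: transpose_def)
    then have g': "g' = divided_difference k h" using that by (intro IH[of l]) auto
    show ?thesis unfolding f' g' by (rule divided_difference_commute[OF that(1)])
  qed
  have near: "divided_difference k f' = divided_difference (Suc k) g'"
    if "1 \<le> k" "Suc k < N" "w k < w (Suc k)" "w (Suc k) < w (Suc (Suc k))"
      "descends N (w \<circ> adj k) f'" "descends N (w \<circ> adj (Suc k)) g'" for k f' g'
  proof -
    have "w \<circ> adj k \<circ> adj (Suc k) \<circ> adj k permutes {1..N}" using w that by (intro comp_adj_permutes) auto
    then obtain h where h: "descends N (w \<circ> adj k \<circ> adj (Suc k) \<circ> adj k) h" using descends_ex by blast
    then have h': "descends N (w \<circ> adj (Suc k) \<circ> adj k \<circ> adj (Suc k)) h" using comp_adj_braid[of w k] by simp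
    have "descends N (w \<circ> adj k \<circ> adj (Suc k)) (divided_difference k h)"
      using that by (intro descends_from_ascent[OF h]) (auto simp: transpose_def)
    then have "descends N (w \<circ> adj k) (divided_difference (Suc k) (divided_difference k h))"
      using that by (intro descends_from_ascent[of N "w \<circ> adj k"]) (auto simp: transpose_def)
    then have f': "f' = divided_difference (Suc k) (divided_difference k h)" using that by (intro IH[of k]) auto
    have "descends N (w \<circ> adj (Suc k) \<circ> adj k) (divided_difference (Suc k) h)"
      using that by (intro descends_from_ascent[OF h']) (auto simp: transpose_def)
    then have "descends N (w \<circ> adj (Suc k)) (divided_difference k (divided_difference (Suc k) h))"
      using that by (intro descends_from_ascent[of N "w \<circ> adj (Suc k)"]) (auto simp: transpose_def)
    then have g': "g' = divided_difference k (divided_difference (Suc k) h)" using that by (intro IH[of "Suc k"]) auto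
    show ?thesis unfolding f' g' by (rule divided_difference_braid)
  qed
  from descends_cases[OF less.prems(1)] show ?case
  proof (elim disjE exE conjE)
    assume top: "w = longest_perm N" "f = (\<Prod>i = 1..N. pvar i ^ (N - i))"
    then show "f = g" using descends_cases[OF less.prems(2)] longest_perm_no_ascent by blast
  next
    fix k f' assume k: "1 \<le> k" "k < N" "w k < w (Suc k)" "descends N (w \<circ> adj k) f'" "f = divided_difference k f'"
    from descends_cases[OF less.prems(2)] show "f = g"
    proof (elim disjE exE conjE)
      assume top: "w = longest_perm N"
      then show "f = g" using k longest_perm_no_ascent by blast
    next
      fix l g' assume l: "1 \<le> l" "l < N" "w l < w (Suc l)" "descends N (w \<circ> adj l) g'" "g = divided_difference l g'"
      consider "k = l" | "Suc k < l" | "Suc l < k" | "l = Suc k" | "k = Suc l" by linarith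
      then show "f = g"
      proof cases
        case 1
        then show ?thesis using k l IH[of k f' g'] by simp
      next
        case 2
        then show ?thesis using k l far[of k l f' g'] by simp
      next
        case 3
        then show ?thesis using k l far[of l k g' f'] by simp
      next
        case 4
        then show ?thesis using k l near[of k f' g'] by simp
      next
        case 5
        then show ?thesis using k l near[of l g' f'] by simp
      qed
    qed
  qed
qed

lemma swap_vars_one: "swap_vars k 1 = 1"
  by (simp add: swap_vars_def)

lemma swap_vars_power: "swap_vars k (f ^ n) = swap_vars k f ^ n"
  by (induction n) (simp_all add: swap_vars_one swap_vars_mult)

lemma swap_vars_prod: "swap_vars k (\<Prod>i\<in>A. f i) = (\<Prod>i\<in>A. swap_vars k (f i))"
  by (induction A rule: infinite_finite_induct) (simp_all add: swap_vars_one swap_vars_mult)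

text \<open>Stability under enlarging \<open>N\<close>. In \<open>v d\<close> the value
  \<open>N + 1\<close> has travelled from position 1 to position \<open>d + 1\<close>, and
  \<open>p d\<close> is the polynomial reached. Each step removes one factor
  \<open>pvar (Suc d)\<close>, because the rest is symmetric in the two variables
  interchanged.\<close>

lemma descends_top_Suc: "descends (Suc N) (longest_perm N) (\<Prod>i = 1..N. pvar i ^ (N - i))"
proof -
  define v where "v d j = (if 1 \<le> j \<and> j \<le> d then N + 1 - j else if j = d + 1 then N + 1
    else if d + 1 < j \<and> j \<le> N + 1 then N + 2 - j else j)" for d j
  define e where "e d i = (if i \<le> d then N - i else N + 1 - i)" for d i
  define p where "p d = (\<Prod>i\<in>{1..Suc N}. pvar i ^ e d i :: (nat, int) poly_ring)" for d
  have "d \<le> N \<Longrightarrow> descends (Suc N) (v d) (p d)" for d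
  proof (induction d)
    case 0
    have "v 0 = longest_perm (Suc N)" by (auto simp: v_def longest_perm_def fun_eq_iff)
    moreover have "p 0 = (\<Prod>i = 1..Suc N. pvar i ^ (Suc N - i))"
      unfolding p_def by (rule prod.cong) (auto simp: e_def)
    ultimately show ?case using descends.top[of "Suc N"] by (simp only:)
  next
    case (Suc d)
    have 1: "v (Suc d) = v d \<circ> adj (Suc d)"
      using Suc.prems by (auto simp: v_def fun_eq_iff transpose_def)
    have nd: "N - d = Suc (N - Suc d)" using Suc.prems by simp
    have "p d = (\<Prod>i\<in>{1..Suc N}. (if i = Suc d then pvar i else 1) * pvar i ^ e (Suc d) i)"
      unfolding p_def using Suc.prems
      by (intro prod.cong) (auto simp: e_def nd)
    also have "\<dots> = pvar (Suc d) * p (Suc d)"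
      unfolding prod.distrib p_def using Suc.prems by (subst prod.delta) auto
    finally have 2: "p d = pvar (Suc d) * p (Suc d)" .
    have sym: "swap_vars (Suc d) (p (Suc d)) = p (Suc d)"
    proof -
      have t: "adj (Suc d) permutes {1..Suc N}" using Suc.prems by (intro adj_permutes) auto
      have "p (Suc d) = (\<Prod>i\<in>{1..Suc N}. pvar (adj (Suc d) i) ^ e (Suc d) (adj (Suc d) i))"
        unfolding p_def by (subst prod.permute[OF t]) (simp add: comp_def)
      also have "\<dots> = (\<Prod>i\<in>{1..Suc N}. pvar (adj (Suc d) i) ^ e (Suc d) i)"
        using Suc.prems by (intro prod.cong) (auto simp: e_def transpose_def)
      also have "\<dots> = swap_vars (Suc d) (p (Suc d))"
        unfolding p_def swap_vars_prod swap_vars_power swap_vars_pvar ..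
      finally show ?thesis by simp
    qed
    have "descends (Suc N) (v d \<circ> adj (Suc d)) (divided_difference (Suc d) (p d))"
    proof (rule descends.step)
      show "descends (Suc N) (v d) (p d)" using Suc by simp
      show "v d (Suc (Suc d)) < v d (Suc d)" using Suc.prems by (simp add: v_def)
    qed (use Suc.prems in simp_all)
    then show ?case unfolding 1 2 divided_difference_pvar_mult[OF sym] .
  qed
  from this[of N] have "descends (Suc N) (v N) (p N)" by simp
  moreover have "v N = longest_perm N" by (auto simp: v_def longest_perm_def fun_eq_iff)
  moreover have "p N = (\<Prod>i = 1..N. pvar i ^ (N - i))"
  proof -
    have "{1..Suc N} = insert (Suc N) {1..N}" by auto
    then have "p N = pvar (Suc N) ^ e N (Suc N) * (\<Prod>i\<in>{1..N}. pvar i ^ e N i)"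
      unfolding p_def by simp
    also have "e N (Suc N) = 0" by (simp add: e_def)
    also have "(\<Prod>i\<in>{1..N}. pvar i ^ e N i :: (nat, int) poly_ring) = (\<Prod>i = 1..N. pvar i ^ (N - i))"
      by (rule prod.cong) (auto simp: e_def)
    finally show ?thesis by simp
  qed
  ultimately show ?thesis by simp
qed

lemma descends_Suc: "descends N w f \<Longrightarrow> descends (Suc N) w f"
proof (induction rule: descends.induct)
  case top
  show ?case by (rule descends_top_Suc)
next
  case (step w f k)
  then show ?case by (intro descends.step) auto
qed

lemma descends_mono: "N \<le> M \<Longrightarrow> descends N w f \<Longrightarrow> descends M w f"
  by (induction M rule: dec_induct) (auto intro: descends_Suc)

lemma fin_perm_permutes:
  assumes "fin_perm w"
  shows "\<exists>N\<ge>M. w permutes {1..N}"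
proof -
  have f: "finite {i. w i \<noteq> i}" and p: "w permutes {1..}" using assms by (auto simp: fin_perm_def)
  define N where "N = Max (insert M {i. w i \<noteq> i})"
  have "M \<le> N" and N: "w i \<noteq> i \<Longrightarrow> i \<le> N" for i using f by (auto simp: N_def)
  have "w permutes {1..N}"
    by (rule permutes_superset[OF p]) (use N in force)
  then show ?thesis using \<open>M \<le> N\<close> by blast
qed

text \<open>As \<open>schubert\<close> is chosen by \<open>SOME\<close>, existence is what makes its
  defining properties available. The descending paths define a family that does not depend on the
  path or on \<open>N\<close>.\<close>

lemma schubert_family_exists: "\<exists>S. is_schubert_family S"
proof -
  define S where "S w = (THE f. \<exists>N. descends N w f)" for w
  have S: "S w = f" if "descends N w f" for N w f
    unfolding S_def
  proof (rule the_equality)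
    show "\<exists>N. descends N w f" using that by blast
  next
    fix g assume "\<exists>N. descends N w g"
    then obtain M where "descends M w g" by blast
    then have "descends (max M N) w g" by (rule descends_mono[rotated]) simp
    moreover have "descends (max M N) w f" using that by (rule descends_mono[rotated]) simp
    ultimately show "g = f" by (rule descends_unique)
  qed
  have "divided_difference k (S w) = (if w k > w (k + 1) then S (w \<circ> transpose k (k + 1)) else 0)"
    if w: "fin_perm w" "1 \<le> k" for w k
  proof -
    obtain N where N: "N \<ge> Suc (Suc k)" "w permutes {1..N}" using fin_perm_permutes[OF w(1)] by blast
    obtain f where f: "descends N w f" using descends_ex[OF N(2)] by blast
    show ?thesis
    proof (cases "w (Suc k) < w k")
      case True
      have "descends N (w \<circ> adj k) (divided_difference k f)"
        using descends.step[OF f w(2) _ True] N by simp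
      then show ?thesis using True S[OF f] S by simp
    next
      case False
      have "w k \<noteq> w (Suc k)" using permutes_inj[OF N(2)] by (simp add: inj_eq)
      then have lt: "w k < w (Suc k)" using False by simp
      \<comment> \<open>At an ascent the polynomial is itself a divided difference with index
        \<open>k\<close>, so applying the operator once more gives 0.\<close>
      obtain h where "descends N (w \<circ> adj k) h"
        using descends_ex comp_adj_permutes[OF N(2) w(2)] N(1) by (metis Suc_le_lessD Suc_leD)
      then have "descends N w (divided_difference k h)"
        using w N lt by (intro descends_from_ascent) auto
      then have "S w = divided_difference k h" by (rule S)
      then show ?thesis using False by (simp add: divided_difference_square)
    qed
  qed
  moreover have "S (longest_perm N) = (\<Prod>i = 1..N. pvar i ^ (N - i))" for N
    by (rule S) (rule descends.top)
  ultimately show ?thesis unfolding is_schubert_family_def by blast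
qed

section \<open>Coefficients of Schubert polynomials\<close>

lemma is_schubert_family_schubert: "is_schubert_family schubert"
  unfolding schubert_def by (rule someI_ex[OF schubert_family_exists])

lemma schubert_longest: "schubert (longest_perm N) = (\<Prod>i = 1..N. pvar i ^ (N - i))"
  and schubert_divided_difference: "fin_perm w \<Longrightarrow> 1 \<le> k \<Longrightarrow>
    divided_difference k (schubert w) = (if w (Suc k) < w k then schubert (w \<circ> adj k) else 0)"
  using is_schubert_family_schubert unfolding is_schubert_family_def by simp_all

lemma lookup_single_mult: "lookup (single e c * g) (e + \<nu>) = c * lookup (g :: ('v, 'a::comm_ring_1) poly_ring) \<nu>"
proof -
  have "(\<lambda>g :: ('v, 'a) poly_ring. single (0::'v \<Rightarrow>\<^sub>0 nat) (lookup (single e c * g) (e + \<nu>))) g = (\<lambda>g. single 0 (c * lookup g \<nu>)) g"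
    by (rule additive_poly_mapping_eqI)
      (auto simp: distrib_left lookup_add single_add[symmetric] mult_single lookup_single when_def)
  from arg_cong[OF this, of "\<lambda>p. lookup p 0"] show ?thesis by simp
qed

lemma lookup_single_mult_eq_0:
  fixes g :: "('v, 'a::comm_ring_1) poly_ring"
  assumes "\<And>\<nu>. m \<noteq> e + \<nu>"
  shows "lookup (single e c * g) m = 0"
proof -
  have "(\<lambda>g :: ('v, 'a) poly_ring. single (0::'v \<Rightarrow>\<^sub>0 nat) (lookup (single e c * g) m)) g = (\<lambda>g. 0) g" for g :: "('v, 'a) poly_ring"
    by (rule additive_poly_mapping_eqI)
      (use assms in \<open>auto simp: distrib_left lookup_add single_add[symmetric] mult_single lookup_single when_def\<close>)
  from arg_cong[OF this, of "\<lambda>p. lookup p 0"] assms show ?thesis by auto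
qed

lemma lookup_pvar_mult:
  "lookup (pvar i * g) (single i 1 + \<nu>) = lookup (g :: ('v, 'a::comm_ring_1) poly_ring) \<nu>"
  unfolding pvar_def by (subst lookup_single_mult) simp

lemma lookup_pvar_mult_eq_0: "lookup m i = 0 \<Longrightarrow> lookup (pvar i * g) m = (0::'a::comm_ring_1)"
  unfolding pvar_def by (rule lookup_single_mult_eq_0) (auto simp: lookup_add)

lemma schubert_ascent_coeff:
  assumes "fin_perm w" "1 \<le> k" "w k < w (Suc k)"
  shows "lookup (schubert w) \<mu> = lookup (schubert w) (sw k \<mu>)"
proof -
  have "schubert w - swap_vars k (schubert w) = 0"
    using divided_difference_eq[of k "schubert w"] schubert_divided_difference[OF assms(1,2)] assms(3) by simp
  then have "schubert w = swap_vars k (schubert w)" by simp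
  then show ?thesis using lookup_swap_vars by metis
qed

text \<open>The product with \<open>x_(k+1)\<close> does not contribute to this coefficient, because
  the exponent of that variable is 0 in the monomial considered.\<close>

lemma schubert_descent_coeff:
  assumes "fin_perm w" "1 \<le> k" "w (Suc k) < w k" "lookup \<nu> (Suc k) = 0"
  shows "lookup (schubert w) (single k 1 + \<nu>) =
    lookup (schubert w) (sw k (single k 1 + \<nu>)) + lookup (schubert (w \<circ> adj k)) \<nu>"
proof -
  let ?g = "schubert (w \<circ> adj k)"
  have "pvar k * ?g - pvar (Suc k) * ?g = schubert w - swap_vars k (schubert w)"
    using divided_difference_eq[of k "schubert w"] schubert_divided_difference[OF assms(1,2)] assms(3)
    by (simp add: left_diff_distrib)
  then have "lookup (pvar k * ?g) (single k 1 + \<nu>) - lookup (pvar (Suc k) * ?g) (single k 1 + \<nu>) =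
    lookup (schubert w) (single k 1 + \<nu>) - lookup (schubert w) (sw k (single k 1 + \<nu>))"
    by (metis lookup_minus lookup_swap_vars)
  moreover have "lookup (pvar (Suc k) * ?g) (single k 1 + \<nu>) = 0"
    using assms(4) by (intro lookup_pvar_mult_eq_0) (simp add: lookup_add lookup_single)
  ultimately show ?thesis using lookup_pvar_mult[of k ?g \<nu>] by simp
qed

text \<open>A property of monomials that does not distinguish the two variables passes to the
  quotient. The coefficient of \<open>g\<close> at \<nu> is that of \<open>f\<close> at
  \<open>x_k * \<nu>\<close> plus that of \<open>g\<close> at \<open>x_k * \<nu> / x_(k+1)\<close>,
  so the induction is on the exponent of \<open>x_(k+1)\<close>.\<close>

lemma keys_quotient:
  assumes g: "(pvar k - pvar (Suc k)) * g = (f :: (nat, int) poly_ring)"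
    and Q: "\<And>m. m \<in> keys f \<Longrightarrow> Q m" "\<And>\<nu>. Q (single k 1 + \<nu>) \<longleftrightarrow> Q (single (Suc k) 1 + \<nu>)"
    and \<nu>: "\<nu> \<in> keys g"
  shows "Q (single k 1 + \<nu>)"
proof (rule ccontr)
  assume nQ: "\<not> Q (single k 1 + \<nu>)"
  have "\<not> Q (single k 1 + \<nu>) \<Longrightarrow> lookup g \<nu> = 0"
  proof (induction "lookup \<nu> (Suc k)" arbitrary: \<nu>)
    case 0
    have "lookup f (single k 1 + \<nu>) = 0"
      using 0(2) Q(1)[of "single k 1 + \<nu>"] not_in_keys_iff_lookup_eq_zero[of "single k 1 + \<nu>" f] by blast
    moreover have "lookup (pvar (Suc k) * g) (single k 1 + \<nu>) = 0"
      using 0 by (intro lookup_pvar_mult_eq_0) (simp add: lookup_add lookup_single)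
    ultimately show ?case
      using lookup_pvar_mult[of k g \<nu>] unfolding g[symmetric] by (simp add: left_diff_distrib lookup_minus)
  next
    case (Suc x)
    define \<nu>' where "\<nu>' = \<nu> - single (Suc k) 1"
    have \<nu>: "\<nu> = single (Suc k) 1 + \<nu>'"
      using Suc.hyps(2) by (intro poly_mapping_eqI) (auto simp: \<nu>'_def lookup_add lookup_minus lookup_single when_def)
    have "lookup f (single k 1 + \<nu>) = 0"
      using Suc.prems Q(1)[of "single k 1 + \<nu>"] not_in_keys_iff_lookup_eq_zero[of "single k 1 + \<nu>" f] by blast
    moreover have "lookup (pvar (Suc k) * g) (single k 1 + \<nu>) = lookup g (single k 1 + \<nu>')"
      unfolding \<nu> using lookup_pvar_mult[of "Suc k" g "single k 1 + \<nu>'"] by (simp add: ac_simps)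
    moreover have "lookup g (single k 1 + \<nu>') = 0"
    proof (rule Suc.hyps(1))
      show "x = lookup (single k 1 + \<nu>') (Suc k)"
        using Suc.hyps(2) unfolding \<nu> by (simp add: lookup_add lookup_single)
      show "\<not> Q (single k 1 + (single k 1 + \<nu>'))"
        using Suc.prems Q(2)[of "single k 1 + \<nu>'"] unfolding \<nu> by (simp add: ac_simps)
    qed
    ultimately show ?case
      using lookup_pvar_mult[of k g \<nu>] unfolding g[symmetric] by (simp add: left_diff_distrib lookup_minus)
  qed
  then show False using nQ \<nu> by (simp add: in_keys_iff)
qed

definition deg :: "(nat \<Rightarrow>\<^sub>0 nat) \<Rightarrow> nat" where
  "deg \<mu> = (\<Sum>v\<in>keys \<mu>. lookup \<mu> v)"

lemma deg_superset: "finite A \<Longrightarrow> keys \<mu> \<subseteq> A \<Longrightarrow> deg \<mu> = (\<Sum>v\<in>A. lookup \<mu> v)"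
  unfolding deg_def by (rule sum.mono_neutral_left) (auto simp: in_keys_iff)

lemma deg_add: "deg (\<mu> + \<nu>) = deg \<mu> + deg \<nu>"
proof -
  have "keys (\<mu> + \<nu>) \<subseteq> keys \<mu> \<union> keys \<nu>" by (rule keys_add)
  then show ?thesis
    by (subst (1 2 3) deg_superset[of "keys \<mu> \<union> keys \<nu>"]) (auto simp: lookup_add sum.distrib)
qed

lemma deg_single [simp]: "deg (single i c) = c"
  by (cases "c = 0") (simp_all add: deg_def)

lemma deg_0 [simp]: "deg 0 = 0"
  by (simp add: deg_def)

lemma deg_sum: "deg (\<Sum>i\<in>A. f i) = (\<Sum>i\<in>A. deg (f i))"
  by (induction A rule: infinite_finite_induct) (simp_all add: deg_add)

lemma deg_sw: "deg (sw k \<mu>) = deg \<mu>"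
proof -
  have "sw k \<mu> = (\<Sum>v\<in>keys \<mu>. single (adj k v) (lookup \<mu> v))"
  proof -
    have "sw k (\<Sum>v\<in>A. single v (lookup \<mu> v)) = (\<Sum>v\<in>A. single (adj k v) (lookup \<mu> v))" for A
      by (induction A rule: infinite_finite_induct) (simp_all add: sw_add sw_single)
    from this[of "keys \<mu>"] show ?thesis by (simp only: sum_single_keys)
  qed
  then have "deg (sw k \<mu>) = (\<Sum>v\<in>keys \<mu>. deg (single (adj k v) (lookup \<mu> v)))"
    by (simp only: deg_sum)
  then show ?thesis by (simp add: deg_def[of \<mu>])
qed

lemma permutes_fin_perm: "w permutes {1..N} \<Longrightarrow> fin_perm w"
  unfolding fin_perm_def
proof
  assume w: "w permutes {1..N}"
  show "w permutes {1..}" by (rule permutes_subset[OF w]) auto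
  have "{i. w i \<noteq> i} \<subseteq> {1..N}" using permutes_not_in[OF w] by blast
  then show "finite {i. w i \<noteq> i}" using finite_subset by blast
qed

text \<open>Each divided difference lowers the degree by one, as does the length along the path, so
  their difference is the one at the longest permutation. This constant is evaluated only in
  \<open>schubert_keys\<close>.\<close>

lemma schubert_keys_permutes:
  assumes "w permutes {1..N}" "\<mu> \<in> keys (schubert w)"
  shows "lookup \<mu> 0 = 0 \<and> deg \<mu> + len (longest_perm N) = len w + (\<Sum>i = 1..N. N - i)"
  using assms
proof (induction "N * N - len w" arbitrary: w \<mu> rule: less_induct)
  case less
  show ?case
  proof (cases "\<exists>k. 1 \<le> k \<and> k < N \<and> w k < w (Suc k)")
    case False
    then have w: "w = longest_perm N" using less.prems by (intro no_ascent_longest_perm) auto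
    have "schubert w = single (\<Sum>i = 1..N. single i (N - i)) 1"
      unfolding w schubert_longest pvar_power by (rule prod_single)
    then have "\<mu> = (\<Sum>i = 1..N. single i (N - i))" using less.prems(2) by simp
    then show ?thesis using w by (simp add: deg_sum lookup_sum lookup_single)
  next
    case True
    then obtain k where k: "1 \<le> k" "k < N" "w k < w (Suc k)" by blast
    let ?v = "w \<circ> adj k"
    have p: "?v permutes {1..N}" using less.prems k by (intro comp_adj_permutes)
    have lv: "len ?v = Suc (len w)" using len_ascent less.prems(1) k(3) by blast
    have m: "N * N - len ?v < N * N - len w" using lv len_le[OF p] by simp
    define Q where "Q \<nu> \<longleftrightarrow> lookup \<nu> 0 = 0 \<and> deg \<nu> + len (longest_perm N) = len ?v + (\<Sum>i = 1..N. N - i)" for \<nu>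
    have "schubert w = divided_difference k (schubert ?v)"
      using schubert_divided_difference[OF permutes_fin_perm[OF p] k(1)] k(3) by simp
    then have eq: "(pvar k - pvar (Suc k)) * schubert w = schubert ?v - swap_vars k (schubert ?v)"
      by (simp add: divided_difference_eq)
    have "Q (single k 1 + \<mu>)"
    proof (rule keys_quotient[OF eq _ _ less.prems(2)])
      fix m assume "m \<in> keys (schubert ?v - swap_vars k (schubert ?v))"
      then have "m \<in> keys (schubert ?v) \<or> sw k m \<in> keys (schubert ?v)"
        by (auto simp: in_keys_iff lookup_minus lookup_swap_vars)
      then have "Q m \<or> Q (sw k m)" using less.hyps[OF m p] unfolding Q_def by blast
      then show "Q m" unfolding Q_def using k(1) by (auto simp: deg_sw transpose_def)
    next
      fix \<nu> show "Q (single k 1 + \<nu>) \<longleftrightarrow> Q (single (Suc k) 1 + \<nu>)"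
        using k(1) by (simp add: Q_def deg_add lookup_add lookup_single)
    qed
    then show ?thesis unfolding Q_def lv by (simp add: deg_add lookup_add)
  qed
qed

lemma schubert_id: "schubert id = 1"
proof -
  have "longest_perm 0 = id" by (auto simp: longest_perm_def fun_eq_iff)
  then show ?thesis using schubert_longest[of 0] by simp
qed

lemma schubert_keys:
  assumes "w permutes {1..N}" "\<mu> \<in> keys (schubert w)"
  shows "lookup \<mu> 0 = 0" "deg \<mu> = len w"
proof -
  have "inversions id = {}" by (auto simp: inversions_def)
  then have "len id = 0" by (simp add: len_def)
  moreover have "id permutes {1..N}" by (rule permutes_id)
  \<comment> \<open>The polynomial of the identity is 1. Its exponent vector 0 fixes the constant
    without counting the inversions of the longest permutation.\<close>
  ultimately have "len (longest_perm N) = (\<Sum>i = 1..N. N - i)"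
    using schubert_keys_permutes[of id N 0] by (simp add: schubert_id)
  then show "lookup \<mu> 0 = 0" "deg \<mu> = len w" using schubert_keys_permutes[OF assms] by auto
qed

text \<open>The polynomial is symmetric in all variables from \<open>i\<close> on. Shifting the
  exponent to larger and larger variables eventually leaves the finite set of those that
  occur.\<close>

lemma schubert_coeff_eq_0_beyond:
  assumes "fin_perm w" "1 \<le> i" "\<And>k. i \<le> k \<Longrightarrow> w k < w (Suc k)" "0 < lookup \<mu> i"
  shows "lookup (schubert w) \<mu> = 0"
proof -
  let ?U = "\<Union> (keys ` keys (schubert w))"
  define M where "M = Suc (Max (insert 0 ?U))"
  have "finite ?U" by auto
  then have M: "v < M" if "v \<in> ?U" for v using that by (auto simp: M_def less_Suc_eq_le)
  have "\<lbrakk>i \<le> l; 0 < lookup \<mu> l\<rbrakk> \<Longrightarrow> lookup (schubert w) \<mu> = 0" for l \<mu>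
  proof (induction "M - l" arbitrary: l \<mu>)
    case 0
    have "\<mu> \<notin> keys (schubert w)"
    proof
      assume "\<mu> \<in> keys (schubert w)"
      moreover have "l \<in> keys \<mu>" using 0 by (simp add: in_keys_iff)
      ultimately have "l < M" using M by blast
      then show False using 0 by simp
    qed
    then show ?case by (simp add: in_keys_iff)
  next
    case (Suc d)
    have "lookup (schubert w) (sw l \<mu>) = 0"
      using Suc.hyps(2) Suc.prems by (intro Suc.hyps(1)[of "Suc l"]) auto
    moreover have "lookup (schubert w) \<mu> = lookup (schubert w) (sw l \<mu>)"
      using assms Suc.prems by (intro schubert_ascent_coeff) auto
    ultimately show ?case by simp
  qed
  then show ?thesis using assms by blast
qed

section \<open>Rothe diagrams at ascents and descents\<close>

section \<open>Columns of Rothe diagrams\<close>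

definition rcol :: "(nat \<Rightarrow> nat) \<Rightarrow> nat \<Rightarrow> nat set" where
  "rcol w j = {i. (i, j) \<in> rothe_diagram w}"

lemma rcol_iff: "i \<in> rcol w j \<longleftrightarrow> 1 \<le> i \<and> 1 \<le> j \<and> j < w i \<and> i < inv_into UNIV w j"
  by (simp add: rcol_def rothe_diagram_def)

lemma finite_rcol: "finite (rcol w j)"
  by (rule finite_subset[of _ "{..<inv_into UNIV w j}"]) (auto simp: rcol_iff)

lemma rcol_ascent:
  assumes "w permutes {1..N}" "w k < w (Suc k)" "k \<in> rcol w j"
  shows "Suc k \<in> rcol w j"
proof -
  have "inv_into UNIV w j \<noteq> Suc k"
  proof
    assume "inv_into UNIV w j = Suc k"
    then have "w (Suc k) = j" using permutes_inverses(1)[OF assms(1), of j] by simp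
    then show False using assms by (simp add: rcol_iff)
  qed
  then show ?thesis using assms by (auto simp: rcol_iff)
qed

lemma inv_comp_adj:
  assumes "w permutes {1..N}"
  shows "inv_into UNIV (w \<circ> adj k) = adj k \<circ> inv_into UNIV w"
proof -
  have "inv_into UNIV (w \<circ> adj k) = inv_into UNIV (adj k) \<circ> inv_into UNIV w"
    by (rule o_inv_distrib) (use permutes_bij[OF assms] in auto)
  then show ?thesis by simp
qed

text \<open>Passing to \<open>w \<circ> adj k\<close> removes the box in row \<open>k\<close> and
  column \<open>w (Suc k)\<close> and interchanges rows \<open>k\<close> and \<open>k + 1\<close>.
  The inclusions between columns rest on one remark: a row \<open>i\<close> of column
  \<open>j\<close> has \<open>w i > j\<close>, hence it lies in any column of smaller positive index
  whose value stands at a position after \<open>i\<close>.\<close>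

lemma descent_rcol:
  assumes w: "w permutes {1..N}" and k: "1 \<le> k" "k < N" and desc: "w (Suc k) < w k"
  shows "descent (rcol w) (rcol (w \<circ> adj k)) k (w (Suc k)) (w k)"
proof -
  have wi: "w (inv_into UNIV w j) = j" "inv_into UNIV w (w j) = j" for j using permutes_inverses[OF w] by auto
  have pos: "1 \<le> w (Suc k)" using permutes_in_image[OF w, of "Suc k"] k by auto
  have q: "inv_into UNIV w j = Suc k \<longleftrightarrow> j = w (Suc k)" "inv_into UNIV w j = k \<longleftrightarrow> j = w k" for j using wi by metis+
  note inv_u = inv_comp_adj[OF w, of k]
  show ?thesis
  proof
    show "0 < k" using k by simp
    show "finite (rcol w j)" for j by (rule finite_rcol)
    show "rcol (w \<circ> adj k) j = adj k ` rcol w j" if j: "j \<noteq> w (Suc k)" for j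
    proof (rule Set.set_eqI)
      fix i
      have qk: "inv_into UNIV w j \<noteq> Suc k" using q j by simp
      have e: "i < adj k (inv_into UNIV w j) \<longleftrightarrow> adj k i < inv_into UNIV w j" if "j < w (adj k i)"
      proof (cases "inv_into UNIV w j = k")
        case True
        then have "j = w k" using q by simp
        then have "adj k i \<noteq> Suc k" using that desc by auto
        then have "i \<noteq> k" by auto
        then show ?thesis using True by (auto simp: transpose_def)
      next
        case False
        then show ?thesis using qk by (auto simp: transpose_def)
      qed
      have p: "1 \<le> adj k i \<longleftrightarrow> 1 \<le> i" using k by (auto simp: transpose_def)
      show "i \<in> rcol (w \<circ> adj k) j \<longleftrightarrow> i \<in> adj k ` rcol w j"
        unfolding transpose_image_iff rcol_iff inv_u using e p by (auto simp: comp_def)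
    qed
    show "rcol (w \<circ> adj k) (w (Suc k)) = rcol w (w (Suc k)) - {k}"
    proof (rule Set.set_eqI)
      fix i
      have "adj k (inv_into UNIV w (w (Suc k))) = k" by (simp add: wi)
      moreover have "adj k i = i" if "i < k" using that by (simp add: transpose_def)
      ultimately show "i \<in> rcol (w \<circ> adj k) (w (Suc k)) \<longleftrightarrow> i \<in> rcol w (w (Suc k)) - {k}"
        unfolding rcol_iff inv_u Diff_iff by (auto simp: wi)
    qed
    show "k \<in> rcol w (w (Suc k))" using k pos desc by (simp add: rcol_iff wi)
    show "rcol w (w (Suc k)) \<subseteq> {..k}" by (auto simp: rcol_iff wi)
    show "k \<in> rcol w j" if "j \<noteq> w (Suc k)" "Suc k \<in> rcol w j" for j
      using that k desc by (auto simp: rcol_iff)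
    show "rcol w j \<inter> {..k} \<subseteq> rcol w (w (Suc k))" if "j \<noteq> w (Suc k)" "k \<in> rcol w j" "Suc k \<notin> rcol w j" for j
    proof -
      have "inv_into UNIV w j \<noteq> Suc k" using that q by simp
      then have "w (Suc k) < j" using that by (auto simp: rcol_iff)
      then show ?thesis using pos by (auto simp: rcol_iff wi)
    qed
    show "w k \<noteq> w (Suc k)" using desc by simp
    show "rcol w (w k) \<subseteq> rcol w (w (Suc k)) - {k}" using desc pos by (auto simp: rcol_iff wi)
    show "j \<noteq> w k \<and> rcol w j \<inter> {..<k} \<subseteq> rcol w (w k)"
      if j: "j \<noteq> w (Suc k)" "k \<notin> rcol w j" "\<not> rcol w j \<subseteq> {..<k}" for j
    proof -
      obtain i where "i \<in> rcol w j" "k \<le> i" using j(3) by (meson lessThan_iff not_less subsetI)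
      then have i: "k < inv_into UNIV w j" "1 \<le> j" by (auto simp: rcol_iff)
      then have "j \<noteq> w k" by (auto simp: wi)
      moreover from this have "w k < j" using j(2) i k by (auto simp: rcol_iff)
      ultimately show ?thesis using desc by (auto simp: rcol_iff wi)
    qed
  qed
qed

section \<open>Lower bound: minors of a generic lower triangular matrix\<close>

section \<open>Minors\<close>

text \<open>The minor with rows \<open>a\<close> and columns \<open>us\<close>.\<close>

fun mn :: "(nat \<Rightarrow> nat \<Rightarrow> 'a::comm_ring_1) \<Rightarrow> nat set \<Rightarrow> nat list \<Rightarrow> 'a" where
  "mn f a [] = (if a = {} then 1 else 0)"
| "mn f a (u # us) = (\<Sum>p\<in>a. (- 1) ^ card {q \<in> a. q < p} * f p u * mn f (a - {p}) us)"

lemma mn_cong: "(\<And>p u. p \<in> a \<Longrightarrow> u \<in> set us \<Longrightarrow> f p u = g p u) \<Longrightarrow> mn f a us = mn g a us"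
proof (induction us arbitrary: a)
  case (Cons u us)
  have "mn f (a - {p}) us = mn g (a - {p}) us" for p by (rule Cons.IH) (use Cons.prems in auto)
  then show ?case using Cons.prems by (auto intro!: sum.cong)
qed simp

lemma mn_map: "mn f a (map s us) = mn (\<lambda>p u. f p (s u)) a us"
  by (induction us arbitrary: a) simp_all

lemma psubst_sum: "psubst \<sigma> (\<Sum>i\<in>A. f i) = (\<Sum>i\<in>A. psubst \<sigma> (f i))"
  by (induction A rule: infinite_finite_induct) (simp_all add: psubst_add)

lemma psubst_prod: "psubst \<sigma> (\<Prod>i\<in>A. f i) = (\<Prod>i\<in>A. psubst \<sigma> (f i))"
  by (induction A rule: infinite_finite_induct) (simp_all add: psubst_mult)

lemma psubst_sign: "psubst \<sigma> ((- 1) ^ n) = (- 1) ^ n"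
  by (induction n) (simp_all add: psubst_uminus)

lemma psubst_mn: "psubst \<sigma> (mn f a us) = mn (\<lambda>p u. psubst \<sigma> (f p u)) a us"
  by (induction us arbitrary: a) (simp_all add: psubst_sum psubst_mult psubst_sign)

lemma psubst_fm_scale: "psubst \<sigma> (fm_scale c f) = fm_scale c (psubst \<sigma> f)"
  by (simp add: fm_scale_eq_pconst_mult psubst_mult)

lemma mn_length: "finite a \<Longrightarrow> card a \<noteq> length us \<Longrightarrow> mn f a us = 0"
proof (induction us arbitrary: a)
  case (Cons u us)
  have "mn f (a - {p}) us = 0" if "p \<in> a" for p
  proof (rule Cons.IH)
    have "card a = Suc (card (a - {p}))" using that Cons.prems(1) by (metis card_Suc_Diff1)
    then show "card (a - {p}) \<noteq> length us" using Cons.prems(2) by simp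
  qed (use Cons.prems in simp)
  then show ?case by simp
qed auto

text \<open>Sign bookkeeping for \<open>mn_transpose_rows\<close>: the position of row
  \<open>p\<close> shifts by one exactly if both rows are in \<open>a\<close> and \<open>p\<close>
  is one of them, which is also when the remaining rows cease to contain both.\<close>

lemma card_less_transpose:
  assumes "finite a" "p \<in> a"
  shows "(- 1 :: 'a::comm_ring_1) ^ card {q \<in> adj k ` a. q < adj k p} *
      (if k \<in> a - {p} \<and> Suc k \<in> a - {p} then - 1 else 1) =
    (if k \<in> a \<and> Suc k \<in> a then - 1 else 1) * (- 1) ^ card {q \<in> a. q < p}"
proof (cases "k \<in> a \<and> Suc k \<in> a")
  case True
  then have t: "adj k ` a = a" by simp
  consider "p = k" | "p = Suc k" | "p \<noteq> k" "p \<noteq> Suc k" by blast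
  then show ?thesis
  proof cases
    case 1
    have "{q \<in> a. q < Suc k} = insert k {q \<in> a. q < k}" using True by auto
    then have "card {q \<in> a. q < Suc k} = Suc (card {q \<in> a. q < k})" using assms(1) by simp
    then show ?thesis unfolding t using 1 True by simp
  next
    case 2
    have "{q \<in> a. q < Suc k} = insert k {q \<in> a. q < k}" using True by auto
    then have "card {q \<in> a. q < Suc k} = Suc (card {q \<in> a. q < k})" using assms(1) by simp
    then show ?thesis unfolding t using 2 True by simp
  next
    case 3
    then show ?thesis unfolding t using True by simp
  qed
next
  case False
  have "{q \<in> adj k ` a. q < adj k p} = adj k ` {q \<in> a. q < p}"
  proof (rule Set.set_eqI)
    fix q
    have "q < adj k p \<longleftrightarrow> adj k q < p" if "adj k q \<in> a"
    proof (cases "adj k q \<in> {k, Suc k} \<and> p \<in> {k, Suc k}")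
      case True
      then have "adj k q = p" using False that assms(2) by auto
      then show ?thesis by auto
    next
      case nt: False
      then show ?thesis by (auto simp: transpose_def split: if_splits)
    qed
    then show "q \<in> {q \<in> adj k ` a. q < adj k p} \<longleftrightarrow> q \<in> adj k ` {q \<in> a. q < p}"
      unfolding mem_Collect_eq transpose_image_iff by auto
  qed
  then have "card {q \<in> adj k ` a. q < adj k p} = card {q \<in> a. q < p}" by (simp add: card_image)
  then show ?thesis using False by auto
qed

lemma mn_transpose_rows:
  "finite a \<Longrightarrow> mn (\<lambda>p u. f (adj k p) u) (adj k ` a) us =
    (if k \<in> a \<and> Suc k \<in> a then - 1 else 1) * mn f a us"
proof (induction us arbitrary: a)
  case (Cons u us)
  let ?e = "\<lambda>a. if k \<in> a \<and> Suc k \<in> a then - 1 else 1 :: 'a"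
  have "mn (\<lambda>p u. f (adj k p) u) (adj k ` a) (u # us) =
    (\<Sum>p\<in>a. (- 1) ^ card {q \<in> adj k ` a. q < adj k p} * f p u * mn (\<lambda>p u. f (adj k p) u) (adj k ` a - {adj k p}) us)"
    by (simp add: sum.reindex[OF inj_on_transpose])
  also have "\<dots> = (\<Sum>p\<in>a. ?e a * ((- 1) ^ card {q \<in> a. q < p} * f p u * mn f (a - {p}) us))"
  proof (rule sum.cong[OF refl])
    fix p assume p: "p \<in> a"
    have "adj k ` a - {adj k p} = adj k ` (a - {p})" by (auto simp: transpose_eq_iff)
    then have "mn (\<lambda>p u. f (adj k p) u) (adj k ` a - {adj k p}) us = ?e (a - {p}) * mn f (a - {p}) us"
      using Cons.IH[of "a - {p}"] Cons.prems by simp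
    moreover have "X * F * (E' * G) = E * (Y * F * G)" if "X * E' = E * Y" for X F E' G E Y :: 'a
    proof -
      have "X * F * (E' * G) = (X * E') * (F * G)" by (simp only: mult_ac)
      also have "\<dots> = E * (Y * F * G)" unfolding that by (simp only: mult_ac)
      finally show ?thesis .
    qed
    ultimately show "(- 1) ^ card {q \<in> adj k ` a. q < adj k p} * f p u * mn (\<lambda>p u. f (adj k p) u) (adj k ` a - {adj k p}) us
        = ?e a * ((- 1) ^ card {q \<in> a. q < p} * f p u * mn f (a - {p}) us)"
      using card_less_transpose[OF Cons.prems p, of k, where 'a='a] by (simp only:)
  qed
  finally show ?case by (simp add: sum_distrib_left)
qed simp

lemma mn_last_zero:
  assumes "\<And>p. p \<in> a \<Longrightarrow> f p k = 0"
  shows "mn f a (us @ [k]) = 0"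
  using assms
proof (induction us arbitrary: a)
  case (Cons u us)
  have "mn f (a - {p}) (us @ [k]) = 0" for p by (rule Cons.IH) (use Cons.prems in auto)
  then show ?case by simp
qed simp

text \<open>In the last column only row \<open>k\<close> is nonzero, and it is the last row, so its
  cofactor has sign +1. Since \<open>mn\<close> expands from the first column, this needs an
  induction over the other columns.\<close>

lemma mn_last:
  assumes "finite a" "k \<in> a" "a \<subseteq> {..k}" "\<And>p. p < k \<Longrightarrow> f p k = 0"
  shows "mn f a (us @ [k]) = f k k * mn f (a - {k}) us"
  using assms(1-3)
proof (induction us arbitrary: a)
  case Nil
  have "mn f a [k] = (\<Sum>p\<in>a. if p = k then (- 1) ^ card {q \<in> a. q < k} * f k k * mn f (a - {k}) [] else 0)"
    unfolding mn.simps(2)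
  proof (rule sum.cong[OF refl])
    fix p assume "p \<in> a"
    then show "(- 1) ^ card {q \<in> a. q < p} * f p k * mn f (a - {p}) [] =
      (if p = k then (- 1) ^ card {q \<in> a. q < k} * f k k * mn f (a - {k}) [] else 0)"
      using assms(4)[of p] Nil.prems(3) by (cases "p = k") auto
  qed
  also have "\<dots> = (- 1) ^ card {q \<in> a. q < k} * f k k * mn f (a - {k}) []"
    using Nil.prems by simp
  also have "\<dots> = f k k * mn f (a - {k}) []"
  proof (cases "a - {k} = {}")
    case True
    then have "{q \<in> a. q < k} = {}" by auto
    then show ?thesis by (simp only: card.empty power_0 mult_1)
  next
    case False
    then have "mn f (a - {k}) [] = 0" by simp
    then show ?thesis by (simp only: mult_zero_right)
  qed
  finally show ?case by simp
next
  case (Cons u us)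
  have kz: "mn f (a - {k}) (us @ [k]) = 0"
  proof (rule mn_last_zero)
    fix p assume "p \<in> a - {k}"
    then have "p \<le> k" "p \<noteq> k" using Cons.prems(3) by auto
    then show "f p k = 0" using assms(4) by simp
  qed
  have "mn f a ((u # us) @ [k]) = (\<Sum>p\<in>a - {k}. (- 1) ^ card {q \<in> a. q < p} * f p u * mn f (a - {p}) (us @ [k]))"
    using Cons.prems kz by (simp add: sum.remove[of a k])
  also have "\<dots> = (\<Sum>p\<in>a - {k}. f k k * ((- 1) ^ card {q \<in> a - {k}. q < p} * f p u * mn f (a - {k} - {p}) us))"
  proof (rule sum.cong[OF refl])
    fix p assume p: "p \<in> a - {k}"
    have IH: "mn f (a - {p}) (us @ [k]) = f k k * mn f (a - {p} - {k}) us"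
      using Cons.prems p by (intro Cons.IH) auto
    have "{q \<in> a. q < p} = {q \<in> a - {k}. q < p}" using p Cons.prems(3) by auto
    moreover have "a - {p} - {k} = a - {k} - {p}" by auto
    ultimately show "(- 1) ^ card {q \<in> a. q < p} * f p u * mn f (a - {p}) (us @ [k]) =
        f k k * ((- 1) ^ card {q \<in> a - {k}. q < p} * f p u * mn f (a - {k} - {p}) us)"
      unfolding IH by (simp only: mult_ac)
  qed
  finally show ?case by (simp add: sum_distrib_left)
qed

text \<open>The entries of a generic lower triangular matrix.
  A minor whose column set violates the flag condition vanishes on it.\<close>

definition tri :: "nat \<Rightarrow> nat \<Rightarrow> (nat \<times> nat, 'k::comm_ring_1) poly_ring" where
  "tri p u = (if u \<le> p then pvar (p, u) else 0)"

text \<open>A nonzero term would match every row up to \<open>i\<close> with a column not exceeding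
  that row, hence also up to \<open>i\<close>, and there are too few such columns.\<close>

lemma mn_tri_eq_0:
  assumes "finite a" "length (filter (\<lambda>u. u \<le> i) us) < card (a \<inter> {..i})"
  shows "mn tri a us = 0"
  using assms
proof (induction us arbitrary: a)
  case Nil
  then show ?case by auto
next
  case (Cons u us)
  have "tri p u * mn tri (a - {p}) us = (0 :: (nat \<times> nat, 'a) poly_ring)" if p: "p \<in> a" for p
  proof (cases "u \<le> i \<or> p \<le> i")
    case True
    show ?thesis
    proof (cases "u \<le> i")
      case u: True
      have "card (a \<inter> {..i}) \<le> card (insert p ((a - {p}) \<inter> {..i}))"
        using Cons.prems(1) by (intro card_mono) auto
      also have "\<dots> \<le> Suc (card ((a - {p}) \<inter> {..i}))" by (rule card_insert_le_m1) auto
      finally have "length (filter (\<lambda>u. u \<le> i) us) < card ((a - {p}) \<inter> {..i})"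
        using Cons.prems(2) u by simp
      then have "mn tri (a - {p}) us = (0 :: (nat \<times> nat, 'a) poly_ring)" using Cons.prems(1) by (intro Cons.IH) auto
      then show ?thesis by simp
    next
      case False
      then show ?thesis using True by (simp add: tri_def)
    qed
  next
    case False
    then have "(a - {p}) \<inter> {..i} = a \<inter> {..i}" by auto
    then have "mn tri (a - {p}) us = (0 :: (nat \<times> nat, 'a) poly_ring)"
      using Cons.prems False by (intro Cons.IH) auto
    then show ?thesis by simp
  qed
  then show ?case by (simp add: mult.assoc)
qed

lemma sorted_list_image_adj:
  assumes "b \<subseteq> {..k}"
  shows "map (adj k) (sorted_list_of_set b) = sorted_list_of_set (adj k ` b)"
proof -
  have fb: "finite b" using assms finite_subset by blast
  have "sorted (map (adj k) (sorted_list_of_set b))"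
  proof (rule sorted_map[THEN iffD2], rule sorted_wrt_mono_rel[of _ "(\<le>)"])
    fix x y assume "x \<in> set (sorted_list_of_set b)" "y \<in> set (sorted_list_of_set b)" "x \<le> y"
    then have "x \<le> k" "y \<le> k" "x \<le> y" using assms fb by auto
    then show "adj k x \<le> adj k y" by (auto simp: transpose_def)
  qed simp
  moreover have "distinct (map (adj k) (sorted_list_of_set b))" by (simp add: distinct_map)
  ultimately have "sorted_list_of_set (set (map (adj k) (sorted_list_of_set b))) = map (adj k) (sorted_list_of_set b)"
    by (rule sorted_list_of_set.idem_if_sorted_distinct)
  then show ?thesis using fb by simp
qed

definition psi :: "nat \<Rightarrow> (nat \<Rightarrow> nat set) \<Rightarrow> (nat \<times> nat) set \<Rightarrow> (nat \<times> nat, 'k::comm_ring_1) poly_ring" where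
  "psi m a \<tau> = (\<Prod>j\<in>{1..m}. mn tri (a j) (sorted_list_of_set (colset j \<tau>)))"

section \<open>Independent sets\<close>

text \<open>Independence is that of the family indexed by \<open>B\<close>: equal values of
  \<open>psi\<close> count as dependent, so \<open>card B\<close> is a lower bound for a
  dimension.\<close>

definition independent_at :: "'k::comm_ring_1 itself \<Rightarrow> nat \<Rightarrow> (nat \<Rightarrow> nat set) \<Rightarrow> (nat \<Rightarrow>\<^sub>0 nat) \<Rightarrow> int \<Rightarrow> bool" where
  "independent_at K m a \<mu> c \<longleftrightarrow> (\<exists>B. finite B \<and> c \<le> int (card B) \<and>
     (\<forall>\<tau>\<in>B. finite \<tau> \<and> wt \<tau> = \<mu> \<and> fst ` \<tau> \<subseteq> {1..m}) \<and>
     (\<forall>\<alpha>. (\<Sum>\<tau>\<in>B. fm_scale (\<alpha> \<tau>) (psi m a \<tau>)) = (0 :: (nat \<times> nat, 'k) poly_ring) \<longrightarrow> (\<forall>\<tau>\<in>B. \<alpha> \<tau> = 0)))"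

text \<open>On the triangular matrix this turns column \<open>k\<close> into column
  \<open>k + 1\<close>, see \<open>lower_hom_tri\<close>. The entry at \<open>(k, k)\<close> goes to
  0 because \<open>(k, k + 1)\<close> lies above the diagonal.\<close>

definition lower_hom :: "nat \<Rightarrow> (nat \<times> nat, 'k::comm_ring_1) poly_ring \<Rightarrow> (nat \<times> nat, 'k) poly_ring" where
  "lower_hom k = psubst (\<lambda>(p, u). if u = k then (if p = k then 0 else pvar (p, Suc k)) else pvar (p, u))"

lemma lower_hom_sum: "lower_hom k (\<Sum>i\<in>A. f i) = (\<Sum>i\<in>A. lower_hom k (f i))"
  and lower_hom_fm_scale: "lower_hom k (fm_scale c g) = fm_scale c (lower_hom k g)"
  and lower_hom_add: "lower_hom k (g + h) = lower_hom k g + lower_hom k h"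
  and lower_hom_0: "lower_hom k 0 = 0"
  by (simp_all add: lower_hom_def psubst_sum psubst_fm_scale psubst_add)

lemma lower_hom_tri: "u \<le> k \<Longrightarrow> lower_hom k (tri p u) = tri p (adj k u)"
  by (auto simp: lower_hom_def tri_def transpose_def)

lemma lower_hom_psi:
  assumes "finite \<tau>" "keys (wt \<tau>) \<subseteq> {..k}"
  shows "lower_hom k (psi m a \<tau>) = psi m a (ren k ` \<tau>)"
proof -
  have "lower_hom k (mn tri (a j) (sorted_list_of_set (colset j \<tau>))) =
      mn tri (a j) (sorted_list_of_set (colset j (ren k ` \<tau>)))" for j
  proof -
    have b: "colset j \<tau> \<subseteq> {..k}" using wt_subset_col[OF assms] .
    have "lower_hom k (mn tri (a j) (sorted_list_of_set (colset j \<tau>))) =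
        mn (\<lambda>p u. lower_hom k (tri p u)) (a j) (sorted_list_of_set (colset j \<tau>))"
      unfolding lower_hom_def by (rule psubst_mn)
    also have "\<dots> = mn (\<lambda>p u. tri p (adj k u)) (a j) (sorted_list_of_set (colset j \<tau>))"
      using b finite_colset[OF assms(1), of j] by (intro mn_cong lower_hom_tri) auto
    also have "\<dots> = mn tri (a j) (sorted_list_of_set (colset j (ren k ` \<tau>)))"
      unfolding colset_ren sorted_list_image_adj[OF b, symmetric] mn_map ..
    finally show ?thesis .
  qed
  note e = this
  have "lower_hom k (psi m a \<tau>) = (\<Prod>j\<in>{1..m}. lower_hom k (mn tri (a j) (sorted_list_of_set (colset j \<tau>))))"
    unfolding psi_def lower_hom_def psubst_prod ..
  then show ?thesis unfolding e psi_def .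
qed

lemma fst_ren: "fst ` ren k ` \<tau> = fst ` \<tau>"
  by (simp add: image_image ren_def)

lemma pvar_mult_eq_0:
  assumes "pvar v * g = (0 :: ('v, 'a::comm_ring_1) poly_ring)"
  shows "g = 0"
proof (rule poly_mapping_eqI)
  fix m
  show "lookup g m = lookup 0 m" using lookup_pvar_mult[of v g m] unfolding assms by simp
qed

lemma psi_neq_0:
  assumes "\<And>\<alpha>. (\<Sum>\<tau>\<in>B. fm_scale (\<alpha> \<tau>) (psi m a \<tau>)) = (0 :: (nat \<times> nat, 'k::comm_ring_1) poly_ring) \<Longrightarrow> \<forall>\<tau>\<in>B. \<alpha> \<tau> = 0"
    and "finite B" "\<tau> \<in> B"
  shows "psi m a \<tau> \<noteq> (0 :: (nat \<times> nat, 'k) poly_ring)"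
proof
  assume z: "psi m a \<tau> = (0 :: (nat \<times> nat, 'k) poly_ring)"
  have "(\<Sum>\<sigma>\<in>B. fm_scale (if \<sigma> = \<tau> then 1 else 0) (psi m a \<sigma>)) = (0 :: (nat \<times> nat, 'k) poly_ring)"
    by (rule sum.neutral) (use z in auto)
  from assms(1)[OF this] assms(3) show False by auto
qed

lemma independent_ascent:
  assumes "independent_at TYPE('k::comm_ring_1) m a (sw k \<mu>) c" "keys \<mu> \<subseteq> {..k}"
  shows "independent_at TYPE('k) m a \<mu> c"
proof -
  obtain B where B: "finite B" "c \<le> int (card B)" "\<forall>\<tau>\<in>B. finite \<tau> \<and> wt \<tau> = sw k \<mu> \<and> fst ` \<tau> \<subseteq> {1..m}"
    "\<And>\<alpha>. (\<Sum>\<tau>\<in>B. fm_scale (\<alpha> \<tau>) (psi m a \<tau>)) = (0 :: (nat \<times> nat, 'k) poly_ring) \<Longrightarrow> \<forall>\<tau>\<in>B. \<alpha> \<tau> = 0"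
    using assms(1) unfolding independent_at_def by blast
  have inj: "inj_on ((`) (ren k)) B" by (metis inj_onI ren_image_ren)
  show ?thesis unfolding independent_at_def
  proof (intro exI[of _ "(`) (ren k) ` B"] conjI allI impI)
    show "finite ((`) (ren k) ` B)" using B(1) by simp
    show "c \<le> int (card ((`) (ren k) ` B))" using B(2) by (simp add: card_image[OF inj])
    show "\<forall>\<tau>\<in>(`) (ren k) ` B. finite \<tau> \<and> wt \<tau> = \<mu> \<and> fst ` \<tau> \<subseteq> {1..m}"
      using B(3) by (simp add: wt_ren fst_ren)
  next
    fix \<alpha> assume s: "(\<Sum>\<tau>\<in>(`) (ren k) ` B. fm_scale (\<alpha> \<tau>) (psi m a \<tau>)) = (0 :: (nat \<times> nat, 'k) poly_ring)"
    have "lower_hom k (psi m a (ren k ` \<tau>)) = (psi m a \<tau> :: (nat \<times> nat, 'k) poly_ring)" if "\<tau> \<in> B" for \<tau>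
      using lower_hom_psi[of "ren k ` \<tau>" k m a] B(3) that assms(2) by (simp add: wt_ren)
    then have "(\<Sum>\<tau>\<in>B. fm_scale (\<alpha> (ren k ` \<tau>)) (psi m a \<tau> :: (nat \<times> nat, 'k) poly_ring)) = lower_hom k (\<Sum>\<tau>\<in>(`) (ren k) ` B. fm_scale (\<alpha> \<tau>) (psi m a \<tau> :: (nat \<times> nat, 'k) poly_ring))"
      by (simp add: sum.reindex[OF inj] lower_hom_sum lower_hom_fm_scale cong: sum.cong)
    also have "\<dots> = 0" unfolding s by (rule lower_hom_0)
    finally show "\<forall>\<tau>\<in>(`) (ren k) ` B. \<alpha> \<tau> = 0" using B(4)[of "\<lambda>\<tau>. \<alpha> (ren k ` \<tau>)"] by auto
  qed
qed

context descent
begin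

text \<open>The interchange of rows \<open>k\<close> and \<open>k + 1\<close>. In the columns up to
  \<open>k\<close> both rows consist of variables, so there it is compatible with the triangular
  shape.\<close>

definition row_hom :: "(nat \<times> nat, 'k::comm_ring_1) poly_ring \<Rightarrow> (nat \<times> nat, 'k) poly_ring" where
  "row_hom = psubst (\<lambda>(p, u). pvar (adj k p, u))"

lemma row_hom_sum: "row_hom (\<Sum>i\<in>A. f i) = (\<Sum>i\<in>A. row_hom (f i))"
  and row_hom_fm_scale: "row_hom (fm_scale c g) = fm_scale c (row_hom g)"
  and row_hom_0: "row_hom 0 = 0"
  by (simp_all add: row_hom_def psubst_sum psubst_fm_scale)

lemma row_hom_tri: "u \<le> k \<Longrightarrow> row_hom (tri p u) = tri (adj k p) u"
  by (auto simp: row_hom_def tri_def transpose_def)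

lemma row_hom_row_hom: "row_hom (row_hom f) = f"
proof (induction f rule: poly_ring_induct)
  case (var v)
  then show ?case by (cases v) (simp add: row_hom_def)
qed (simp_all add: row_hom_def psubst_add psubst_mult)

definition row_sign :: "nat \<Rightarrow> (nat \<times> nat, 'k::comm_ring_1) poly_ring" where
  "row_sign m = (\<Prod>j\<in>{1..m} - {j0}. if k \<in> a j \<and> Suc k \<in> a j then - 1 else 1)"

lemma row_sign_square: "row_sign m * row_sign m = 1"
  unfolding row_sign_def prod.distrib[symmetric] by (rule prod.neutral) auto

text \<open>In the minor for \<open>j0\<close>, row and column \<open>k\<close> come last, so the
  diagonal entry splits off. In the other columns \<open>a'\<close> is \<open>a\<close> with two
  rows interchanged, which \<open>row_hom\<close> matches up to the sign \<open>row_sign\<close>. If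
  \<open>k\<close> already were an entry of column \<open>j0\<close>, the minor on the rows
  \<open>a' j0\<close>, all smaller than \<open>k\<close>, would have a zero column.\<close>

lemma psi_insert:
  assumes \<tau>: "finite \<tau>" "keys (wt \<tau>) \<subseteq> {..k}" and j0: "j0 \<in> {1..m}"
    and nz: "psi m a' \<tau> \<noteq> (0 :: (nat \<times> nat, 'k::comm_ring_1) poly_ring)"
  shows "(j0, k) \<notin> \<tau>"
    and "psi m a (insert (j0, k) \<tau>) = (row_sign m * (pvar (k, k) * row_hom (psi m a' \<tau>)) :: (nat \<times> nat, 'k) poly_ring)"
proof -
  let ?s = "\<lambda>j. sorted_list_of_set (colset j \<tau>)"
  have le: "u \<le> k" if "u \<in> set (?s j)" for u j
    using that wt_subset_col[OF \<tau>] finite_colset[OF \<tau>(1), of j] by auto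
  have hom: "row_hom (mn tri (a' j) (?s j)) = mn (\<lambda>p u. tri (adj k p) u) (a' j) (?s j)" for j
  proof -
    have "row_hom (mn tri (a' j) (?s j)) = mn (\<lambda>p u. row_hom (tri p u)) (a' j) (?s j)"
      unfolding row_hom_def by (rule psubst_mn)
    also have "\<dots> = mn (\<lambda>p u. tri (adj k p) u) (a' j) (?s j)"
      using le by (intro mn_cong row_hom_tri) auto
    finally show ?thesis .
  qed
  have prod_split: "psi m b \<sigma> = mn tri (b j0) (sorted_list_of_set (colset j0 \<sigma>)) *
      (\<Prod>j\<in>{1..m} - {j0}. mn tri (b j) (sorted_list_of_set (colset j \<sigma>)))" for b \<sigma>
    unfolding psi_def using j0 by (simp add: prod.remove)
  have colk: "k \<notin> colset j0 \<tau>"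
  proof
    assume "k \<in> colset j0 \<tau>"
    then have ins: "colset j0 \<tau> = insert k (colset j0 \<tau> - {k})" by auto
    have "?s j0 = sorted_list_of_set (colset j0 \<tau> - {k}) @ [k]"
    proof -
      have "sorted_list_of_set (set (sorted_list_of_set (colset j0 \<tau> - {k}) @ [k])) = sorted_list_of_set (colset j0 \<tau> - {k}) @ [k]"
        using finite_colset[OF \<tau>(1), of j0] wt_subset_col[OF \<tau>, of j0]
        by (intro sorted_list_of_set.idem_if_sorted_distinct) (auto simp: sorted_append)
      moreover have "set (sorted_list_of_set (colset j0 \<tau> - {k}) @ [k]) = colset j0 \<tau>"
        using ins finite_colset[OF \<tau>(1), of j0] by auto
      ultimately show ?thesis by (simp only:)
    qed
    moreover have "mn tri (a' j0) (sorted_list_of_set (colset j0 \<tau> - {k}) @ [k]) = (0 :: (nat \<times> nat, 'k) poly_ring)"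
      using j0_minus by (intro mn_last_zero) (auto simp: a'_j0 tri_def)
    ultimately have "psi m a' \<tau> = (0 :: (nat \<times> nat, 'k) poly_ring)" unfolding prod_split by simp
    then show False using nz by simp
  qed
  then show "(j0, k) \<notin> \<tau>" by (simp add: colset_def)
  have c0: "colset j0 (insert (j0, k) \<tau>) = insert k (colset j0 \<tau>)" by (auto simp: colset_def)
  have s0: "sorted_list_of_set (insert k (colset j0 \<tau>)) = ?s j0 @ [k]"
  proof -
    have "sorted_list_of_set (set (?s j0 @ [k])) = ?s j0 @ [k]"
      using finite_colset[OF \<tau>(1), of j0] wt_subset_col[OF \<tau>, of j0] colk
      by (intro sorted_list_of_set.idem_if_sorted_distinct) (auto simp: sorted_append)
    moreover have "set (?s j0 @ [k]) = insert k (colset j0 \<tau>)" using finite_colset[OF \<tau>(1), of j0] by auto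
    ultimately show ?thesis by (simp only:)
  qed
  have "mn tri (a j0) (?s j0 @ [k]) = (tri k k * mn tri (a j0 - {k}) (?s j0) :: (nat \<times> nat, 'k) poly_ring)"
    by (rule mn_last[OF fin k_j0 j0_le]) (simp add: tri_def)
  moreover have "row_hom (mn tri (a' j0) (?s j0)) = (mn tri (a j0 - {k}) (?s j0) :: (nat \<times> nat, 'k) poly_ring)"
    unfolding hom unfolding a'_j0 using j0_minus by (intro mn_cong) (auto simp: transpose_def)
  ultimately have m0: "mn tri (a j0) (sorted_list_of_set (colset j0 (insert (j0, k) \<tau>))) =
      (pvar (k, k) * row_hom (mn tri (a' j0) (?s j0)) :: (nat \<times> nat, 'k) poly_ring)"
    unfolding c0 s0 by (simp add: tri_def)
  have mj: "mn tri (a j) (sorted_list_of_set (colset j (insert (j0, k) \<tau>))) =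
      ((if k \<in> a j \<and> Suc k \<in> a j then - 1 else 1) * row_hom (mn tri (a' j) (?s j)) :: (nat \<times> nat, 'k) poly_ring)"
    if "j \<noteq> j0" for j
  proof -
    have "colset j (insert (j0, k) \<tau>) = colset j \<tau>" using that by (auto simp: colset_def)
    moreover have "row_hom (mn tri (a' j) (?s j)) = ((if k \<in> a j \<and> Suc k \<in> a j then - 1 else 1) * mn tri (a j) (?s j) :: (nat \<times> nat, 'k) poly_ring)"
      unfolding hom unfolding a'_other[OF that] by (rule mn_transpose_rows[OF fin])
    ultimately show ?thesis by simp
  qed
  have rh: "row_hom (f * g) = row_hom f * row_hom g" "row_hom (\<Prod>i\<in>A. h i) = (\<Prod>i\<in>A. row_hom (h i))"
    for f g :: "(nat \<times> nat, 'k) poly_ring" and A and h :: "nat \<Rightarrow> (nat \<times> nat, 'k) poly_ring"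
    by (simp_all add: row_hom_def psubst_mult psubst_prod)
  have "(\<Prod>j\<in>{1..m} - {j0}. mn tri (a j) (sorted_list_of_set (colset j (insert (j0, k) \<tau>)))) =
     (\<Prod>j\<in>{1..m} - {j0}. (if k \<in> a j \<and> Suc k \<in> a j then - 1 else 1) * (row_hom (mn tri (a' j) (?s j)) :: (nat \<times> nat, 'k) poly_ring))"
    by (rule prod.cong) (auto simp: mj)
  then show "psi m a (insert (j0, k) \<tau>) = (row_sign m * (pvar (k, k) * row_hom (psi m a' \<tau>)) :: (nat \<times> nat, 'k) poly_ring)"
    unfolding prod_split[of a] prod_split[of a'] m0 rh row_sign_def prod.distrib by (simp only: mult_ac)
qed

lemma independent_descent:
  assumes i1: "independent_at TYPE('k::comm_ring_1) m a (sw k (single k 1 + \<mu>)) c1"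
    and i2: "independent_at TYPE('k) m a' \<mu> c2" and keys: "keys \<mu> \<subseteq> {..k}" and j0: "j0 \<in> {1..m}"
  shows "independent_at TYPE('k) m a (single k 1 + \<mu>) (c1 + c2)"
proof -
  let ?\<mu> = "single k 1 + \<mu>"
  have keys': "keys ?\<mu> \<subseteq> {..k}" using keys keys_add[of "single k 1" \<mu>] by auto
  obtain B1 where B1: "finite B1" "c1 \<le> int (card B1)" "\<forall>\<tau>\<in>B1. finite \<tau> \<and> wt \<tau> = ?\<mu> \<and> fst ` \<tau> \<subseteq> {1..m}"
      "\<And>\<alpha>. (\<Sum>\<tau>\<in>B1. fm_scale (\<alpha> \<tau>) (psi m a (ren k ` \<tau>))) = (0 :: (nat \<times> nat, 'k) poly_ring) \<Longrightarrow> \<forall>\<tau>\<in>B1. \<alpha> \<tau> = 0"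
  proof -
    obtain B where B: "finite B" "c1 \<le> int (card B)" "\<forall>\<tau>\<in>B. finite \<tau> \<and> wt \<tau> = sw k ?\<mu> \<and> fst ` \<tau> \<subseteq> {1..m}"
      "\<And>\<alpha>. (\<Sum>\<tau>\<in>B. fm_scale (\<alpha> \<tau>) (psi m a \<tau>)) = (0 :: (nat \<times> nat, 'k) poly_ring) \<Longrightarrow> \<forall>\<tau>\<in>B. \<alpha> \<tau> = 0"
      using i1 unfolding independent_at_def by blast
    have inj: "inj_on ((`) (ren k)) B" by (metis inj_onI ren_image_ren)
    show ?thesis
    proof (rule that[of "(`) (ren k) ` B"])
      show "finite ((`) (ren k) ` B)" using B(1) by simp
      show "c1 \<le> int (card ((`) (ren k) ` B))" using B(2) by (simp add: card_image[OF inj])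
      show "\<forall>\<tau>\<in>(`) (ren k) ` B. finite \<tau> \<and> wt \<tau> = ?\<mu> \<and> fst ` \<tau> \<subseteq> {1..m}"
        using B(3) by (simp add: wt_ren fst_ren)
    next
      fix \<alpha> assume s: "(\<Sum>\<tau>\<in>(`) (ren k) ` B. fm_scale (\<alpha> \<tau>) (psi m a (ren k ` \<tau>))) = (0 :: (nat \<times> nat, 'k) poly_ring)"
      then show "\<forall>\<tau>\<in>(`) (ren k) ` B. \<alpha> \<tau> = 0"
        using B(4)[of "\<lambda>\<tau>. \<alpha> (ren k ` \<tau>)"] by (simp add: sum.reindex[OF inj])
    qed
  qed
  obtain B2 where B2: "finite B2" "c2 \<le> int (card B2)" "\<forall>\<tau>\<in>B2. finite \<tau> \<and> wt \<tau> = \<mu> \<and> fst ` \<tau> \<subseteq> {1..m}"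
      "\<And>\<alpha>. (\<Sum>\<tau>\<in>B2. fm_scale (\<alpha> \<tau>) (psi m a' \<tau>)) = (0 :: (nat \<times> nat, 'k) poly_ring) \<Longrightarrow> \<forall>\<tau>\<in>B2. \<alpha> \<tau> = 0"
    using i2 unfolding independent_at_def by blast
  have nz: "psi m a' \<tau> \<noteq> (0 :: (nat \<times> nat, 'k) poly_ring)" if "\<tau> \<in> B2" for \<tau>
    using psi_neq_0[OF B2(4) B2(1) that] .
  have ins: "(j0, k) \<notin> \<tau>"
    "psi m a (insert (j0, k) \<tau>) = (row_sign m * (pvar (k, k) * row_hom (psi m a' \<tau>)) :: (nat \<times> nat, 'k) poly_ring)"
    if "\<tau> \<in> B2" for \<tau>
    using psi_insert[OF _ _ j0 nz[OF that]] B2(3) that keys by auto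
  let ?I = "insert (j0, k)"
  have inj: "inj_on ?I B2"
  proof (rule inj_onI)
    fix \<sigma> \<tau> assume "\<sigma> \<in> B2" "\<tau> \<in> B2" "?I \<sigma> = ?I \<tau>"
    then show "\<sigma> = \<tau>" using ins(1) by (metis insert_ident)
  qed
  have low1: "lower_hom k (psi m a \<tau>) = (psi m a (ren k ` \<tau>) :: (nat \<times> nat, 'k) poly_ring)" if "\<tau> \<in> B1" for \<tau>
    using lower_hom_psi B1(3) that keys' by metis
  have low2: "lower_hom k (psi m a (?I \<tau>)) = (0 :: (nat \<times> nat, 'k) poly_ring)" if "\<tau> \<in> B2" for \<tau>
    unfolding ins(2)[OF that] lower_hom_def psubst_mult by simp
  \<comment> \<open>A common element would have a \<open>psi\<close> that \<open>lower_hom\<close>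
    sends to 0, contrary to the independence of the values transported from
    \<open>B1\<close>.\<close>
  have disj: "B1 \<inter> ?I ` B2 = {}"
  proof (rule ccontr)
    assume "B1 \<inter> ?I ` B2 \<noteq> {}"
    then obtain \<tau> where \<tau>: "\<tau> \<in> B2" "?I \<tau> \<in> B1" by blast
    then have z: "psi m a (ren k ` ?I \<tau>) = (0 :: (nat \<times> nat, 'k) poly_ring)" using low1[OF \<tau>(2)] low2[OF \<tau>(1)] by (simp only:)
    have "(\<Sum>\<sigma>\<in>B1. fm_scale (if \<sigma> = ?I \<tau> then 1 else 0) (psi m a (ren k ` \<sigma>))) = (0 :: (nat \<times> nat, 'k) poly_ring)"
      by (rule sum.neutral) (use z in \<open>auto simp del: image_insert\<close>)
    from B1(4)[OF this] \<tau>(2) show False by auto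
  qed
  show ?thesis unfolding independent_at_def
  proof (intro exI[of _ "B1 \<union> ?I ` B2"] conjI allI impI)
    show "finite (B1 \<union> ?I ` B2)" using B1(1) B2(1) by simp
    show "c1 + c2 \<le> int (card (B1 \<union> ?I ` B2))"
      using B1(1,2) B2(1,2) disj by (simp add: card_Un_disjoint card_image[OF inj])
    show "\<forall>\<tau>\<in>B1 \<union> ?I ` B2. finite \<tau> \<and> wt \<tau> = ?\<mu> \<and> fst ` \<tau> \<subseteq> {1..m}"
      using B1(3) B2(3) ins(1) j0 by (auto simp: wt_insert)
  next
    fix \<alpha> assume s: "(\<Sum>\<tau>\<in>B1 \<union> ?I ` B2. fm_scale (\<alpha> \<tau>) (psi m a \<tau>)) = (0 :: (nat \<times> nat, 'k) poly_ring)"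
    have split: "(\<Sum>\<tau>\<in>B1. fm_scale (\<alpha> \<tau>) (psi m a \<tau>)) + (\<Sum>\<tau>\<in>B2. fm_scale (\<alpha> (?I \<tau>)) (psi m a (?I \<tau>))) = (0 :: (nat \<times> nat, 'k) poly_ring)"
      using s B1(1) B2(1) disj by (simp add: sum.union_disjoint sum.reindex[OF inj])
    have "lower_hom k (\<Sum>\<tau>\<in>B1. fm_scale (\<alpha> \<tau>) (psi m a \<tau>)) + lower_hom k (\<Sum>\<tau>\<in>B2. fm_scale (\<alpha> (?I \<tau>)) (psi m a (?I \<tau>))) = (0 :: (nat \<times> nat, 'k) poly_ring)"
      using arg_cong[OF split, of "lower_hom k"] by (simp only: lower_hom_add lower_hom_0)
    moreover have "lower_hom k (\<Sum>\<tau>\<in>B2. fm_scale (\<alpha> (?I \<tau>)) (psi m a (?I \<tau>))) = (0 :: (nat \<times> nat, 'k) poly_ring)"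
      by (simp add: low2 lower_hom_sum lower_hom_fm_scale cong: sum.cong)
    moreover have "lower_hom k (\<Sum>\<tau>\<in>B1. fm_scale (\<alpha> \<tau>) (psi m a \<tau>)) = (\<Sum>\<tau>\<in>B1. fm_scale (\<alpha> \<tau>) (psi m a (ren k ` \<tau>)) :: (nat \<times> nat, 'k) poly_ring)"
      by (simp add: low1 lower_hom_sum lower_hom_fm_scale cong: sum.cong)
    ultimately have "\<forall>\<tau>\<in>B1. \<alpha> \<tau> = 0" using B1(4)[of \<alpha>] by simp
    then have "(\<Sum>\<tau>\<in>B2. fm_scale (\<alpha> (?I \<tau>)) (psi m a (?I \<tau>))) = (0 :: (nat \<times> nat, 'k) poly_ring)"
      using split by simp
    moreover have "(\<Sum>\<tau>\<in>B2. fm_scale (\<alpha> (?I \<tau>)) (psi m a (?I \<tau>))) =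
      (row_sign m * (pvar (k, k) * row_hom (\<Sum>\<tau>\<in>B2. fm_scale (\<alpha> (?I \<tau>)) (psi m a' \<tau>))) :: (nat \<times> nat, 'k) poly_ring)"
      unfolding row_hom_sum row_hom_fm_scale sum_distrib_left
      by (rule sum.cong) (simp_all add: ins(2) fm_scale_eq_pconst_mult mult_ac)
    ultimately have "row_sign m * (pvar (k, k) * row_hom (\<Sum>\<tau>\<in>B2. fm_scale (\<alpha> (?I \<tau>)) (psi m a' \<tau>))) = (0 :: (nat \<times> nat, 'k) poly_ring)"
      by (simp only:)
    \<comment> \<open>Three cancellations valid over any commutative ring: \<open>row_sign m\<close>
      squares to 1, a variable is not a zero divisor, and \<open>row_hom\<close> is an
      involution.\<close>
    then have "row_sign m * (row_sign m * (pvar (k, k) * row_hom (\<Sum>\<tau>\<in>B2. fm_scale (\<alpha> (?I \<tau>)) (psi m a' \<tau>)))) = (0 :: (nat \<times> nat, 'k) poly_ring)"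
      by simp
    then have z: "pvar (k, k) * row_hom (\<Sum>\<tau>\<in>B2. fm_scale (\<alpha> (?I \<tau>)) (psi m a' \<tau>)) = (0 :: (nat \<times> nat, 'k) poly_ring)"
      unfolding mult.assoc[symmetric] row_sign_square by simp
    have "row_hom (\<Sum>\<tau>\<in>B2. fm_scale (\<alpha> (?I \<tau>)) (psi m a' \<tau>)) = (0 :: (nat \<times> nat, 'k) poly_ring)"
      by (rule pvar_mult_eq_0[OF z])
    then have "row_hom (row_hom (\<Sum>\<tau>\<in>B2. fm_scale (\<alpha> (?I \<tau>)) (psi m a' \<tau>))) = row_hom (0 :: (nat \<times> nat, 'k) poly_ring)" by simp
    then have "(\<Sum>\<tau>\<in>B2. fm_scale (\<alpha> (?I \<tau>)) (psi m a' \<tau>)) = (0 :: (nat \<times> nat, 'k) poly_ring)"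
      unfolding row_hom_row_hom by (simp add: row_hom_def)
    from B2(4)[OF this] \<open>\<forall>\<tau>\<in>B1. \<alpha> \<tau> = 0\<close> show "\<forall>\<tau>\<in>B1 \<union> ?I ` B2. \<alpha> \<tau> = 0" by auto
  qed
qed

end

section \<open>Both bounds equal the coefficient, by a double induction\<close>

section \<open>Induction along the recursion\<close>

lemma spans_none:
  assumes "\<And>\<tau>. finite \<tau> \<Longrightarrow> wt \<tau> = \<mu> \<Longrightarrow> \<not> flagged a \<tau>"
  shows "spans TYPE('k::comm_ring_1) a \<mu> 0"
  unfolding spans_def
proof (intro exI[of _ "{}"] conjI allI impI)
  fix \<tau> assume "finite \<tau>" "wt \<tau> = \<mu>"
  then have "single \<tau> (1::'k) \<in> gens a \<mu>" using assms unfolding gens_def by blast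
  then show "single \<tau> (1::'k) \<in> fm.span ((\<lambda>\<tau>. single \<tau> 1) ` {} \<union> gens a \<mu>)" by (intro fm.span_base) simp
qed auto

lemma independent_none: "independent_at TYPE('k::comm_ring_1) m a \<mu> 0"
  unfolding independent_at_def by (intro exI[of _ "{}"]) auto

lemma len_pos:
  assumes "w permutes {1..N}" "i \<in> rcol w j"
  shows "0 < len w" "i < N"
proof -
  have "(i, inv_into UNIV w j) \<in> inversions w"
    using assms permutes_inverses(1)[OF assms(1), of j] by (auto simp: inversions_def rcol_iff)
  then show "0 < len w" using finite_inversions[OF assms(1)] by (auto simp: len_def card_gt_0_iff)
  have "inv_into UNIV w j \<le> N"
    using \<open>(i, inv_into UNIV w j) \<in> inversions w\<close> inversions_subset[OF assms(1)] by auto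
  then show "i < N" using assms(2) by (auto simp: rcol_iff)
qed

text \<open>Without boxes there is no descent. Composing with \<open>longest_perm N\<close> then
  gives a permutation without ascents, which is known.\<close>

lemma no_box_id:
  assumes w: "w permutes {1..N}" and e: "\<And>j. rcol w j = {}"
  shows "w = id"
proof -
  have desc: "\<not> w (Suc k) < w k" if "1 \<le> k" "k < N" for k
  proof
    assume "w (Suc k) < w k"
    then interpret descent "rcol w" "rcol (w \<circ> adj k)" k "w (Suc k)" "w k"
      using w that by (intro descent_rcol)
    show False using k_j0 e by simp
  qed
  let ?v = "longest_perm N \<circ> w"
  have inn: "w l \<in> {1..N} \<longleftrightarrow> l \<in> {1..N}" for l using w by (rule permutes_in_image)
  have "?v = longest_perm N"
  proof (rule no_ascent_longest_perm)
    show "?v permutes {1..N}" by (rule permutes_compose[OF w longest_perm_permutes])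
    fix k assume k: "1 \<le> k" "k < N"
    then have "w k \<in> {1..N}" "w (Suc k) \<in> {1..N}" using inn by auto
    moreover have "w k \<le> w (Suc k)" using desc[OF k] by simp
    ultimately show "\<not> ?v k < ?v (Suc k)" by (simp add: longest_perm_def)
  qed
  then have "longest_perm N (w i) = longest_perm N i" for i by (metis comp_apply)
  then have "w i = i" for i using permutes_inj[OF longest_perm_permutes] by (metis injD)
  then show ?thesis by auto
qed

text \<open>The outer induction on the length serves the summand for \<open>w \<circ> adj k\<close>;
  the inner one serves the weight \<open>sw k \<mu>\<close>, whose largest index has grown by one.
  The inner one stops once that index reaches \<open>N\<close>.\<close>

theorem schubert_basis:
  assumes "w permutes {1..N}" "\<And>j. rcol w j \<noteq> {} \<Longrightarrow> j \<in> {1..m}"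
  shows "spans TYPE('k::comm_ring_1) (rcol w) \<mu> (lookup (schubert w) \<mu>) \<and>
    independent_at TYPE('k) m (rcol w) \<mu> (lookup (schubert w) \<mu>)"
  using assms
proof (induction "len w" arbitrary: w \<mu> rule: less_induct)
  case outer: less
  note w = outer.prems(1)
  have fp: "fin_perm w" using w by (rule permutes_fin_perm)
  let ?a = "rcol w"
  have vanish: "spans TYPE('k) ?a \<nu> (lookup (schubert w) \<nu>) \<and> independent_at TYPE('k) m ?a \<nu> (lookup (schubert w) \<nu>)"
    if "lookup (schubert w) \<nu> = 0" "\<And>\<tau>. finite \<tau> \<Longrightarrow> wt \<tau> = \<nu> \<Longrightarrow> \<not> flagged ?a \<tau>" for \<nu>
    using that by (simp add: spans_none independent_none)
  show ?case
  proof (induction "N - Max (keys \<mu>)" arbitrary: \<mu> rule: less_induct)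
    case inner: less
    \<comment> \<open>The type of indices contains 0, which belongs to no generator; weights
      involving it are settled separately.\<close>
    consider (zero) "\<mu> = 0" | (row0) "0 < lookup \<mu> 0" | (pos) "\<mu> \<noteq> 0" "lookup \<mu> 0 = 0" by auto
    then show ?case
    proof cases
      case zero
      have \<tau>0: "\<tau> = {}" if "finite \<tau>" "wt \<tau> = 0" for \<tau> using wt_keys[OF that(1)] that(2) by simp
      show ?thesis
      proof (cases "\<forall>j. ?a j = {}")
        case True
        then have "w = id" using no_box_id[OF w] by blast
        then have c: "lookup (schubert w) \<mu> = 1" by (simp add: schubert_id zero)
        have wt0: "wt {} = 0" by (simp add: wt_def)
        have "spans TYPE('k) ?a \<mu> 1" unfolding spans_def
        proof (intro exI[of _ "{{}}"] conjI allI impI)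
          fix \<tau> assume "finite \<tau>" "wt \<tau> = \<mu>"
          then have "\<tau> = {}" using \<tau>0 zero by simp
          then show "single \<tau> (1::'k) \<in> fm.span ((\<lambda>\<tau>. single \<tau> 1) ` {{}} \<union> gens ?a \<mu>)"
            by (intro fm.span_base) simp
        qed (auto simp: wt0 zero)
        moreover have "independent_at TYPE('k) m ?a \<mu> 1" unfolding independent_at_def
        proof (intro exI[of _ "{{}}"] conjI allI impI)
          fix \<alpha> :: "(nat \<times> nat) set \<Rightarrow> 'k"
          have "psi m ?a {} = (1 :: (nat \<times> nat, 'k) poly_ring)"
            using True by (simp add: psi_def colset_def)
          moreover assume "(\<Sum>\<tau>\<in>{{}}. fm_scale (\<alpha> \<tau>) (psi m ?a \<tau>)) = (0 :: (nat \<times> nat, 'k) poly_ring)"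
          ultimately have "fm_scale (\<alpha> {}) (1 :: (nat \<times> nat, 'k) poly_ring) = 0" by simp
          then have "lookup (fm_scale (\<alpha> {}) (1 :: (nat \<times> nat, 'k) poly_ring)) 0 = 0" by simp
          then show "\<forall>\<tau>\<in>{{}}. \<alpha> \<tau> = 0" by simp
        qed (auto simp: wt0 zero)
        ultimately show ?thesis unfolding c by blast
      next
        case False
        then obtain i j where ij: "i \<in> ?a j" by blast
        have "0 < len w" using len_pos[OF w ij] by simp
        then have "0 \<notin> keys (schubert w)" using schubert_keys(2)[OF w, of 0] by auto
        then have "lookup (schubert w) \<mu> = 0" by (simp add: in_keys_iff zero)
        moreover have "\<not> flagged ?a \<tau>" if "finite \<tau>" "wt \<tau> = \<mu>" for \<tau>
        proof
          assume "flagged ?a \<tau>"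
          then have "card (?a j) = card (colset j \<tau>)" by (auto simp: flagged_def flag_le_def)
          moreover have "colset j \<tau> = {}" using \<tau>0[OF that(1)] that(2) zero by (simp add: colset_def)
          ultimately show False using ij finite_rcol[of w j] by auto
        qed
        ultimately show ?thesis by (rule vanish)
      qed
    next
      case row0
      have "\<mu> \<notin> keys (schubert w)" using schubert_keys(1)[OF w, of \<mu>] row0 by auto
      then have "lookup (schubert w) \<mu> = 0" by (simp add: in_keys_iff)
      moreover have "\<not> flagged ?a \<tau>" if "finite \<tau>" "wt \<tau> = \<mu>" for \<tau>
      proof
        assume f: "flagged ?a \<tau>"
        have "0 \<in> snd ` \<tau>" using wt_keys[OF that(1)] row0 unfolding that(2) by (auto simp: in_keys_iff)
        then obtain j where "(j, 0) \<in> \<tau>" by auto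
        then show False using flaggedD[OF f, of j] by (simp add: flag_le_def colset_def)
      qed
      ultimately show ?thesis by (rule vanish)
    next
      case pos
      define k where "k = Max (keys \<mu>)"
      have ne: "keys \<mu> \<noteq> {}" using pos by simp
      then have kk: "k \<in> keys \<mu>" unfolding k_def by (intro Max_in) auto
      have keys: "keys \<mu> \<subseteq> {..k}" unfolding k_def by auto
      have k1: "1 \<le> k" using kk pos(2) by (cases k) (auto simp: in_keys_iff)
      show ?thesis
      proof (cases "k < N")
        case False
        \<comment> \<open>From position \<open>N\<close> on there are no descents, so the variable
          \<open>k\<close> does not occur; correspondingly all boxes are in rows below
          \<open>N\<close>, and the entry \<open>k\<close> violates the flag in every
          column.\<close>
        have "lookup (schubert w) \<mu> = 0"
        proof (rule schubert_coeff_eq_0_beyond[OF fp k1])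
          fix l assume l: "k \<le> l"
          have "w (Suc l) = Suc l" using False l permutes_not_in[OF w, of "Suc l"] by auto
          moreover have "w l \<le> l" using False l permutes_not_in[OF w, of l] permutes_in_image[OF w, of l] by (cases "l \<in> {1..N}") auto
          ultimately show "w l < w (Suc l)" by simp
        qed (use kk in \<open>simp add: in_keys_iff\<close>)
        moreover have "\<not> flagged ?a \<tau>" if "finite \<tau>" "wt \<tau> = \<mu>" for \<tau>
        proof -
          have "k \<in> snd ` \<tau>" using wt_keys[OF that(1)] kk that(2) by simp
          then obtain j where "(j, k) \<in> \<tau>" by auto
          moreover have "?a j \<subseteq> {..<k}" using len_pos(2)[OF w, of _ j] False by (meson lessThan_iff not_le order.strict_trans2 subsetI)
          ultimately show ?thesis using that(1) by (intro not_flagged_large_entry)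
        qed
        ultimately show ?thesis by (rule vanish)
      next
        case True
        have Sk: "Suc k \<notin> keys \<mu>" using keys by auto
        then have lSk: "lookup \<mu> (Suc k) = 0" by (simp add: in_keys_iff)
        have "Suc k \<in> keys (sw k \<mu>)" using kk by (simp add: in_keys_iff)
        then have "Suc k \<le> Max (keys (sw k \<mu>))" by (intro Max_ge) auto
        then have "N - Max (keys (sw k \<mu>)) < N - Max (keys \<mu>)" using True k_def by simp
        note IH = inner.hyps[OF this]
        have wneq: "w k \<noteq> w (Suc k)" using permutes_inj[OF w] by (simp add: inj_eq)
        show ?thesis
        proof (cases "w k < w (Suc k)")
          case asc: True
          have c: "lookup (schubert w) \<mu> = lookup (schubert w) (sw k \<mu>)"
            by (rule schubert_ascent_coeff[OF fp k1 asc])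
          show ?thesis unfolding c
            using IH keys k1 finite_rcol rcol_ascent[OF w asc]
            by (auto intro: spans_ascent[of ?a k \<mu>] independent_ascent[of m ?a k \<mu>])
        next
          case False
          then have desc: "w (Suc k) < w k" using wneq by simp
          let ?u = "w \<circ> adj k"
          interpret descent ?a "rcol ?u" k "w (Suc k)" "w k"
            by (rule descent_rcol[OF w k1 True desc])
          define \<nu> where "\<nu> = \<mu> - single k 1"
          have \<mu>: "\<mu> = single k 1 + \<nu>"
            using kk by (intro poly_mapping_eqI) (auto simp: \<nu>_def lookup_add lookup_minus lookup_single when_def in_keys_iff)
          have keys\<nu>: "keys \<nu> \<subseteq> {..k}"
          proof
            fix x assume "x \<in> keys \<nu>"
            then have "x \<in> keys \<mu>" unfolding \<mu> by (simp add: in_keys_iff lookup_add)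
            then show "x \<in> {..k}" using keys by blast
          qed
          have u: "?u permutes {1..N}" by (rule comp_adj_permutes[OF w k1 True])
          have "len w = Suc (len ?u)" using len_ascent[OF u, of k] desc by simp
          moreover have "j \<in> {1..m}" if "rcol ?u j \<noteq> {}" for j
          proof (cases "j = w (Suc k)")
            case True
            then show ?thesis using k_j0 outer.prems(2)[of j] by blast
          next
            case False
            then have "rcol w j \<noteq> {}" using a'_other[OF False] that by auto
            then show ?thesis by (rule outer.prems(2))
          qed
          ultimately have IH2: "spans TYPE('k) (rcol ?u) \<nu> (lookup (schubert ?u) \<nu>) \<and>
              independent_at TYPE('k) m (rcol ?u) \<nu> (lookup (schubert ?u) \<nu>)"
            using u by (intro outer.hyps) auto
          have c: "lookup (schubert w) \<mu> = lookup (schubert w) (sw k \<mu>) + lookup (schubert ?u) \<nu>"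
            unfolding \<mu> using lSk by (intro schubert_descent_coeff[OF fp k1 desc]) (simp add: \<mu> lookup_add)
          have j0: "w (Suc k) \<in> {1..m}" using k_j0 outer.prems(2) by blast
          note IH' = IH[unfolded \<mu>]
          have "spans TYPE('k) ?a (single k 1 + \<nu>) (lookup (schubert w) (sw k (single k 1 + \<nu>)) + lookup (schubert ?u) \<nu>)"
            by (rule spans_descent[OF conjunct1[OF IH'] conjunct1[OF IH2] keys\<nu>])
          moreover have "independent_at TYPE('k) m ?a (single k 1 + \<nu>)
              (lookup (schubert w) (sw k (single k 1 + \<nu>)) + lookup (schubert ?u) \<nu>)"
            by (rule independent_descent[OF conjunct2[OF IH'] conjunct2[OF IH2] keys\<nu> j0])
          ultimately show ?thesis unfolding c unfolding \<mu> by blast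
        qed
      qed
    qed
  qed
qed

section \<open>Explicit bases of the spaces that define the flagged Schur module\<close>

section \<open>Bases of the exterior and tensor powers\<close>

lemma span_eqI:
  assumes "A \<subseteq> fm.span B" "B \<subseteq> A"
  shows "fm.span A = fm.span B"
proof
  show "fm.span A \<subseteq> fm.span B" using assms(1) by (intro fm.span_minimal fm.subspace_span)
  show "fm.span B \<subseteq> fm.span A" using assms(2) by (rule fm.span_mono)
qed

lemma basis_span_eq: "v \<in> basis_span I \<longleftrightarrow> keys v \<subseteq> (\<lambda>i. {i}) ` I"
  for v :: "'k::field ext_alg"
  unfolding basis_span_def using span_single_iff[of v "(\<lambda>i. {i}) ` I"] by (simp add: image_image)

lemma keys_sum_subset: "keys (\<Sum>i\<in>I. f i) \<subseteq> (\<Union>i\<in>I. keys (f i))"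
proof
  fix x assume "x \<in> keys (\<Sum>i\<in>I. f i)"
  then have "(\<Sum>i\<in>I. lookup (f i) x) \<noteq> 0" by (simp add: in_keys_iff lookup_sum)
  then obtain i where "i \<in> I" "lookup (f i) x \<noteq> 0" by (meson sum.neutral)
  then show "x \<in> (\<Union>i\<in>I. keys (f i))" by (auto simp: in_keys_iff)
qed

lemma keys_wedge:
  fixes u v :: "'k::comm_ring_1 ext_alg"
  assumes "B \<in> keys (wedge u v)"
  obtains b c where "B = b \<union> c" "b \<in> keys u" "c \<in> keys v" "b \<inter> c = {}"
proof -
  obtain b where b: "b \<in> keys u"
    "B \<in> keys (\<Sum>c\<in>keys v. single (b \<union> c) (wedge_sign b c * lookup u b * lookup v c))"
    using subsetD[OF keys_sum_subset assms[unfolded wedge_def]] by (rule UN_E)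
  obtain c where "c \<in> keys v" "B \<in> keys (single (b \<union> c) (wedge_sign b c * lookup u b * lookup v c))"
    using subsetD[OF keys_sum_subset b(2)] by (rule UN_E)
  note bc = b(1) this
  then have "wedge_sign b c \<noteq> (0 :: 'k)" "B = b \<union> c" by (auto split: if_splits)
  moreover from this have "b \<inter> c = {}" unfolding wedge_sign_def by presburger
  ultimately show ?thesis using that bc by blast
qed

lemma wedge_single:
  assumes "\<And>i j. i \<in> b \<Longrightarrow> j \<in> c \<Longrightarrow> i < j"
  shows "wedge (single b 1) (single c 1) = (single (b \<union> c) 1 :: 'k::comm_ring_1 ext_alg)"
proof -
  have "{(i, j). i \<in> b \<and> j \<in> c \<and> j < i} = {}" using assms by fastforce
  moreover have "b \<inter> c = {}" using assms by fastforce
  ultimately have "wedge_sign b c = (1 :: 'k)" by (simp only: wedge_sign_def) simp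
  then show ?thesis by (simp add: wedge_def)
qed

text \<open>Wedges of vectors in the span only involve sets of the right size in \<open>I\<close>;
  conversely the wedge of generators in increasing order is a basis vector with sign +1.\<close>

lemma ext_power_eq: "v \<in> ext_power r (basis_span I) \<longleftrightarrow> keys v \<subseteq> {b. b \<subseteq> I \<and> finite b \<and> card b = r}"
  for v :: "'k::field ext_alg"
proof -
  let ?S = "\<lambda>r. {b. b \<subseteq> I \<and> finite b \<and> card b = r}"
  let ?G = "{foldr wedge us (single {} 1) |us. length us = r \<and> set us \<subseteq> (basis_span I :: 'k ext_alg set)}"
  have G: "keys (foldr wedge us (single {} (1::'k))) \<subseteq> ?S (length us)" if "set us \<subseteq> basis_span I" for us
    using that
  proof (induction us)
    case (Cons u us)
    have u: "keys u \<subseteq> (\<lambda>i. {i}) ` I" using Cons.prems basis_span_eq[of u I] by simp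
    show ?case
    proof
      fix B assume "B \<in> keys (foldr wedge (u # us) (single {} (1::'k)))"
      then have "B \<in> keys (wedge u (foldr wedge us (single {} (1::'k))))" by simp
      then obtain b c where B: "B = b \<union> c" "b \<in> keys u" "c \<in> keys (foldr wedge us (single {} (1::'k)))" "b \<inter> c = {}"
        by (rule keys_wedge)
      then obtain i where "b = {i}" "i \<in> I" using u by auto
      moreover have "c \<in> ?S (length us)" using Cons B(3) by auto
      ultimately show "B \<in> ?S (length (u # us))" using B by auto
    qed
  qed simp
  have S: "(\<lambda>b. single b (1::'k)) ` ?S r \<subseteq> ?G"
  proof (rule image_subsetI)
    fix b assume b: "b \<in> ?S r"
    have f: "foldr wedge (map (\<lambda>i. single {i} 1) xs) (single {} 1) = (single (set xs) 1 :: 'k ext_alg)"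
      if "sorted_wrt (<) xs" for xs
      using that
    proof (induction xs)
      case (Cons x xs)
      then have "wedge (single {x} 1) (single (set xs) 1) = (single ({x} \<union> set xs) 1 :: 'k ext_alg)"
        by (intro wedge_single) auto
      then show ?case using Cons by simp
    qed simp
    let ?us = "map (\<lambda>i. single {i} (1::'k)) (sorted_list_of_set b)"
    have "single b (1::'k) = foldr wedge ?us (single {} 1)"
      using b f[of "sorted_list_of_set b"] by (simp add: strict_sorted_iff)
    moreover have "length ?us = r" using b by simp
    moreover have "set ?us \<subseteq> basis_span I"
    proof
      fix x assume "x \<in> set ?us"
      then obtain i where "i \<in> b" "x = single {i} 1" using b by auto
      then show "x \<in> basis_span I" using b by (auto simp: basis_span_eq)
    qed
    ultimately show "single b (1::'k) \<in> ?G" by blast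
  qed
  have "?G \<subseteq> fm.span ((\<lambda>b. single b 1) ` ?S r)"
    using G by (auto simp: span_single_iff)
  then have "fm.span ?G = fm.span ((\<lambda>b. single b (1::'k)) ` ?S r)"
    using S by (rule span_eqI)
  then show ?thesis unfolding ext_power_def by (simp add: span_single_iff)
qed

lemma sorted_nth_le:
  assumes "finite (a :: nat set)" "i < card (a \<inter> {..t})"
  shows "sorted_list_of_set a ! i \<le> t"
proof (rule ccontr)
  let ?s = "sorted_list_of_set a"
  assume "\<not> ?s ! i \<le> t"
  have "a \<inter> {..t} \<subseteq> (!) ?s ` {..<i}"
  proof
    fix x assume x: "x \<in> a \<inter> {..t}"
    then obtain l where l: "l < length ?s" "?s ! l = x" using assms(1) by (metis IntE in_set_conv_nth set_sorted_list_of_set)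
    have "l < i"
    proof (rule ccontr)
      assume "\<not> l < i"
      then have "?s ! i \<le> ?s ! l" using l by (intro sorted_nth_mono) auto
      then show False using l x \<open>\<not> ?s ! i \<le> t\<close> by auto
    qed
    then show "x \<in> (!) ?s ` {..<i}" using l by auto
  qed
  then have "card (a \<inter> {..t}) \<le> card ((!) ?s ` {..<i})" by (intro card_mono) auto
  also have "\<dots> \<le> i" using card_image_le[of "{..<i}" "(!) ?s"] by simp
  finally show False using assms(2) by simp
qed

lemma card_below_nth:
  assumes "finite (a :: nat set)" "i < card a"
  shows "i < card (a \<inter> {..sorted_list_of_set a ! i})"
proof -
  let ?s = "sorted_list_of_set a"
  have len: "length ?s = card a" using assms by simp
  have "(!) ?s ` {..i} \<subseteq> a \<inter> {..?s ! i}"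
  proof
    fix x assume "x \<in> (!) ?s ` {..i}"
    then obtain l where l: "l \<le> i" "x = ?s ! l" by auto
    then have "?s ! l \<le> ?s ! i" using assms len by (intro sorted_nth_mono) auto
    moreover have "?s ! l \<in> a" using l assms len nth_mem[of l ?s] by simp
    ultimately show "x \<in> a \<inter> {..?s ! i}" using l by simp
  qed
  then have "card ((!) ?s ` {..i}) \<le> card (a \<inter> {..?s ! i})" using assms(1) by (intro card_mono) auto
  moreover have "inj_on ((!) ?s) {..i}" using assms len by (intro inj_on_nth) auto
  ultimately show ?thesis by (simp add: card_image)
qed

text \<open>A product of \<open>i\<close> arbitrary vectors with vectors beyond the entry
  \<open>i\<close> of \<open>a\<close> has at most \<open>i\<close> indices up to that entry,
  whereas \<open>a\<close> has \<open>i + 1\<close> rows there, as entries are numbered from 0. This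
  is exactly a violated count in \<open>flag_le\<close>.\<close>

lemma flag_relations_eq:
  fixes v :: "'k::field ext_alg"
  assumes a: "finite a"
  shows "v \<in> flag_relations n a \<longleftrightarrow> keys v \<subseteq> {b. b \<subseteq> {1..n} \<and> card b = card a \<and> \<not> flag_le b a}"
    (is "_ \<longleftrightarrow> keys v \<subseteq> ?S")
proof -
  let ?s = "sorted_list_of_set a"
  let ?G = "\<Union>i<card a. {wedge u v | u v. u \<in> (ext_power i (basis_span {1..n}) :: 'k ext_alg set) \<and>
        v \<in> ext_power (card a - i) (flag_kernel n (?s ! i))}"
  have "?G \<subseteq> fm.span ((\<lambda>b. single b 1) ` ?S)"
  proof
    fix x assume "x \<in> ?G"
    then obtain i u v where x: "i < card a" "x = wedge u v"
      "keys u \<subseteq> {b. b \<subseteq> {1..n} \<and> finite b \<and> card b = i}"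
      "keys v \<subseteq> {b. b \<subseteq> {?s ! i + 1..n} \<and> finite b \<and> card b = card a - i}"
      unfolding flag_kernel_def ext_power_eq by blast
    have "keys x \<subseteq> ?S"
    proof
      fix B assume "B \<in> keys x"
      then obtain b c where B: "B = b \<union> c" "b \<in> keys u" "c \<in> keys v" "b \<inter> c = {}"
        unfolding x(2) by (rule keys_wedge)
      have b: "b \<subseteq> {1..n}" "finite b" "card b = i" and c: "c \<subseteq> {?s ! i + 1..n}" "finite c" "card c = card a - i"
        using B x by auto
      have "card B = card a" using b c B x(1) by (simp add: card_Un_disjoint)
      moreover have "B \<subseteq> {1..n}" using b c B by fastforce
      moreover have "\<not> flag_le B a"
      proof
        assume "flag_le B a"
        then have "card (a \<inter> {..?s ! i}) \<le> card (B \<inter> {..?s ! i})" by (simp add: flag_le_def)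
        also have "B \<inter> {..?s ! i} \<subseteq> b" using B c by fastforce
        then have "card (B \<inter> {..?s ! i}) \<le> card b" using b by (intro card_mono)
        finally show False using card_below_nth[OF a x(1)] b by simp
      qed
      ultimately show "B \<in> ?S" by simp
    qed
    then show "x \<in> fm.span ((\<lambda>b. single b 1) ` ?S)" by (simp add: span_single_iff)
  qed
  moreover have "(\<lambda>b. single b (1::'k)) ` ?S \<subseteq> ?G"
  proof (rule image_subsetI)
    fix b assume b: "b \<in> ?S"
    then have fb: "finite b" "0 \<notin> b" "card b = card a" using finite_subset[of b "{1..n}"] by auto
    \<comment> \<open>A count violated at \<open>t\<close> splits \<open>b\<close> into its elements
      up to \<open>t\<close> and the rest. Their number \<open>?i\<close> is the number of free
      factors, since the entry \<open>?i\<close> of \<open>a\<close> is still at most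
      \<open>t\<close> and the rest of \<open>b\<close> lies beyond it.\<close>
    then obtain t where t: "card (b \<inter> {..t}) < card (a \<inter> {..t})"
      using b by (auto simp: flag_le_def not_le)
    let ?i = "card (b \<inter> {..t})"
    have "card (a \<inter> {..t}) \<le> card a" using a by (intro card_mono) auto
    then have i: "?i < card a" using t by simp
    have st: "?s ! ?i \<le> t" by (rule sorted_nth_le[OF a t])
    have "b = (b \<inter> {..t}) \<union> (b - {..t})" by auto
    then have "single b (1::'k) = wedge (single (b \<inter> {..t}) 1) (single (b - {..t}) 1)"
      by (subst wedge_single) auto
    moreover have "single (b \<inter> {..t}) (1::'k) \<in> ext_power ?i (basis_span {1..n})"
      using b fb by (auto simp: ext_power_eq)
    moreover have "single (b - {..t}) (1::'k) \<in> ext_power (card a - ?i) (flag_kernel n (?s ! ?i))"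
      using b fb st card_Diff_subset_Int[of b "{..t}"] by (auto simp: ext_power_eq flag_kernel_def Suc_le_eq not_le)
    ultimately show "single b (1::'k) \<in> ?G" using i by blast
  qed
  ultimately have "fm.span ?G = fm.span ((\<lambda>b. single b (1::'k)) ` ?S)"
    by (rule span_eqI)
  then show ?thesis unfolding flag_relations_def by (simp add: span_single_iff)
qed

lemma keys_tensor: "keys (tensor vs) \<subseteq> {l. list_all2 (\<lambda>b v. b \<in> keys v) l vs}"
proof (induction vs)
  case (Cons v vs)
  show ?case
  proof
    fix l assume "l \<in> keys (tensor (v # vs))"
    then have "l \<in> keys (\<Sum>b\<in>keys v. \<Sum>\<tau>\<in>keys (tensor vs). single (b # \<tau>) (lookup v b * lookup (tensor vs) \<tau>))"
      by simp
    from subsetD[OF keys_sum_subset this] obtain b where b: "b \<in> keys v"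
      and "l \<in> keys (\<Sum>\<tau>\<in>keys (tensor vs). single (b # \<tau>) (lookup v b * lookup (tensor vs) \<tau>))"
      by (rule UN_E)
    from subsetD[OF keys_sum_subset this(2)] obtain \<tau> where \<tau>: "\<tau> \<in> keys (tensor vs)"
      and "l \<in> keys (single (b # \<tau>) (lookup v b * lookup (tensor vs) \<tau>))" by (rule UN_E)
    then have l: "l = b # \<tau>" by (auto split: if_splits)
    have "list_all2 (\<lambda>b v. b \<in> keys v) \<tau> vs" using \<tau> Cons.IH by blast
    then show "l \<in> {l. list_all2 (\<lambda>b v. b \<in> keys v) l (v # vs)}" using l b by simp
  qed
qed simp

lemma tensor_single: "tensor (map (\<lambda>b. single b 1) l) = (single l 1 :: _ \<Rightarrow>\<^sub>0 'k::comm_ring_1)"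
  by (induction l) simp_all

definition shapes :: "nat \<Rightarrow> nat set list \<Rightarrow> nat set list set" where
  "shapes n D = {l. list_all2 (\<lambda>b a. b \<subseteq> {1..n} \<and> card b = card a) l D}"

lemma ext_tuples_iff: "vs \<in> ext_tuples n D \<longleftrightarrow>
    list_all2 (\<lambda>v a. keys v \<subseteq> {b. b \<subseteq> {1..n} \<and> finite b \<and> card b = card a}) vs D"
  unfolding ext_tuples_def by (simp add: ext_power_eq)

lemma tensor_ext_tuples_keys:
  assumes "vs \<in> ext_tuples n D" "l \<in> keys (tensor vs)"
  shows "l \<in> shapes n D"
proof -
  have "list_all2 (\<lambda>b v. b \<in> keys v) l vs" using keys_tensor assms(2) by blast
  moreover have "list_all2 (\<lambda>v a. keys v \<subseteq> {b. b \<subseteq> {1..n} \<and> finite b \<and> card b = card a}) vs D"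
    using assms(1) by (simp only: ext_tuples_iff)
  ultimately have "list_all2 (\<lambda>b a. b \<subseteq> {1..n} \<and> card b = card a) l D"
    by (rule list_all2_trans[rotated 1]) auto
  then show ?thesis by (simp add: shapes_def)
qed

lemma single_ext_tuple:
  assumes "l \<in> shapes n D"
  shows "map (\<lambda>b. single b (1::'k::field)) l \<in> ext_tuples n D"
proof -
  have "list_all2 (\<lambda>b a. b \<subseteq> {1..n} \<and> card b = card a) l D" using assms by (simp add: shapes_def)
  then show ?thesis unfolding ext_tuples_iff list_all2_map1
    by (rule list_all2_mono) (auto intro: finite_subset)
qed

lemma TE_iff: "f \<in> TE n D \<longleftrightarrow> keys f \<subseteq> shapes n D"
  for f :: "nat set list \<Rightarrow>\<^sub>0 'k::field"
proof -
  have "tensor ` ext_tuples n D \<subseteq> fm.span ((\<lambda>l. single l (1::'k)) ` shapes n D)"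
    using tensor_ext_tuples_keys by (force simp: span_single_iff)
  moreover have "(\<lambda>l. single l (1::'k)) ` shapes n D \<subseteq> tensor ` ext_tuples n D"
  proof (rule image_subsetI)
    fix l assume "l \<in> shapes n D"
    then show "single l (1::'k) \<in> tensor ` ext_tuples n D"
      by (subst tensor_single[symmetric]) (intro imageI single_ext_tuple)
  qed
  ultimately have "fm.span (tensor ` ext_tuples n D) = fm.span ((\<lambda>l. single l (1::'k)) ` shapes n D)"
    by (rule span_eqI)
  then show ?thesis unfolding TE_def by (simp add: span_single_iff)
qed

lemma tensor_flag_relations_iff:
  fixes f :: "nat set list \<Rightarrow>\<^sub>0 'k::field"
  assumes "\<And>a. a \<in> set D \<Longrightarrow> finite a"
  shows "f \<in> tensor_flag_relations n D \<longleftrightarrow> keys f \<subseteq> {l \<in> shapes n D. \<exists>j<length D. \<not> flag_le (l ! j) (D ! j)}"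
    (is "_ \<longleftrightarrow> keys f \<subseteq> ?S")
proof -
  let ?G = "tensor ` {vs \<in> (ext_tuples n D :: 'k ext_alg list set). \<exists>j<length D. vs ! j \<in> flag_relations n (D ! j)}"
  have "?G \<subseteq> fm.span ((\<lambda>l. single l (1::'k)) ` ?S)"
  proof (rule image_subsetI)
    fix vs assume "vs \<in> {vs \<in> (ext_tuples n D :: 'k ext_alg list set). \<exists>j<length D. vs ! j \<in> flag_relations n (D ! j)}"
    then obtain j where vs: "vs \<in> ext_tuples n D" "j < length D" "vs ! j \<in> flag_relations n (D ! j)" by blast
    have "keys (tensor vs) \<subseteq> ?S"
    proof
      fix l assume l: "l \<in> keys (tensor vs)"
      have all2: "list_all2 (\<lambda>b v. b \<in> keys v) l vs" using keys_tensor l by blast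
      have "length vs = length D" using vs(1) by (auto simp: ext_tuples_def dest: list_all2_lengthD)
      then have "l ! j \<in> keys (vs ! j)" using all2 vs(2) list_all2_lengthD list_all2_nthD by metis
      then have "\<not> flag_le (l ! j) (D ! j)" using vs(2,3) flag_relations_eq[of "D ! j" "vs ! j" n] assms by auto
      then show "l \<in> ?S" using tensor_ext_tuples_keys[OF vs(1) l] vs(2) by blast
    qed
    then show "tensor vs \<in> fm.span ((\<lambda>l. single l (1::'k)) ` ?S)" by (simp only: span_single_iff)
  qed
  moreover have "(\<lambda>l. single l (1::'k)) ` ?S \<subseteq> ?G"
  proof (rule image_subsetI)
    fix l assume "l \<in> ?S"
    then obtain j where l: "l \<in> shapes n D" "j < length D" "\<not> flag_le (l ! j) (D ! j)" by blast
    let ?vs = "map (\<lambda>b. single b (1::'k)) l"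
    have all2: "list_all2 (\<lambda>b a. b \<subseteq> {1..n} \<and> card b = card a) l D" using l(1) by (simp add: shapes_def)
    then have len: "length l = length D" by (rule list_all2_lengthD)
    have "l ! j \<subseteq> {1..n} \<and> card (l ! j) = card (D ! j)" using list_all2_nthD[OF all2] len l(2) by simp
    then have "?vs ! j \<in> flag_relations n (D ! j)"
      using l len assms by (simp add: flag_relations_eq)
    then have "?vs \<in> {vs \<in> ext_tuples n D. \<exists>j<length D. vs ! j \<in> flag_relations n (D ! j)}"
      using single_ext_tuple[OF l(1)] l(2) by blast
    then show "single l (1::'k) \<in> ?G" by (subst tensor_single[symmetric]) (rule imageI)
  qed
  ultimately have "fm.span ?G = fm.span ((\<lambda>l. single l (1::'k)) ` ?S)"
    by (rule span_eqI)
  then show ?thesis unfolding tensor_flag_relations_def by (simp only: span_single_iff)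
qed

section \<open>Exchange products lie in the kernel of the map to minors\<close>

section \<open>Minors and exchange relations\<close>

text \<open>Laplace expansion along the first column: for sorted rows the position of a row is the
  number of smaller rows, which is the exponent of the sign in \<open>mn\<close>.\<close>

lemma det_eq_mn:
  assumes "sorted xs" "distinct xs" "length xs = r" "length us = r"
  shows "det (mat r r (\<lambda>(i, j). f (xs ! i) (us ! j))) = mn f (set xs) us"
  using assms
proof (induction us arbitrary: r xs)
  case Nil
  then show ?case by (simp add: det_dim_zero)
next
  case (Cons u us)
  obtain r' where r: "r = Suc r'" using Cons.prems(4) by (cases r) auto
  let ?A = "mat r r (\<lambda>(i, j). f (xs ! i) ((u # us) ! j))"
  have "det ?A = (\<Sum>i<r. ?A $$ (i, 0) * cofactor ?A i 0)"
    by (rule laplace_expansion_column) (auto simp: r)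
  also have "\<dots> = (\<Sum>i<r. (- 1) ^ card {q \<in> set xs. q < xs ! i} * f (xs ! i) u * mn f (set xs - {xs ! i}) us)"
  proof (rule sum.cong[OF refl])
    fix i assume "i \<in> {..<r}"
    then have i: "i < r" by simp
    let ?ys = "take i xs @ drop (Suc i) xs"
    have "mat_delete ?A i 0 = mat r' r' (\<lambda>(i', j'). f (?ys ! i') (us ! j'))"
      using i Cons.prems(3) by (intro eq_matI) (auto simp: mat_delete_def r nth_append min_def)
    moreover have "det (mat r' r' (\<lambda>(i', j'). f (?ys ! i') (us ! j'))) = mn f (set ?ys) us"
    proof (rule Cons.IH)
      have xs: "xs = take i xs @ xs ! i # drop (Suc i) xs" using i Cons.prems(3) by (simp add: id_take_nth_drop)
      show "sorted ?ys" using Cons.prems(1) by (subst (asm) xs) (auto simp: sorted_append)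
      show "distinct ?ys" using Cons.prems(2) by (subst (asm) xs) auto
      show "length ?ys = r'" "length us = r'" using i Cons.prems r by auto
    qed
    moreover have "set ?ys = set xs - {xs ! i}"
    proof -
      have xs: "xs = take i xs @ xs ! i # drop (Suc i) xs" using i Cons.prems(3) by (simp add: id_take_nth_drop)
      then have "distinct (take i xs @ xs ! i # drop (Suc i) xs)" using Cons.prems(2) by simp
      then have "set (take i xs @ xs ! i # drop (Suc i) xs) - {xs ! i} = set ?ys" by auto
      then show ?thesis using xs by simp
    qed
    moreover have "card {q \<in> set xs. q < xs ! i} = i"
    proof -
      have "{q \<in> set xs. q < xs ! i} = (!) xs ` {..<i}"
      proof
        show "{q \<in> set xs. q < xs ! i} \<subseteq> (!) xs ` {..<i}"
        proof
          fix q assume "q \<in> {q \<in> set xs. q < xs ! i}"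
          then obtain l where l: "l < length xs" "q = xs ! l" "xs ! l < xs ! i" by (auto simp: in_set_conv_nth)
          have "l < i"
          proof (rule ccontr)
            assume "\<not> l < i"
            then have "xs ! i \<le> xs ! l" using l Cons.prems(1) by (intro sorted_nth_mono) auto
            then show False using l by simp
          qed
          then show "q \<in> (!) xs ` {..<i}" using l by auto
        qed
        show "(!) xs ` {..<i} \<subseteq> {q \<in> set xs. q < xs ! i}"
        proof (rule image_subsetI)
          fix l assume "l \<in> {..<i}"
          then have l: "l < i" by simp
          have "xs ! l \<le> xs ! i" using l i Cons.prems by (intro sorted_nth_mono) auto
          moreover have "xs ! l \<noteq> xs ! i" using l i Cons.prems by (simp add: nth_eq_iff_index_eq)
          ultimately show "xs ! l \<in> {q \<in> set xs. q < xs ! i}" using l i Cons.prems by simp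
        qed
      qed
      moreover have "inj_on ((!) xs) {..<i}" using i Cons.prems by (intro inj_on_nth) auto
      ultimately show ?thesis by (simp add: card_image)
    qed
    ultimately show "?A $$ (i, 0) * cofactor ?A i 0 =
        (- 1) ^ card {q \<in> set xs. q < xs ! i} * f (xs ! i) u * mn f (set xs - {xs ! i}) us"
      using i by (simp add: cofactor_def r mult_ac)
  qed
  also have "\<dots> = (\<Sum>p\<in>set xs. (- 1) ^ card {q \<in> set xs. q < p} * f p u * mn f (set xs - {p}) us)"
    using sum.reindex_bij_betw[OF bij_betw_nth[OF Cons.prems(2), of "{..<r}" "set xs"]] Cons.prems(3) by simp
  finally show ?case by simp
qed

lemma generic_minor_eq_mn:
  assumes "finite a" "finite b" "card b = card a"
  shows "generic_minor a b = mn (\<lambda>p u. pvar (p, u)) a (sorted_list_of_set b)"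
  unfolding generic_minor_def
  using det_eq_mn[of "sorted_list_of_set a" "card a" "sorted_list_of_set b" "\<lambda>p u. pvar (p, u)"] assms by simp

section \<open>The products of minors as an image of the exterior algebra\<close>

text \<open>A generator in column \<open>j\<close> with index \<open>u\<close> is sent to the sum of \<open>z\<^bsub>pu\<^esub> e\<^bsub>jp\<^esub>\<close> over the boxes
  \<open>(j, p)\<close> of a diagram \<open>E\<close>; the minors are the coefficients of the top exterior power.\<close>

definition box_op :: "(nat \<times> nat) set \<Rightarrow> nat set \<times> nat \<Rightarrow>
    ((nat \<times> nat) set \<Rightarrow>\<^sub>0 (nat \<times> nat, 'k::comm_ring_1) poly_ring) \<Rightarrow> ((nat \<times> nat) set \<Rightarrow>\<^sub>0 (nat \<times> nat, 'k) poly_ring)" where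
  "box_op E l = comb (\<lambda>x. pvar (snd x, snd l)) {x \<in> E. fst x \<in> fst l}"

abbreviation box_gen where "box_gen E x \<equiv> box_op E ({fst x}, snd x)"

definition box_mon :: "(nat \<times> nat) set \<Rightarrow> (nat \<times> nat) set \<Rightarrow> ((nat \<times> nat) set \<Rightarrow>\<^sub>0 (nat \<times> nat, 'k::comm_ring_1) poly_ring)" where
  "box_mon E \<tau> = (if finite \<tau> then foldr (box_gen E) (sorted_list_of_set \<tau>) (single {} 1) else 0)"

definition box_hom :: "(nat \<times> nat) set \<Rightarrow> ((nat \<times> nat) set \<Rightarrow>\<^sub>0 'k::comm_ring_1) \<Rightarrow> ((nat \<times> nat) set \<Rightarrow>\<^sub>0 (nat \<times> nat, 'k) poly_ring)" where
  "box_hom E v = (\<Sum>\<tau>\<in>keys v. fm_scale (pconst (lookup v \<tau>)) (box_mon E \<tau>))"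

lemma box_hom_superset:
  "finite A \<Longrightarrow> keys v \<subseteq> A \<Longrightarrow> box_hom E v = (\<Sum>\<tau>\<in>A. fm_scale (pconst (lookup v \<tau>)) (box_mon E \<tau>))"
  unfolding box_hom_def by (rule sum.mono_neutral_left) (auto simp: in_keys_iff)

lemma box_hom_add: "box_hom E (u + v) = box_hom E u + box_hom E v"
proof -
  have "keys (u + v) \<subseteq> keys u \<union> keys v" by (rule keys_add)
  then show ?thesis
    by (subst (1 2 3) box_hom_superset[of "keys u \<union> keys v"])
       (auto simp: lookup_add pconst_add fm.scale_left_distrib sum.distrib)
qed

lemma box_hom_single: "box_hom E (single \<tau> c) = fm_scale (pconst c) (box_mon E \<tau>)"
  by (subst box_hom_superset[of "{\<tau>}"]) auto

lemma box_hom_0 [simp]: "box_hom E 0 = 0"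
  by (simp add: box_hom_def)

lemma box_hom_sum: "box_hom E (\<Sum>i\<in>I. f i) = (\<Sum>i\<in>I. box_hom E (f i))"
  by (induction I rule: infinite_finite_induct) (simp_all add: box_hom_add)

lemma anticommuting_box_op: "anticommuting (box_op E)"
  unfolding box_op_def[abs_def] by (rule anticommuting_comb)

lemma anticommuting_box_gen: "anticommuting (box_gen E)"
  unfolding box_op_def[abs_def] by (rule anticommuting_comb)

lemma flin_box_op: "flin (box_op E l)"
  unfolding box_op_def by (rule flin_comb)

text \<open>Multiplicativity. The map \<open>box_mon\<close> multiplies the images in sorted order,
  and moving a generator to its sorted place costs the same sign as in \<open>theta\<close>.\<close>

lemma box_hom_theta: "box_hom E (theta x v) = box_gen E x (box_hom E v)"
proof (rule additive_poly_mapping_eqI[of "\<lambda>v. box_hom E (theta x v)" "\<lambda>v. box_gen E x (box_hom E v)"])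
  fix u v :: "(nat \<times> nat) set \<Rightarrow>\<^sub>0 'a"
  show "box_hom E (theta x (u + v)) = box_hom E (theta x u) + box_hom E (theta x v)"
    by (simp add: flin_add[OF flin_theta] box_hom_add)
  show "box_gen E x (box_hom E (u + v)) = box_gen E x (box_hom E u) + box_gen E x (box_hom E v)"
    by (simp add: flin_add[OF flin_box_op] box_hom_add)
next
  fix \<tau> and c :: 'a
  interpret anticommuting "box_gen E :: _ \<Rightarrow> (_ \<Rightarrow>\<^sub>0 (nat \<times> nat, 'a) poly_ring) \<Rightarrow> _" by (rule anticommuting_box_gen)
  have rhs: "box_gen E x (box_hom E (single \<tau> c)) = fm_scale (pconst c) (box_gen E x (box_mon E \<tau>))"
    by (simp add: box_hom_single flin_scale[OF flin_box_op])
  show "box_hom E (theta x (single \<tau> c)) = box_gen E x (box_hom E (single \<tau> c))"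
  proof (cases "x \<in> \<tau> \<or> infinite \<tau>")
    case True
    have "box_gen E x (box_mon E \<tau>) = (0 :: (nat \<times> nat) set \<Rightarrow>\<^sub>0 (nat \<times> nat, 'a) poly_ring)"
    proof (cases "finite \<tau>")
      case fin: True
      then have "x \<in> set (sorted_list_of_set \<tau>)" using True by simp
      then show ?thesis using fin foldr_member by (simp add: box_mon_def)
    next
      case False
      then show ?thesis using local.zero by (simp add: box_mon_def)
    qed
    then show ?thesis using True unfolding rhs by (simp add: theta_single)
  next
    case False
    then have nx: "x \<notin> \<tau>" "finite \<tau>" by auto
    have ins: "box_mon E (insert x \<tau>) =
      (if even (card {y \<in> \<tau>. y < x}) then box_gen E x (box_mon E \<tau>) else - box_gen E x (box_mon E \<tau> :: (nat \<times> nat) set \<Rightarrow>\<^sub>0 (nat \<times> nat, 'a) poly_ring))"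
      using foldr_insert_sorted[OF anticommuting_box_gen nx(2,1), where v = "single {} (1 :: (nat \<times> nat, 'a) poly_ring)"]
      by (simp only: box_mon_def finite_insert nx(2) if_True)
    have "box_hom E (theta x (single \<tau> c)) = fm_scale (pconst (c * (- 1) ^ card {y \<in> \<tau>. y < x})) (box_mon E (insert x \<tau>))"
      using nx by (simp add: theta_single box_hom_single)
    also have "\<dots> = fm_scale (pconst c) (box_gen E x (box_mon E \<tau>))"
    proof (cases "even (card {y \<in> \<tau>. y < x})")
      case True
      then show ?thesis unfolding ins by simp
    next
      case False
      have "pconst (- c) = - (pconst c :: (nat \<times> nat, 'a) poly_ring)"
        by (simp add: pconst_def single_uminus)
      then show ?thesis using False unfolding ins by simp
    qed
    finally show ?thesis unfolding rhs .
  qed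
qed

lemma box_op_cols:
  assumes "finite E" "finite C"
  shows "box_op E (C, u) v = (\<Sum>j\<in>C. box_op E ({j}, u) v)"
  using assms(2)
proof (induction C)
  case empty
  then show ?case by (simp add: box_op_def comb_def)
next
  case (insert j C)
  have "{x \<in> E. fst x \<in> insert j C} = {x \<in> E. fst x \<in> {j}} \<union> {x \<in> E. fst x \<in> C}" by auto
  moreover have "{x \<in> E. fst x \<in> {j}} \<inter> {x \<in> E. fst x \<in> C} = {}" using insert by auto
  ultimately have "box_op E (insert j C, u) v = box_op E ({j}, u) v + box_op E (C, u) v"
    using assms(1) unfolding box_op_def fst_conv snd_conv by (simp only: comb_union finite_subset[OF Collect_restrict])
  then show ?case using insert by simp
qed

lemma box_hom_fop:
  assumes "finite E" "finite C"
  shows "box_hom E (fop (C, u) v) = box_op E (C, u) (box_hom E v)"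
proof -
  have "fop (C, u) v = (\<Sum>i\<in>C \<times> {u}. theta i v)" by (simp add: fop_def comb_def)
  also have "C \<times> {u} = (\<lambda>j. (j, u)) ` C" by auto
  also have "(\<Sum>i\<in>(\<lambda>j. (j, u)) ` C. theta i v) = (\<Sum>j\<in>C. theta (j, u) v)"
    by (subst sum.reindex) (auto intro: inj_onI)
  finally show ?thesis using box_op_cols[OF assms, of u "box_hom E v"]
    by (simp add: box_hom_sum box_hom_theta)
qed

lemma box_hom_prodL:
  assumes "finite E" "\<And>l. l \<in> set L \<Longrightarrow> finite (fst l)"
  shows "box_hom E (prodL L) = foldr (box_op E) L (single {} 1)"
  using assms(2)
proof (induction L)
  case Nil
  then show ?case by (simp add: prodL_def box_hom_single box_mon_def)
next
  case (Cons l L)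
  then have "finite (fst l)" by simp
  then show ?case using box_hom_fop[OF assms(1), of "fst l" "snd l" "prodL L :: (nat \<times> nat) set \<Rightarrow>\<^sub>0 'a"] Cons
    by (simp add: prodL_Cons)
qed

text \<open>The factors with columns \<open>{i, j}\<close> are combinations, with coefficients in the polynomial ring, of
  \<open>card (a i \<union> a j)\<close> anticommuting elements \<open>e\<^bsub>ip\<^esub> + e\<^bsub>jp\<^esub>\<close>.\<close>

lemma box_hom_exch:
  assumes "finite E" "exch a (mset L)" "\<And>j. finite (a j)" "\<And>j p. (j, p) \<in> E \<Longrightarrow> p \<in> a j"
  shows "box_hom E (prodL L) = 0"
proof -
  obtain i j where ij: "card (a i \<union> a j) < cnt ((=) {i, j}) (mset L)" and
    fL: "\<And>l. l \<in> set L \<Longrightarrow> finite (fst l)"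
    using assms(2) unfolding exch_def by auto
  let ?R = "\<lambda>l. {i, j} = fst l"
  let ?P = "a i \<union> a j"
  let ?v = "foldr (box_op E) (filter (\<lambda>l. \<not> ?R l) L) (single {} 1)
    :: (nat \<times> nat) set \<Rightarrow>\<^sub>0 (nat \<times> nat, 'a) poly_ring"
  define I where "I p = {x \<in> E. fst x \<in> {i, j} \<and> snd x = p}" for p
  define e where "e p = comb (\<lambda>_. 1 :: (nat \<times> nat, 'a) poly_ring) (I p)" for p
  define cs where "cs = map (\<lambda>l p. pvar (p, snd l) :: (nat \<times> nat, 'a) poly_ring) (filter ?R L)"
  have op: "box_op E l v = (\<Sum>p\<in>?P. fm_scale (pvar (p, snd l)) (e p v))" if "?R l" for l v
  proof -
    have fI: "finite (I p)" for p using assms(1) by (simp add: I_def)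
    have un: "{x \<in> E. fst x \<in> fst l} = (\<Union>p\<in>?P. I p)" using that[symmetric] assms(4) by (auto simp: I_def)
    have "box_op E l v = (\<Sum>x\<in>(\<Union>p\<in>?P. I p). fm_scale (pvar (snd x, snd l)) (theta x v))"
      by (simp only: box_op_def comb_def un)
    also have "\<dots> = (\<Sum>p\<in>?P. \<Sum>x\<in>I p. fm_scale (pvar (snd x, snd l)) (theta x v))"
      using assms(3) fI by (intro sum.UNION_disjoint) (auto simp: I_def)
    also have "\<dots> = (\<Sum>p\<in>?P. fm_scale (pvar (p, snd l)) (e p v))"
    proof (rule sum.cong[OF refl])
      fix p
      have "(\<Sum>x\<in>I p. fm_scale (pvar (snd x, snd l)) (theta x v)) = (\<Sum>x\<in>I p. fm_scale (pvar (p, snd l)) (theta x v))"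
        by (rule sum.cong) (auto simp: I_def)
      then show "(\<Sum>x\<in>I p. fm_scale (pvar (snd x, snd l)) (theta x v)) = fm_scale (pvar (p, snd l)) (e p v)"
        by (simp add: e_def comb_def fm.scale_sum_right)
    qed
    finally show ?thesis .
  qed
  have "foldr (box_op E) Ls v = foldr (\<lambda>c v. \<Sum>p\<in>?P. fm_scale (c p) (e p v)) (map (\<lambda>l p. pvar (p, snd l)) Ls) v"
    if "\<forall>l\<in>set Ls. ?R l" for Ls v
    using that by (induction Ls) (simp_all add: op)
  then have "foldr (box_op E) (filter ?R L) ?v = foldr (\<lambda>c v. \<Sum>p\<in>?P. fm_scale (c p) (e p v)) cs ?v"
    unfolding cs_def by simp
  also have "\<dots> = foldr e [] (foldr (\<lambda>c v. \<Sum>p\<in>?P. fm_scale (c p) (e p v)) cs ?v)" by simp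
  also have "\<dots> = 0"
  proof (rule anticommuting_product_eq_0)
    show "anticommuting e" unfolding e_def[abs_def] by (rule anticommuting_comb)
    show "flin (e p)" for p unfolding e_def by (rule flin_comb)
    have "length (filter ?R L) = cnt ((=) {i, j}) (mset L)"
      by (simp add: cnt_def mset_filter[symmetric] del: mset_filter)
    then show "card ?P < length [] + length cs" using ij by (simp add: cs_def)
  qed (use assms(3) in auto)
  finally have "foldr (box_op E) (filter ?R L @ filter (\<lambda>l. \<not> ?R l) L) (single {} 1)
      = (0 :: (nat \<times> nat) set \<Rightarrow>\<^sub>0 (nat \<times> nat, 'a) poly_ring)" by simp
  moreover have "mset L = mset (filter ?R L @ filter (\<lambda>l. \<not> ?R l) L)" by (simp add: union_filter_mset_complement)
  from anticommuting.foldr_mset[OF anticommuting_box_op[of E] this, where v = "single {} (1 :: (nat \<times> nat, 'a) poly_ring)"]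
  have "foldr (box_op E) L (single {} (1 :: (nat \<times> nat, 'a) poly_ring)) =
      foldr (box_op E) (filter ?R L @ filter (\<lambda>l. \<not> ?R l) L) (single {} 1) \<or>
    foldr (box_op E) L (single {} (1 :: (nat \<times> nat, 'a) poly_ring)) =
      - foldr (box_op E) (filter ?R L @ filter (\<lambda>l. \<not> ?R l) L) (single {} 1)" .
  ultimately have "foldr (box_op E) L (single {} 1) = (0 :: (nat \<times> nat) set \<Rightarrow>\<^sub>0 (nat \<times> nat, 'a) poly_ring)"
    by (metis neg_equal_0_iff_equal)
  then show ?thesis by (subst box_hom_prodL[OF assms(1) fL])
qed

lemma lookup_box_gen:
  assumes "finite E"
  shows "lookup (box_gen E x v) D = (\<Sum>y\<in>{y \<in> E. fst y = fst x} \<inter> D.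
    if finite D then (- 1) ^ card {z \<in> D. z < y} * pvar (snd y, snd x) * lookup v (D - {y}) else 0)"
proof -
  have "lookup (box_gen E x v) D = (\<Sum>y\<in>{y \<in> E. fst y = fst x}. pvar (snd y, snd x) * lookup (theta y v) D)"
    by (simp add: box_op_def comb_def lookup_sum)
  also have "\<dots> = (\<Sum>y\<in>{y \<in> E. fst y = fst x} \<inter> D. pvar (snd y, snd x) * lookup (theta y v) D)"
    using assms by (intro sum.mono_neutral_right) (auto simp: lookup_theta)
  also have "\<dots> = (\<Sum>y\<in>{y \<in> E. fst y = fst x} \<inter> D.
    if finite D then (- 1) ^ card {z \<in> D. z < y} * pvar (snd y, snd x) * lookup v (D - {y}) else 0)"
    by (rule sum.cong) (auto simp: lookup_theta mult_ac)
  finally show ?thesis .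
qed

lemma lookup_box_foldr_cols:
  assumes "finite E" "lookup (foldr (box_gen E) xs (single {} 1)) D \<noteq> 0"
  shows "fst ` D \<subseteq> fst ` set xs"
  using assms(2)
proof (induction xs arbitrary: D)
  case Nil
  then have "D = {}" by (auto simp: lookup_single when_def split: if_splits)
  then show ?case by simp
next
  case (Cons x xs)
  let ?v = "foldr (box_gen E) xs (single {} 1) :: (nat \<times> nat) set \<Rightarrow>\<^sub>0 (nat \<times> nat, 'a) poly_ring"
  have "lookup (box_gen E x ?v) D \<noteq> 0" using Cons.prems by simp
  then obtain y where y: "y \<in> {y \<in> E. fst y = fst x} \<inter> D"
    "(if finite D then (- 1) ^ card {z \<in> D. z < y} * pvar (snd y, snd x) * lookup ?v (D - {y}) else 0) \<noteq> 0"
    unfolding lookup_box_gen[OF assms(1)] by (rule sum.not_neutral_contains_not_neutral)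
  then have "lookup ?v (D - {y}) \<noteq> 0" by (auto split: if_splits)
  then have "fst ` (D - {y}) \<subseteq> fst ` set xs" by (rule Cons.IH)
  then show ?case using y(1) by auto
qed

text \<open>The condition on the columns of \<open>D\<close> makes the signs of \<open>theta\<close> those of the Laplace expansion.\<close>

lemma lookup_box_foldr_first:
  assumes "finite E" "D \<subseteq> E" "\<And>x. x \<in> D \<Longrightarrow> s \<le> fst x"
    and "\<And>D. lookup v D \<noteq> 0 \<Longrightarrow> s \<notin> fst ` D"
  shows "lookup (foldr (box_gen E) (map (Pair s) us) v) D =
    mn (\<lambda>p u. pvar (p, u)) (colset s D) us * lookup v {x \<in> D. fst x \<noteq> s}"
  using assms(2,3)
proof (induction us arbitrary: D)
  case Nil
  show ?case
  proof (cases "colset s D = {}")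
    case True
    then have "{x \<in> D. fst x \<noteq> s} = D" by (auto simp: colset_def)
    with True show ?thesis by simp
  next
    case False
    then have "s \<in> fst ` D" by (force simp: colset_def)
    then have "lookup v D = 0" using assms(4) by blast
    with False show ?thesis by simp
  qed
next
  case (Cons u us)
  let ?A = "colset s D"
  let ?w = "foldr (box_gen E) (map (Pair s) us) v"
  have fD: "finite D" using Cons.prems assms(1) finite_subset by blast
  have img: "{y \<in> E. fst y = fst (s, u)} \<inter> D = Pair s ` ?A" using Cons.prems(1) by (auto simp: colset_def)
  have "lookup (foldr (box_gen E) (map (Pair s) (u # us)) v) D = lookup (box_gen E (s, u) ?w) D" by simp
  also have "\<dots> = (\<Sum>y\<in>Pair s ` ?A. (- 1) ^ card {z \<in> D. z < y} * pvar (snd y, u) * lookup ?w (D - {y}))"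
    unfolding lookup_box_gen[OF assms(1)] img using fD by simp
  also have "\<dots> = (\<Sum>p\<in>?A. (- 1) ^ card {z \<in> D. z < (s, p)} * pvar (p, u) * lookup ?w (D - {(s, p)}))"
    by (subst sum.reindex) (auto intro: inj_onI)
  also have "\<dots> = (\<Sum>p\<in>?A. (- 1) ^ card {q \<in> ?A. q < p} * pvar (p, u) * mn (\<lambda>p u. pvar (p, u)) (?A - {p}) us *
      lookup v {x \<in> D. fst x \<noteq> s})"
  proof (rule sum.cong[OF refl])
    fix p assume p: "p \<in> ?A"
    have "{z \<in> D. z < (s, p)} = Pair s ` {q \<in> ?A. q < p}"
      using Cons.prems(2) by (force simp: colset_def less_prod_def)
    then have 1: "card {z \<in> D. z < (s, p)} = card {q \<in> ?A. q < p}" by (simp add: card_image inj_on_def)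
    have 2: "colset s (D - {(s, p)}) = ?A - {p}" "{x \<in> D - {(s, p)}. fst x \<noteq> s} = {x \<in> D. fst x \<noteq> s}"
      by (auto simp: colset_def)
    have 3: "lookup ?w (D - {(s, p)}) = mn (\<lambda>p u. pvar (p, u)) (?A - {p}) us * lookup v {x \<in> D. fst x \<noteq> s}"
      using Cons.IH[of "D - {(s, p)}"] Cons.prems unfolding 2 by auto
    show "(- 1) ^ card {z \<in> D. z < (s, p)} * pvar (p, u) * lookup ?w (D - {(s, p)}) =
      (- 1) ^ card {q \<in> ?A. q < p} * pvar (p, u) * mn (\<lambda>p u. pvar (p, u)) (?A - {p}) us *
      lookup v {x \<in> D. fst x \<noteq> s}"
      unfolding 1 3 by (simp only: mult.assoc)
  qed
  also have "\<dots> = mn (\<lambda>p u. pvar (p, u)) ?A (u # us) * lookup v {x \<in> D. fst x \<noteq> s}"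
    by (simp add: sum_distrib_right)
  finally show ?case .
qed

text \<open>Reading column by column is the lexicographic order on pairs, so for sorted
  \<open>js\<close> covering all columns of a finite \<tau> this is its sorted list.\<close>

definition col_word :: "nat list \<Rightarrow> (nat \<times> nat) set \<Rightarrow> (nat \<times> nat) list" where
  "col_word js \<tau> = concat (map (\<lambda>j. map (Pair j) (sorted_list_of_set (colset j \<tau>))) js)"

lemma set_col_word: "finite \<tau> \<Longrightarrow> set (col_word js \<tau>) = {x \<in> \<tau>. fst x \<in> set js}"
  by (auto simp: col_word_def finite_colset) (auto simp: colset_def)

lemma sorted_col_word: "sorted_wrt (<) js \<Longrightarrow> finite \<tau> \<Longrightarrow> sorted_wrt (<) (col_word js \<tau>)"
proof (induction js)
  case (Cons j js)
  have "sorted_wrt (<) (map (Pair j) (sorted_list_of_set (colset j \<tau>)))"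
    unfolding sorted_wrt_map by (rule sorted_wrt_mono_rel[of _ "(<)"]) (simp_all add: strict_sorted_iff)
  moreover have "x < y" if "x \<in> Pair j ` colset j \<tau>" "y \<in> set (col_word js \<tau>)" for x y
    using that Cons.prems by (auto simp: set_col_word less_prod_def)
  moreover have "col_word (j # js) \<tau> = map (Pair j) (sorted_list_of_set (colset j \<tau>)) @ col_word js \<tau>"
    by (simp add: col_word_def)
  ultimately show ?case using Cons by (simp add: sorted_wrt_append finite_colset)
qed (simp add: col_word_def)

lemma lookup_box_col_word:
  assumes "finite E" "finite \<tau>" "sorted_wrt (<) js" "D \<subseteq> E" "fst ` D \<subseteq> set js"
  shows "lookup (foldr (box_gen E) (col_word js \<tau>) (single {} 1)) D =
    (\<Prod>j\<leftarrow>js. mn (\<lambda>p u. pvar (p, u)) (colset j D) (sorted_list_of_set (colset j \<tau>)))"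
  using assms(3-)
proof (induction js arbitrary: D)
  case Nil
  then show ?case by (simp add: col_word_def)
next
  case (Cons j js)
  let ?v = "foldr (box_gen E) (col_word js \<tau>) (single {} 1) :: (nat \<times> nat) set \<Rightarrow>\<^sub>0 (nat \<times> nat, 'a) poly_ring"
  let ?D = "{x \<in> D. fst x \<noteq> j}"
  have "lookup (foldr (box_gen E) (map (Pair j) (sorted_list_of_set (colset j \<tau>))) ?v) D =
      mn (\<lambda>p u. pvar (p, u)) (colset j D) (sorted_list_of_set (colset j \<tau>)) * lookup ?v ?D"
  proof (rule lookup_box_foldr_first[OF assms(1) Cons.prems(2)])
    show "j \<le> fst x" if "x \<in> D" for x using that Cons.prems(1,3) by (auto intro: less_imp_le)
    show "j \<notin> fst ` D'" if "lookup ?v D' \<noteq> 0" for D'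
    proof -
      have "fst ` D' \<subseteq> fst ` set (col_word js \<tau>)" by (rule lookup_box_foldr_cols[OF assms(1) that])
      also have "\<dots> \<subseteq> set js" using assms(2) by (auto simp: set_col_word)
      finally show ?thesis using Cons.prems(1) by auto
    qed
  qed
  also have "lookup ?v ?D = (\<Prod>i\<leftarrow>js. mn (\<lambda>p u. pvar (p, u)) (colset i ?D) (sorted_list_of_set (colset i \<tau>)))"
    using Cons.prems by (intro Cons.IH) auto
  also have "map (\<lambda>i. mn (\<lambda>p u. pvar (p, u) :: (nat \<times> nat, 'a) poly_ring) (colset i ?D) (sorted_list_of_set (colset i \<tau>))) js =
      map (\<lambda>i. mn (\<lambda>p u. pvar (p, u)) (colset i D) (sorted_list_of_set (colset i \<tau>))) js"
  proof (rule map_cong[OF refl])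
    fix i assume "i \<in> set js"
    then have "i \<noteq> j" using Cons.prems(1) by auto
    then have "colset i ?D = colset i D" by (auto simp: colset_def)
    then show "mn (\<lambda>p u. pvar (p, u) :: (nat \<times> nat, 'a) poly_ring) (colset i ?D) (sorted_list_of_set (colset i \<tau>)) =
      mn (\<lambda>p u. pvar (p, u)) (colset i D) (sorted_list_of_set (colset i \<tau>))" by simp
  qed
  finally show ?case by (simp add: col_word_def)
qed

lemma foldr_op_zero:
  assumes "x \<in> set xs" "\<And>v. f x v = 0" "\<And>y. f y 0 = 0"
  shows "foldr f xs v = (0 :: 'v::zero)"
  using assms(1)
proof (induction xs)
  case (Cons y ys)
  then show ?case using assms(2,3) by (cases "x = y") auto
qed simp

text \<open>The coefficient at the full set of boxes is computed column after column by Laplace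
  expansion. A generator in a column outside the range has no boxes and is sent to 0.\<close>

lemma lookup_box_mon:
  assumes "finite \<tau>" "\<And>j. finite (a j)"
  shows "lookup (box_mon (Sigma {1..m} a) \<tau>) (Sigma {1..m} a) =
    (if fst ` \<tau> \<subseteq> {1..m} then \<Prod>j\<in>{1..m}. mn (\<lambda>p u. pvar (p, u)) (a j) (sorted_list_of_set (colset j \<tau>)) else 0)"
proof (cases "fst ` \<tau> \<subseteq> {1..m}")
  case True
  let ?E = "Sigma {1..m} a" and ?js = "[1..<Suc m]"
  have fE: "finite ?E" using assms(2) by auto
  have js: "set ?js = {1..m}" by auto
  have sw: "sorted_wrt (<) (col_word ?js \<tau>)" by (intro sorted_col_word sorted_wrt_upt assms(1))
  have "set (col_word ?js \<tau>) = \<tau>" using True assms(1) by (simp only: set_col_word js) auto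
  then have "sorted_list_of_set \<tau> = col_word ?js \<tau>"
    using sorted_list_of_set.idem_if_sorted_distinct[of "col_word ?js \<tau>"] sw by (simp add: strict_sorted_iff)
  then have "lookup (box_mon ?E \<tau>) ?E = (\<Prod>j\<leftarrow>?js. mn (\<lambda>p u. pvar (p, u)) (colset j ?E) (sorted_list_of_set (colset j \<tau>)))"
    using lookup_box_col_word[OF fE assms(1), of ?js ?E] assms(1) js by (simp add: box_mon_def image_subset_iff del: upt_Suc)
  also have "\<dots> = (\<Prod>j\<in>{1..m}. mn (\<lambda>p u. pvar (p, u)) (colset j ?E) (sorted_list_of_set (colset j \<tau>)))"
    unfolding js[symmetric] by (rule prod.distinct_set_conv_list[symmetric]) simp
  also have "\<dots> = (\<Prod>j\<in>{1..m}. mn (\<lambda>p u. pvar (p, u)) (a j) (sorted_list_of_set (colset j \<tau>)))"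
    by (rule prod.cong) (auto simp: colset_def)
  finally show ?thesis using True by simp
next
  case False
  let ?E = "Sigma {1..m} a"
  from False obtain x where x: "x \<in> \<tau>" "fst x \<notin> {1..m}" by blast
  have "foldr (box_gen ?E) (sorted_list_of_set \<tau>) (single {} 1) = (0 :: (nat \<times> nat) set \<Rightarrow>\<^sub>0 (nat \<times> nat, 'a) poly_ring)"
  proof (rule foldr_op_zero[of x])
    have "{y \<in> ?E. fst y \<in> {fst x}} = {}" using x by auto
    then show "box_gen ?E x v = 0" for v :: "(nat \<times> nat) set \<Rightarrow>\<^sub>0 (nat \<times> nat, 'a) poly_ring"
      by (simp only: box_op_def comb_def fst_conv sum.empty)
    show "box_gen ?E y 0 = 0" for y by (rule flin_zero[OF flin_box_op])
  qed (use x assms(1) in simp)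
  then show ?thesis using False assms(1) by (simp add: box_mon_def)
qed

section \<open>Dimensions of coset spaces and the grading by weight\<close>

section \<open>Dimensions of spaces of cosets\<close>

interpretation vs: Vector_Spaces.vector_space "fm_scale :: 'k::field \<Rightarrow> ('b \<Rightarrow>\<^sub>0 'k) \<Rightarrow> _"
  by unfold_locales (simp_all add: fm.scale_right_distrib fm.scale_left_distrib)

definition lin_indep :: "('i \<Rightarrow> ('b \<Rightarrow>\<^sub>0 'k::field)) \<Rightarrow> 'i set \<Rightarrow> bool" where
  "lin_indep f S \<longleftrightarrow> (\<forall>c. (\<Sum>i\<in>S. fm_scale (c i) (f i)) = 0 \<longrightarrow> (\<forall>i\<in>S. c i = 0))"

lemma lin_indepD: "lin_indep f S \<Longrightarrow> (\<Sum>i\<in>S. fm_scale (c i) (f i)) = 0 \<Longrightarrow> i \<in> S \<Longrightarrow> c i = 0"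
  unfolding lin_indep_def by blast

lemma lin_indep_neq_0:
  fixes f :: "'i \<Rightarrow> ('b \<Rightarrow>\<^sub>0 'k::field)"
  assumes "lin_indep f S" "finite S" "i \<in> S"
  shows "f i \<noteq> 0"
proof
  assume "f i = 0"
  then have "(\<Sum>l\<in>S. fm_scale (if l = i then 1 else 0) (f l)) = 0" by (intro sum.neutral) auto
  from lin_indepD[OF assms(1) this assms(3)] show False by simp
qed

lemma lin_indep_iff:
  fixes f :: "'i \<Rightarrow> ('b \<Rightarrow>\<^sub>0 'k::field)"
  assumes "finite S"
  shows "lin_indep f S \<longleftrightarrow> inj_on f S \<and> \<not> fm.dependent (f ` S)"
proof -
  have dep: "fm.dependent (f ` S) \<longleftrightarrow> (\<exists>u. (\<exists>v\<in>f ` S. u v \<noteq> 0) \<and> (\<Sum>v\<in>f ` S. fm_scale (u v) v) = 0)"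
    using assms by (intro fm.dependent_finite) simp
  show ?thesis
  proof
    assume ind: "lin_indep f S"
    have inj: "inj_on f S"
    proof (rule inj_onI, rule ccontr)
      fix i j assume ij: "i \<in> S" "j \<in> S" "f i = f j" "i \<noteq> j"
      let ?c = "\<lambda>l. if l = i then 1 else if l = j then - 1 else 0 :: 'k"
      have "(\<Sum>l\<in>S. fm_scale (?c l) (f l)) = (\<Sum>l\<in>{i, j}. fm_scale (?c l) (f l))"
        using assms ij by (intro sum.mono_neutral_right) auto
      also have "\<dots> = 0" using ij by simp
      finally have "?c i = 0" by (rule lin_indepD[OF ind _ ij(1)])
      then show False by simp
    qed
    moreover have "\<not> fm.dependent (f ` S)"
    proof
      assume "fm.dependent (f ` S)"
      then obtain u i where u: "i \<in> S" "u (f i) \<noteq> 0" "(\<Sum>v\<in>f ` S. fm_scale (u v) v) = 0" unfolding dep by blast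
      then have "(\<Sum>i\<in>S. fm_scale (u (f i)) (f i)) = 0" using inj by (simp add: sum.reindex)
      then have "u (f i) = 0" using u(1) by (rule lin_indepD[OF ind, of "\<lambda>i. u (f i)"])
      then show False using u(2) by simp
    qed
    ultimately show "inj_on f S \<and> \<not> fm.dependent (f ` S)" by blast
  next
    assume r: "inj_on f S \<and> \<not> fm.dependent (f ` S)"
    show "lin_indep f S" unfolding lin_indep_def
    proof (intro allI impI ballI)
      fix c i assume c: "(\<Sum>i\<in>S. fm_scale (c i) (f i)) = 0" and i: "i \<in> S"
      let ?u = "\<lambda>v. c (the_inv_into S f v)"
      have sum0: "(\<Sum>v\<in>f ` S. fm_scale (?u v) v) = 0"
        using r c by (simp add: sum.reindex the_inv_into_f_f)
      have "?u (f i) = 0"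
      proof (rule ccontr)
        assume "?u (f i) \<noteq> 0"
        then have "\<exists>v\<in>f ` S. ?u v \<noteq> 0" using i by (rule bexI[OF _ imageI])
        then have "fm.dependent (f ` S)" unfolding dep using sum0 by (intro exI[of _ ?u] conjI)
        then show False using r by simp
      qed
      then show "c i = 0" using r i by (simp add: the_inv_into_f_f)
    qed
  qed
qed

lemma lin_indep_span_bound:
  assumes "lin_indep f S" "finite S" "finite T" "f ` S \<subseteq> fm.span T"
  shows "card S \<le> card T"
proof -
  have "inj_on f S" "\<not> fm.dependent (f ` S)" using assms lin_indep_iff by blast+
  then show ?thesis using vs.independent_span_bound[OF assms(3) _ assms(4)] by (simp add: card_image)
qed

text \<open>A repetition or a dependence among the \<open>g i\<close> would leave fewer than
  \<open>card B\<close> vectors to span \<open>card B\<close> independent ones.\<close>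

lemma lin_indep_spanning:
  assumes "lin_indep f B" "finite B" "finite S" "card S \<le> card B" "f ` B \<subseteq> fm.span (g ` S)"
  shows "lin_indep g S"
proof -
  have b: "card B \<le> card T" if "finite T" "f ` B \<subseteq> fm.span T" for T
    using lin_indep_span_bound[OF assms(1,2) that] .
  have "card (g ` S) \<le> card S" using assms(3) by (rule card_image_le)
  moreover have "card B \<le> card (g ` S)" using assms(3,5) by (intro b) auto
  ultimately have card: "card (g ` S) = card S" "card S = card B" using assms(4) by auto
  have "\<not> fm.dependent (g ` S)"
  proof
    assume "fm.dependent (g ` S)"
    then obtain x where x: "x \<in> g ` S" "x \<in> fm.span (g ` S - {x})" unfolding vs.dependent_def by blast
    have "fm.span (g ` S - {x}) = fm.span (insert x (g ` S - {x}))" using x(2) by (rule vs.span_redundant[symmetric])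
    also have "insert x (g ` S - {x}) = g ` S" using x(1) by blast
    finally have "card B \<le> card (g ` S - {x})" using assms(3,5) by (intro b) auto
    then show False using x(1) card assms(3) card_Diff1_less[of "g ` S" x] by simp
  qed
  then show ?thesis using card(1) assms(3) by (simp add: lin_indep_iff eq_card_imp_inj_on)
qed

lemma coset_eq_iff:
  assumes "fm.subspace R"
  shows "coset R u = coset R v \<longleftrightarrow> u - v \<in> R"
proof
  assume "coset R u = coset R v"
  moreover have "u \<in> coset R u" using fm.subspace_0[OF assms] by (force simp: coset_def)
  ultimately show "u - v \<in> R" by (auto simp: coset_def)
next
  assume uv: "u - v \<in> R"
  have "coset R x \<subseteq> coset R y" if "x - y \<in> R" for x y
  proof
    fix z assume "z \<in> coset R x"
    then obtain r where "r \<in> R" "z = x + r" by (auto simp: coset_def)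
    then have "x - y + r \<in> R" "z = y + (x - y + r)" using that fm.subspace_add[OF assms] by auto
    then show "z \<in> coset R y" unfolding coset_def by blast
  qed
  moreover have "v - u \<in> R" using fm.subspace_neg[OF assms uv] by simp
  ultimately show "coset R u = coset R v" using uv by blast
qed

text \<open>Replace each \<open>b\<close> by a congruent vector in the span of \<open>C\<close>. A
  linear relation between these is one between the \<open>b\<close> modulo \<open>R\<close>, so they
  are independent.\<close>

lemma coset_basis_card_le:
  assumes R: "fm.subspace R" and B: "is_coset_basis R Q B" and C: "is_coset_basis R Q C"
  shows "card B \<le> card C"
proof -
  have fin: "finite B" "finite C" using B C by (auto simp: is_coset_basis_def)
  have "\<exists>g. g \<in> fm.span C \<and> b - g \<in> R" if "b \<in> B" for b
  proof -
    have "coset R b \<in> Q" using B that fm.span_base unfolding is_coset_basis_def by blast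
    then obtain g where "g \<in> fm.span C" "coset R b = coset R g" using C unfolding is_coset_basis_def by blast
    then show ?thesis using coset_eq_iff[OF R] by blast
  qed
  then obtain g where g: "\<And>b. b \<in> B \<Longrightarrow> g b \<in> fm.span C" "\<And>b. b \<in> B \<Longrightarrow> b - g b \<in> R" by metis
  have "lin_indep g B" unfolding lin_indep_def
  proof (intro allI impI)
    fix c assume c: "(\<Sum>b\<in>B. fm_scale (c b) (g b)) = 0"
    have "(\<Sum>b\<in>B. fm_scale (c b) (b - g b)) \<in> R"
      using g(2) by (intro fm.subspace_sum[OF R] fm.subspace_scale[OF R]) auto
    then have "(\<Sum>b\<in>B. fm_scale (c b) b) \<in> R" using c by (simp add: fm.scale_right_diff_distrib sum_subtractf)
    then show "\<forall>b\<in>B. c b = 0" using B unfolding is_coset_basis_def by blast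
  qed
  then show ?thesis using g(1) fin by (intro lin_indep_span_bound) auto
qed

lemma coset_dim_eq:
  fixes R :: "('b \<Rightarrow>\<^sub>0 'k::field) set"
  assumes R: "fm.subspace R" and Q: "Q = coset R ` {v. keys v \<subseteq> W}" and S: "finite S" "S \<subseteq> W"
    and sp: "\<And>b. b \<in> W \<Longrightarrow> single b 1 \<in> fm.span ((\<lambda>b. single b 1) ` S \<union> R)"
    and ind: "\<And>c. (\<Sum>b\<in>S. fm_scale (c b) (single b 1)) \<in> R \<Longrightarrow> \<forall>b\<in>S. c b = 0"
  shows "coset_dim R Q = card S"
proof -
  let ?s = "\<lambda>b. single b (1 :: 'k)"
  have inj: "inj_on ?s S" by (rule inj_onI) (metis lookup_single_eq lookup_single_not_eq zero_neq_one)
  have basis: "is_coset_basis R Q (?s ` S)" unfolding is_coset_basis_def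
  proof (intro conjI allI impI)
    show "coset R ` fm.span (?s ` S) = Q"
    proof
      show "coset R ` fm.span (?s ` S) \<subseteq> Q" using S(2) by (auto simp: Q span_single_iff)
      show "Q \<subseteq> coset R ` fm.span (?s ` S)"
      proof
        fix C assume "C \<in> Q"
        then obtain v where v: "keys v \<subseteq> W" "C = coset R v" unfolding Q by blast
        then have "v \<in> fm.span (?s ` W)" by (simp add: span_single_iff)
        then have "v \<in> fm.span (?s ` S \<union> R)" using sp by (elim span_subset_trans) blast
        then obtain s r where sr: "s \<in> fm.span (?s ` S)" "r \<in> fm.span R" "v = s + r" unfolding fm.span_Un by blast
        then have "r \<in> R" using fm.span_subspace[OF subset_refl fm.span_superset R] by simp
        then have "C = coset R s" using sr v(2) by (simp add: coset_eq_iff[OF R])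
        then show "C \<in> coset R ` fm.span (?s ` S)" using sr(1) by blast
      qed
    qed
    fix c assume "(\<Sum>b\<in>?s ` S. fm_scale (c b) b) \<in> R"
    then have "(\<Sum>b\<in>S. fm_scale (c (?s b)) (?s b)) \<in> R" using inj by (simp add: sum.reindex)
    then have "\<forall>b\<in>S. c (?s b) = 0" by (rule ind)
    then show "\<forall>b\<in>?s ` S. c b = 0" by blast
  qed (use S in simp)
  have "card B = card S" if "is_coset_basis R Q B" for B
    using coset_basis_card_le[OF R that basis] coset_basis_card_le[OF R basis that] inj by (simp add: card_image)
  then show ?thesis unfolding coset_dim_def using basis inj by (intro the_equality) (auto simp: card_image)
qed

section \<open>The grading by weight\<close>

definition part :: "('b \<Rightarrow> bool) \<Rightarrow> ('b \<Rightarrow>\<^sub>0 'a::comm_ring_1) \<Rightarrow> ('b \<Rightarrow>\<^sub>0 'a)" where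
  "part P = lext (\<lambda>b. if P b then single b 1 else 0)"

lemma flin_part: "flin (part P)"
  unfolding part_def by (rule flin_lext)

lemma lookup_part: "lookup (part P v) b = (if P b then lookup v b else 0)"
proof -
  have "lookup (part P v) b = (\<Sum>c\<in>keys v. if c = b then (if P b then lookup v b else 0) else 0)"
    unfolding part_def lext_def lookup_sum by (rule sum.cong) (auto simp: lookup_single)
  also have "\<dots> = (if P b then lookup v b else 0)" by (auto simp: in_keys_iff)
  finally show ?thesis .
qed

lemma keys_part: "keys (part P v) = {b \<in> keys v. P b}"
  by (auto simp: in_keys_iff lookup_part split: if_splits)

definition tup_wt :: "nat set list \<Rightarrow> (nat \<Rightarrow>\<^sub>0 nat)" where
  "tup_wt L = (\<Sum>b\<leftarrow>L. \<Sum>i\<in>b. single i 1)"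

text \<open>The grading of the matrix entries by their column index, for which the minors are
  homogeneous of the weight of the tensor.\<close>

definition mon_wt :: "(nat \<times> nat \<Rightarrow>\<^sub>0 nat) \<Rightarrow> (nat \<Rightarrow>\<^sub>0 nat)" where
  "mon_wt M = (\<Sum>x\<in>keys M. single (snd x) (lookup M x))"

definition homog :: "(nat \<Rightarrow>\<^sub>0 nat) \<Rightarrow> (nat \<times> nat, 'k::comm_ring_1) poly_ring \<Rightarrow> bool" where
  "homog \<nu> f \<longleftrightarrow> (\<forall>M\<in>keys f. mon_wt M = \<nu>)"

lemma mon_wt_superset:
  "finite A \<Longrightarrow> keys M \<subseteq> A \<Longrightarrow> mon_wt M = (\<Sum>x\<in>A. single (snd x) (lookup M x))"
  unfolding mon_wt_def by (rule sum.mono_neutral_left) (auto simp: in_keys_iff)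

lemma mon_wt_add: "mon_wt (M + N) = mon_wt M + mon_wt N"
proof -
  have "keys (M + N) \<subseteq> keys M \<union> keys N" by (rule keys_add)
  then show ?thesis
    by (subst (1 2 3) mon_wt_superset[of "keys M \<union> keys N"])
       (auto simp: lookup_add single_add sum.distrib)
qed

lemma homog_0 [simp]: "homog \<nu> 0"
  by (simp add: homog_def)

lemma homog_1: "homog 0 1"
  by (simp add: homog_def mon_wt_def)

lemma homog_pvar: "homog (single u 1) (pvar (p, u))"
  by (simp add: homog_def pvar_def mon_wt_def)

lemma homog_sum:
  assumes "\<And>i. i \<in> I \<Longrightarrow> homog \<nu> (f i)"
  shows "homog \<nu> (\<Sum>i\<in>I. f i)"
  unfolding homog_def
proof
  fix M assume "M \<in> keys (\<Sum>i\<in>I. f i)"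
  from subsetD[OF keys_sum_subset this] obtain i where "i \<in> I" "M \<in> keys (f i)" by (rule UN_E)
  then show "mon_wt M = \<nu>" using assms by (simp add: homog_def)
qed

lemma homog_mult:
  assumes "homog \<nu> f" "homog \<rho> g"
  shows "homog (\<nu> + \<rho>) (f * g)"
  unfolding homog_def
proof
  fix M assume "M \<in> keys (f * g)"
  then obtain A B where "M = A + B" "A \<in> keys f" "B \<in> keys g" using keys_mult[of f g] by blast
  then show "mon_wt M = \<nu> + \<rho>" using assms by (simp add: mon_wt_add homog_def)
qed

lemma homog_sign: "homog \<nu> f \<Longrightarrow> homog \<nu> ((- 1) ^ k * f)"
  by (cases "even k") (simp_all add: homog_def)

lemma homog_mn: "homog (\<Sum>u\<leftarrow>us. single u 1) (mn (\<lambda>p u. pvar (p, u)) a us)"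
proof (induction us arbitrary: a)
  case Nil
  then show ?case by (simp add: homog_1)
next
  case (Cons u us)
  show ?case unfolding mn.simps sum_list.Cons list.map
    by (rule homog_sum) (simp only: mult.assoc, intro homog_sign homog_mult homog_pvar Cons.IH)
qed

lemma homog_prod:
  "(\<And>i. i \<in> I \<Longrightarrow> homog (\<nu> i) (f i)) \<Longrightarrow> homog (\<Sum>i\<in>I. \<nu> i) (\<Prod>i\<in>I. f i)"
  by (induction I rule: infinite_finite_induct) (simp_all add: homog_1 homog_mult)

lemma part_homog: "homog \<nu> f \<Longrightarrow> part (\<lambda>M. mon_wt M = \<mu>) f = (if \<nu> = \<mu> then f else 0)"
  by (rule poly_mapping_eqI) (auto simp: lookup_part homog_def in_keys_iff)

section \<open>The relations of the flagged Schur module\<close>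

lemma minor_map_lext: "minor_map D f = lext (\<lambda>\<tau>. \<Prod>j<length D. generic_minor (D ! j) (\<tau> ! j)) f"
  by (simp add: minor_map_def lext_def fm_scale_eq_pconst_mult)

lemma flin_minor_map: "flin (minor_map D)"
  by (rule flinI) (simp_all add: minor_map_lext flin_add[OF flin_lext] flin_scale[OF flin_lext])

lemma minor_map_single: "minor_map D (single \<tau> 1) = (\<Prod>j<length D. generic_minor (D ! j) (\<tau> ! j))"
  by (simp add: minor_map_lext)

lemma subspace_schur_relations: "fm.subspace (schur_relations n D)"
  unfolding schur_relations_def by (rule fm.subspace_span)

lemma homog_minor_map:
  assumes "\<And>a. a \<in> set D \<Longrightarrow> finite a" "L \<in> shapes n D"
  shows "homog (tup_wt L) (minor_map D (single L 1))"
proof -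
  have sh: "list_all2 (\<lambda>b a. b \<subseteq> {1..n} \<and> card b = card a) L D" using assms(2) by (simp add: shapes_def)
  have len: "length L = length D" by (rule list_all2_lengthD[OF sh])
  have "homog (\<Sum>j<length D. \<Sum>i\<in>L ! j. single i 1) (\<Prod>j<length D. generic_minor (D ! j) (L ! j))"
  proof (rule homog_prod)
    fix j assume "j \<in> {..<length D}"
    then have j: "j < length D" by simp
    then have b: "L ! j \<subseteq> {1..n}" "card (L ! j) = card (D ! j)" using list_all2_nthD[OF sh] len by auto
    then have f: "finite (L ! j)" "finite (D ! j)" using assms(1) j finite_subset by auto
    have "(\<Sum>i\<in>L ! j. single i 1) = (\<Sum>u\<leftarrow>sorted_list_of_set (L ! j). single u (1::nat))"
      using f(1) by (simp add: sum_list_distinct_conv_sum_set)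
    then show "homog (\<Sum>i\<in>L ! j. single i 1) (generic_minor (D ! j) (L ! j))"
      unfolding generic_minor_eq_mn[OF f(2,1) b(2)] by (simp only: homog_mn)
  qed
  moreover have "tup_wt L = (\<Sum>j<length D. \<Sum>i\<in>L ! j. single i 1)"
    by (simp add: tup_wt_def sum_list_sum_nth len atLeast0LessThan)
  ultimately show ?thesis by (simp add: minor_map_single)
qed

lemma part_exchange_relations:
  assumes fin: "\<And>a. a \<in> set D \<Longrightarrow> finite a" and "x \<in> exchange_relations n D"
  shows "part (\<lambda>L. tup_wt L = \<nu>) x \<in> exchange_relations n D"
proof -
  let ?p = "part (\<lambda>L. tup_wt L = \<nu>) :: (nat set list \<Rightarrow>\<^sub>0 'a) \<Rightarrow> _"
  have x: "keys x \<subseteq> shapes n D" "minor_map D x = 0" using assms(2) by (auto simp: exchange_relations_def TE_iff)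
  have "minor_map D (?p x) = part (\<lambda>M. mon_wt M = \<nu>) (minor_map D x)"
  proof (rule flin_eqI[OF flin_comp[OF flin_minor_map flin_part] flin_comp[OF flin_part flin_minor_map]])
    fix L assume "L \<in> keys x"
    then have "L \<in> shapes n D" using x(1) by blast
    from part_homog[OF homog_minor_map[OF fin this], of \<nu>]
    have "part (\<lambda>M. mon_wt M = \<nu>) (minor_map D (single L (1::'a))) =
      (if tup_wt L = \<nu> then minor_map D (single L 1) else 0)" .
    moreover have "?p (single L 1) = (if tup_wt L = \<nu> then single L 1 else 0)" by (simp add: part_def)
    ultimately show "minor_map D (?p (single L 1)) = part (\<lambda>M. mon_wt M = \<nu>) (minor_map D (single L 1))"
      by (simp add: flin_zero[OF flin_minor_map])
  qed
  also have "\<dots> = 0" by (simp add: x(2) flin_zero[OF flin_part])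
  finally show ?thesis using x(1) by (auto simp: exchange_relations_def TE_iff keys_part)
qed

text \<open>The flag relations are spanned by basis tensors, and the exchange relations are the
  kernel of a map that is homogeneous in the weights; so both are graded.\<close>

lemma part_schur_relations:
  assumes fin: "\<And>a. a \<in> set D \<Longrightarrow> finite a" and r: "r \<in> schur_relations n D"
  shows "part (\<lambda>L. tup_wt L = \<nu>) r \<in> schur_relations n D"
proof -
  let ?U = "tensor_flag_relations n D \<union> exchange_relations n D :: (nat set list \<Rightarrow>\<^sub>0 'a) set"
  have "part (\<lambda>L. tup_wt L = \<nu>) x \<in> fm.span ?U" if "x \<in> ?U" for x
  proof (rule fm.span_base, cases "x \<in> exchange_relations n D")
    case True
    then show "part (\<lambda>L. tup_wt L = \<nu>) x \<in> ?U" using part_exchange_relations[OF fin] by blast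
  next
    case False
    then have "x \<in> tensor_flag_relations n D" using that by blast
    then have "keys x \<subseteq> {l \<in> shapes n D. \<exists>j<length D. \<not> flag_le (l ! j) (D ! j)}"
      by (simp only: tensor_flag_relations_iff[OF fin])
    then have "part (\<lambda>L. tup_wt L = \<nu>) x \<in> tensor_flag_relations n D"
      by (simp only: tensor_flag_relations_iff[OF fin] keys_part) auto
    then show "part (\<lambda>L. tup_wt L = \<nu>) x \<in> ?U" by blast
  qed
  then show ?thesis unfolding schur_relations_def
    by (rule flin_span[OF flin_part r[unfolded schur_relations_def]])
qed

section \<open>Weight spaces\<close>

lemma lookup_extend_scalars: "lookup (extend_scalars v) L = pconst (lookup v L)"
  by (simp add: extend_scalars_def Poly_Mapping.map.rep_eq when_def)

lemma lookup_torus_act: "lookup (torus_act v) L = single (tup_wt L) (lookup v L)"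
proof -
  have p: "(\<Prod>b\<leftarrow>L. \<Prod>i\<in>b. pvar i) = (single (tup_wt L) 1 :: (nat, 'a) poly_ring)" for L
    by (induction L) (simp_all add: tup_wt_def pvar_def prod_single mult_single)
  have "lookup (torus_act v) L = (\<Sum>\<tau>\<in>keys v. if \<tau> = L then single (tup_wt L) (lookup v L) else 0)"
    unfolding torus_act_def lookup_sum p
    by (rule sum.cong) (auto simp: lookup_single pconst_def mult_single)
  also have "\<dots> = single (tup_wt L) (lookup v L)" by (auto simp: in_keys_iff)
  finally show ?thesis .
qed

text \<open>The coefficient of \<open>t^\<nu>\<close>: the way back from the extended scalars, under
  which the extension of a subspace returns into that subspace.\<close>

definition scalar_coeff :: "(nat \<Rightarrow>\<^sub>0 nat) \<Rightarrow> (nat set list \<Rightarrow>\<^sub>0 (nat, 'k::comm_ring_1) poly_ring) \<Rightarrow> (nat set list \<Rightarrow>\<^sub>0 'k)" where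
  "scalar_coeff \<nu> F = Poly_Mapping.map (\<lambda>p. lookup p \<nu>) F"

lemma lookup_scalar_coeff [simp]: "lookup (scalar_coeff \<nu> F) L = lookup (lookup F L) \<nu>"
  by (simp add: scalar_coeff_def Poly_Mapping.map.rep_eq when_def)

lemma scalar_coeff_span:
  assumes "fm.subspace R" "F \<in> fm.span (extend_scalars ` R)"
  shows "scalar_coeff \<nu> F \<in> R"
  using assms(2)
proof (induction rule: fm.span_induct_alt)
  case base
  have "scalar_coeff \<nu> 0 = (0 :: nat set list \<Rightarrow>\<^sub>0 'a)" by (rule poly_mapping_eqI) simp
  then show ?case using fm.subspace_0[OF assms(1)] by simp
next
  case (step c x y)
  then obtain r where r: "r \<in> R" "x = extend_scalars r" by blast
  have "lookup (c * pconst k) \<nu> = lookup c \<nu> * k" for k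
    using lookup_fm_scale[of k c \<nu>] by (simp add: fm_scale_eq_pconst_mult mult.commute)
  then have "scalar_coeff \<nu> (fm_scale c x + y) = fm_scale (lookup c \<nu>) r + scalar_coeff \<nu> y"
    by (intro poly_mapping_eqI) (simp add: r(2) lookup_add lookup_extend_scalars)
  then show ?case using r(1) step by (simp add: fm.subspace_add[OF assms(1)] fm.subspace_scale[OF assms(1)])
qed

text \<open>Let \<open>X v\<close> be the defect \<open>t v - t^l v\<close>. Its coefficient at
  \<open>t^\<nu>\<close> for \<nu> other than \<open>l\<close> is the part of \<open>v\<close> of
  weight \<nu>, which is therefore a relation, and \<open>v\<close> is congruent to its part of
  weight \<open>l\<close>. Conversely the defect of a relation is a relation over the extended
  scalars, because the relations are graded.\<close>

lemma weight_space_eq: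
  assumes fin: "\<And>a. a \<in> set D \<Longrightarrow> finite a"
  shows "(weight_space n D l :: (nat set list \<Rightarrow>\<^sub>0 'k::field) set set) =
    coset (schur_relations n D) ` {v. keys v \<subseteq> {L \<in> shapes n D. tup_wt L = l}}"
proof -
  let ?R = "schur_relations n D :: (nat set list \<Rightarrow>\<^sub>0 'k) set"
  let ?W = "{L \<in> shapes n D. tup_wt L = l}"
  let ?p = "\<lambda>\<nu>. part (\<lambda>L. tup_wt L = \<nu>) :: (nat set list \<Rightarrow>\<^sub>0 'k) \<Rightarrow> _"
  define X where "X v = torus_act v - fm_scale (single l 1) (extend_scalars v)" for v :: "nat set list \<Rightarrow>\<^sub>0 'k"
  note R = subspace_schur_relations[of n D, where 'a='k]
  have lX: "lookup (X v) L = single (tup_wt L) (lookup v L) - single l (lookup v L)" for v L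
    by (simp add: X_def lookup_minus lookup_torus_act lookup_extend_scalars pconst_def mult_single)
  have decomp: "v = (\<Sum>\<nu>\<in>tup_wt ` keys v. ?p \<nu> v)" for v
  proof (rule poly_mapping_eqI)
    fix L
    have "lookup (\<Sum>\<nu>\<in>tup_wt ` keys v. ?p \<nu> v) L = (\<Sum>\<nu>\<in>tup_wt ` keys v. if tup_wt L = \<nu> then lookup v L else 0)"
      by (simp add: lookup_sum lookup_part)
    also have "\<dots> = lookup v L" using imageI[of L "keys v" tup_wt] by (auto simp: in_keys_iff)
    finally show "lookup v L = lookup (\<Sum>\<nu>\<in>tup_wt ` keys v. ?p \<nu> v) L" by simp
  qed
  have XR: "X r \<in> fm.span (extend_scalars ` ?R)" if r: "r \<in> ?R" for r
  proof -
    have "torus_act r = (\<Sum>\<nu>\<in>tup_wt ` keys r. fm_scale (single \<nu> 1) (extend_scalars (?p \<nu> r)))"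
    proof (rule poly_mapping_eqI)
      fix L
      have "lookup (\<Sum>\<nu>\<in>tup_wt ` keys r. fm_scale (single \<nu> 1) (extend_scalars (?p \<nu> r))) L =
        (\<Sum>\<nu>\<in>tup_wt ` keys r. if tup_wt L = \<nu> then single (tup_wt L) (lookup r L) else 0)"
        unfolding lookup_sum by (rule sum.cong) (auto simp: lookup_extend_scalars lookup_part pconst_def mult_single)
      also have "\<dots> = lookup (torus_act r) L" by (cases "L \<in> keys r") (auto simp: lookup_torus_act, simp add: in_keys_iff)
      finally show "lookup (torus_act r) L = lookup (\<Sum>\<nu>\<in>tup_wt ` keys r. fm_scale (single \<nu> 1) (extend_scalars (?p \<nu> r))) L" by simp
    qed
    moreover have "\<dots> \<in> fm.span (extend_scalars ` ?R)"
      using part_schur_relations[OF fin r] by (intro fm.span_sum fm.span_scale fm.span_base) auto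
    ultimately show ?thesis using r unfolding X_def by (intro fm.span_diff fm.span_scale fm.span_base[OF imageI]) simp_all
  qed
  have Xadd: "X (u + v) = X u + X v" for u v
    by (rule poly_mapping_eqI) (simp add: lookup_add lX single_add)
  show ?thesis
  proof
    show "weight_space n D l \<subseteq> coset ?R ` {v. keys v \<subseteq> ?W}"
    proof
      fix C :: "(nat set list \<Rightarrow>\<^sub>0 'k) set" assume "C \<in> weight_space n D l"
      then obtain v where v: "v \<in> TE n D" "C = coset ?R v"
        and XC: "\<And>u. u \<in> C \<Longrightarrow> X u \<in> fm.span (extend_scalars ` ?R)"
        unfolding weight_space_def flagged_schur_module_def X_def by blast
      have "v \<in> C" using fm.subspace_0[OF R] unfolding v(2) coset_def by force
      then have Xv: "X v \<in> fm.span (extend_scalars ` ?R)" by (rule XC)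
      have "?p \<nu> v \<in> ?R" if "\<nu> \<noteq> l" for \<nu>
      proof -
        have "scalar_coeff \<nu> (X v) = ?p \<nu> v"
          using that by (intro poly_mapping_eqI) (auto simp: lX lookup_minus lookup_part lookup_single when_def)
        then show ?thesis using scalar_coeff_span[OF R Xv, of \<nu>] by simp
      qed
      then have "(\<Sum>\<nu>\<in>tup_wt ` keys v - {l}. ?p \<nu> v) \<in> ?R" by (intro fm.subspace_sum[OF R]) auto
      moreover have "v - ?p l v = (\<Sum>\<nu>\<in>tup_wt ` keys v - {l}. ?p \<nu> v)"
      proof (cases "l \<in> tup_wt ` keys v")
        case True
        then have "(\<Sum>\<nu>\<in>tup_wt ` keys v. ?p \<nu> v) = ?p l v + (\<Sum>\<nu>\<in>tup_wt ` keys v - {l}. ?p \<nu> v)"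
          by (simp add: sum.remove)
        then show ?thesis using decomp[of v] by (metis add_diff_cancel_left')
      next
        case False
        then have "?p l v = 0" by (intro poly_mapping_eqI) (auto simp: lookup_part in_keys_iff)
        then show ?thesis using False decomp[of v] by simp
      qed
      ultimately have "C = coset ?R (?p l v)" unfolding v(2) by (simp add: coset_eq_iff[OF R])
      moreover have "keys (?p l v) \<subseteq> ?W" using v(1) by (auto simp: keys_part TE_iff)
      ultimately show "C \<in> coset ?R ` {v. keys v \<subseteq> ?W}" by blast
    qed
    show "coset ?R ` {v. keys v \<subseteq> ?W} \<subseteq> weight_space n D l"
    proof
      fix C assume "C \<in> coset ?R ` {v. keys v \<subseteq> ?W}"
      then obtain v where v: "keys v \<subseteq> ?W" "C = coset ?R v" by blast
      then have "v \<in> TE n D" by (auto simp: TE_iff)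
      then have "C \<in> flagged_schur_module n D" unfolding flagged_schur_module_def v(2) by (rule imageI)
      moreover have "X u \<in> fm.span (extend_scalars ` ?R)" if u: "u \<in> C" for u
      proof -
        obtain r where r: "r \<in> ?R" "u = v + r" using u unfolding v(2) coset_def by blast
        have "lookup (X v) L = 0" for L
        proof (cases "L \<in> keys v")
          case True
          then have "tup_wt L = l" using v(1) by blast
          then show ?thesis by (simp add: lX)
        next
          case False
          then show ?thesis by (simp add: lX in_keys_iff)
        qed
        then have "X v = 0" by (intro poly_mapping_eqI) simp
        then show ?thesis using XR[OF r(1)] by (simp add: r(2) Xadd)
      qed
      ultimately show "C \<in> weight_space n D l" unfolding weight_space_def X_def by blast
    qed
  qed
qed

section \<open>Comparison of the module with the exterior algebra, and the character\<close>

section \<open>The character\<close>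

text \<open>Column \<open>j\<close>, counted from 1, is stored at position \<open>j - 1\<close> of
  the list.\<close>

definition columns :: "nat \<Rightarrow> (nat \<times> nat) set \<Rightarrow> nat set list" where
  "columns m \<tau> = map (\<lambda>j. colset j \<tau>) [1..<m + 1]"

definition fills :: "nat \<Rightarrow> (nat \<Rightarrow> nat set) \<Rightarrow> (nat \<times> nat) set \<Rightarrow> bool" where
  "fills m a \<tau> \<longleftrightarrow> finite \<tau> \<and> fst ` \<tau> \<subseteq> {1..m} \<and> (\<forall>j\<in>{1..m}. card (colset j \<tau>) = card (a j))"

lemma length_columns [simp]: "length (columns m \<tau>) = m"
  by (simp add: columns_def del: upt_Suc)

lemma nth_columns [simp]: "j < m \<Longrightarrow> columns m \<tau> ! j = colset (Suc j) \<tau>"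
  by (simp add: columns_def del: upt_Suc)

lemma prod_columns: "(\<Prod>j<m. f (Suc j)) = (\<Prod>j\<in>{1..m}. f j)" for f :: "nat \<Rightarrow> 'a::comm_monoid_mult"
  using prod.reindex[of Suc "{..<m}" f] by (simp add: image_Suc_lessThan)

lemma tup_wt_columns:
  assumes "finite \<tau>" "fst ` \<tau> \<subseteq> {1..m}"
  shows "tup_wt (columns m \<tau>) = wt \<tau>"
proof -
  have "\<tau> = Sigma {1..m} (\<lambda>j. colset j \<tau>)" using assms(2) by (auto simp: colset_def)
  then have "wt \<tau> = (\<Sum>x\<in>Sigma {1..m} (\<lambda>j. colset j \<tau>). single (snd x) 1)" by (simp add: wt_def)
  also have "\<dots> = (\<Sum>j\<in>{1..m}. \<Sum>u\<in>colset j \<tau>. single u 1)"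
    using sum.Sigma[of "{1..m}" "\<lambda>j. colset j \<tau>" "\<lambda>_ u. single u (1::nat)"] finite_colset[OF assms(1)]
    by (simp add: split_def)
  also have "\<dots> = (\<Sum>j\<leftarrow>[1..<m + 1]. \<Sum>u\<in>colset j \<tau>. single u 1)"
    by (subst sum_list_distinct_conv_sum_set) (simp_all add: atLeastLessThanSuc_atLeastAtMost del: upt_Suc)
  finally show ?thesis by (simp add: tup_wt_def columns_def comp_def del: upt_Suc)
qed

locale schur_diagram =
  fixes n m :: nat and a :: "nat \<Rightarrow> nat set"
  assumes finite_a: "\<And>j. finite (a j)" and outside: "\<And>j. a j \<noteq> {} \<Longrightarrow> j \<in> {1..m}"
begin

definition D :: "nat set list" where "D = map a [1..<m + 1]"

lemma length_D [simp]: "length D = m"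
  by (simp add: D_def del: upt_Suc)

lemma nth_D [simp]: "j < m \<Longrightarrow> D ! j = a (Suc j)"
  by (simp add: D_def del: upt_Suc)

lemma finite_D: "b \<in> set D \<Longrightarrow> finite b"
  using finite_a by (auto simp: D_def)

lemma columns_shapes:
  assumes "fills m a \<tau>" "keys (wt \<tau>) \<subseteq> {1..n}"
  shows "columns m \<tau> \<in> shapes n D"
proof -
  have "snd ` \<tau> \<subseteq> {1..n}" using assms by (simp add: wt_keys fills_def)
  then have "colset j \<tau> \<subseteq> {1..n}" for j by (force simp: colset_def)
  then show ?thesis using assms(1) unfolding shapes_def list_all2_conv_all_nth
    by (auto simp: fills_def)
qed

lemma shapes_columns:
  assumes "L \<in> shapes n D"
  obtains \<tau> where "fills m a \<tau>" "L = columns m \<tau>"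
proof -
  have L: "length L = m" "\<And>j. j < m \<Longrightarrow> L ! j \<subseteq> {1..n} \<and> card (L ! j) = card (a (Suc j))"
    using assms unfolding shapes_def list_all2_conv_all_nth by auto
  define \<tau> where "\<tau> = Sigma {1..m} (\<lambda>j. L ! (j - 1))"
  have c: "colset j \<tau> = L ! (j - 1)" if "j \<in> {1..m}" for j using that by (auto simp: colset_def \<tau>_def)
  have fin: "finite (L ! (j - 1))" and card: "card (L ! (j - 1)) = card (a j)" if "j \<in> {1..m}" for j
    using L(2)[of "j - 1"] that finite_subset[of "L ! (j - 1)" "{1..n}"] by auto
  have "finite \<tau>" unfolding \<tau>_def using fin by (intro finite_SigmaI) auto
  moreover have "fst ` \<tau> \<subseteq> {1..m}" by (auto simp: \<tau>_def)
  ultimately have "fills m a \<tau>" using c card by (simp add: fills_def)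
  moreover have "L = columns m \<tau>" by (rule nth_equalityI) (use L(1) c in auto)
  ultimately show ?thesis by (rule that)
qed

text \<open>Tensors with wrong column degrees go to 0, so that a product of column sums, which mixes
  these degrees, can be transferred as a whole.\<close>

definition transfer :: "((nat \<times> nat) set \<Rightarrow>\<^sub>0 'k::comm_ring_1) \<Rightarrow> (nat set list \<Rightarrow>\<^sub>0 'k)" where
  "transfer = lext (\<lambda>\<tau>. if fills m a \<tau> then single (columns m \<tau>) 1 else 0)"

lemma flin_transfer: "flin transfer"
  unfolding transfer_def by (rule flin_lext)

lemma transfer_single: "transfer (single \<tau> 1) = (if fills m a \<tau> then single (columns m \<tau>) 1 else 0)"
  by (simp add: transfer_def)

text \<open>On a basis tensor both sides are the product of its minors. For wrong column degrees the
  left side is 0 by \<open>transfer\<close> and the right side because an expansion with unequal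
  numbers of rows and columns vanishes. Through this identity \<open>box_hom_exch\<close> yields
  genuine exchange relations.\<close>

lemma minor_map_transfer:
  "minor_map D (transfer v) = lookup (box_hom (Sigma {1..m} a) v) (Sigma {1..m} a)"
proof (rule additive_poly_mapping_eqI[of "\<lambda>v. minor_map D (transfer v)" "\<lambda>v. lookup (box_hom (Sigma {1..m} a) v) (Sigma {1..m} a)"])
  fix u v :: "(nat \<times> nat) set \<Rightarrow>\<^sub>0 'a"
  show "minor_map D (transfer (u + v)) = minor_map D (transfer u) + minor_map D (transfer v)"
    by (simp only: flin_add[OF flin_transfer] flin_add[OF flin_minor_map])
  show "lookup (box_hom (Sigma {1..m} a) (u + v)) (Sigma {1..m} a) =
    lookup (box_hom (Sigma {1..m} a) u) (Sigma {1..m} a) + lookup (box_hom (Sigma {1..m} a) v) (Sigma {1..m} a)"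
    by (simp only: box_hom_add lookup_add)
next
  fix \<tau> and c :: 'a
  let ?E = "Sigma {1..m} a"
  have e: "minor_map D (transfer (single \<tau> (1 :: 'a))) = lookup (box_mon ?E \<tau>) ?E"
  proof (cases "finite \<tau>")
    case fin: True
    show ?thesis
    proof (cases "fills m a \<tau>")
      case True
      have "minor_map D (transfer (single \<tau> (1 :: 'a))) = (\<Prod>j<m. generic_minor (a (Suc j)) (colset (Suc j) \<tau>))"
        unfolding transfer_single using True
        by (simp only: if_True minor_map_single length_D) (rule prod.cong, simp_all)
      also have "\<dots> = (\<Prod>j\<in>{1..m}. generic_minor (a j) (colset j \<tau>))"
        by (rule prod_columns[of "\<lambda>j. generic_minor (a j) (colset j \<tau>)"])
      also have "\<dots> = (\<Prod>j\<in>{1..m}. mn (\<lambda>p u. pvar (p, u)) (a j) (sorted_list_of_set (colset j \<tau>)))"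
        using True fin by (intro prod.cong refl generic_minor_eq_mn finite_a finite_colset) (auto simp: fills_def)
      also have "\<dots> = lookup (box_mon ?E \<tau>) ?E"
        by (subst lookup_box_mon[of \<tau> a, OF fin finite_a]) (use True in \<open>simp add: fills_def\<close>)
      finally show ?thesis .
    next
      case False
      have "(\<Prod>j\<in>{1..m}. mn (\<lambda>p u. pvar (p, u)) (a j) (sorted_list_of_set (colset j \<tau>))) = (0 :: (nat \<times> nat, 'a) poly_ring)"
        if sub: "fst ` \<tau> \<subseteq> {1..m}"
      proof -
        obtain j where "j \<in> {1..m}" "card (a j) \<noteq> length (sorted_list_of_set (colset j \<tau>))"
          using False fin sub by (auto simp: fills_def finite_colset)
        then show ?thesis using finite_a by (intro prod_zero bexI[of _ j] mn_length) auto
      qed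
      then have "lookup (box_mon ?E \<tau>) ?E = (0 :: (nat \<times> nat, 'a) poly_ring)"
        unfolding lookup_box_mon[of \<tau> a, OF fin finite_a] by presburger
      then show ?thesis using False by (simp add: transfer_single flin_zero[OF flin_minor_map])
    qed
  next
    case False
    then show ?thesis by (simp add: transfer_single fills_def box_mon_def flin_zero[OF flin_minor_map])
  qed
  have "single \<tau> c = fm_scale c (single \<tau> 1)" by simp
  then have "minor_map D (transfer (single \<tau> c)) = fm_scale c (minor_map D (transfer (single \<tau> 1)))"
    by (simp only: flin_scale[OF flin_transfer] flin_scale[OF flin_minor_map])
  then show "minor_map D (transfer (single \<tau> c)) = lookup (box_hom ?E (single \<tau> c)) ?E"
    unfolding e by (simp add: box_hom_single fm_scale_eq_pconst_mult)
qed

lemma transfer_gens: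
  assumes "x \<in> gens a \<mu>" "keys \<mu> \<subseteq> {1..n}"
  shows "transfer x \<in> schur_relations n D"
  using assms(1) unfolding gens_def
proof (elim UnE)
  assume "x \<in> {single \<tau> 1 |\<tau>. finite \<tau> \<and> wt \<tau> = \<mu> \<and> \<not> flagged a \<tau>}"
  then obtain \<tau> where \<tau>: "x = single \<tau> 1" "finite \<tau>" "wt \<tau> = \<mu>" "\<not> flagged a \<tau>" by blast
  show ?thesis
  proof (cases "fills m a \<tau>")
    case True
    obtain j where j: "\<not> flag_le (colset j \<tau>) (a j)" using \<tau>(4) by (auto simp: flagged_def)
    have "j \<in> {1..m}"
    proof (rule ccontr)
      assume "j \<notin> {1..m}"
      then have "j \<notin> fst ` \<tau>" "a j = {}" using True outside by (auto simp: fills_def)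
      then have "colset j \<tau> = {}" by (force simp: colset_def)
      with \<open>a j = {}\<close> j show False by (simp add: flag_le_def)
    qed
    then have "j - 1 < m" "Suc (j - 1) = j" by auto
    then have "\<exists>j<length D. \<not> flag_le (columns m \<tau> ! j) (D ! j)"
      using j by (intro exI[of _ "j - 1"]) simp
    then have "keys (single (columns m \<tau>) (1 :: 'a)) \<subseteq> {l \<in> shapes n D. \<exists>j<length D. \<not> flag_le (l ! j) (D ! j)}"
      using columns_shapes[OF True] \<tau>(3) assms(2) by (simp)
    then have "transfer x \<in> tensor_flag_relations n D"
      unfolding \<tau>(1) transfer_single using True by (simp only: if_True tensor_flag_relations_iff[OF finite_D])
    then show ?thesis unfolding schur_relations_def by (intro fm.span_base) simp
  next
    case False
    then show ?thesis unfolding \<tau>(1) transfer_single schur_relations_def by (simp add: fm.span_zero)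
  qed
next
  assume "x \<in> {prodL L |L. wtm (mset L) = \<mu> \<and> exch a (mset L)}"
  then obtain L where L: "x = prodL L" "wtm (mset L) = \<mu>" "exch a (mset L)" by blast
  have "transfer x \<in> fm.span ((\<lambda>l. single l 1) ` shapes n D)"
  proof (rule flin_span[OF flin_transfer, of _ "(\<lambda>\<tau>. single \<tau> 1) ` mons L"])
    show "x \<in> fm.span ((\<lambda>\<tau>. single \<tau> 1) ` mons L)" unfolding L(1) span_single_iff by (rule keys_prodL)
    fix y :: "(nat \<times> nat) set \<Rightarrow>\<^sub>0 'a" assume "y \<in> (\<lambda>\<tau>. single \<tau> 1) ` mons L"
    then obtain \<tau> where \<tau>: "y = single \<tau> 1" "\<tau> \<in> mons L" by blast
    then have "keys (wt \<tau>) \<subseteq> {1..n}" using mons_wt[OF \<tau>(2)] L(2) assms(2) by simp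
    then show "transfer y \<in> fm.span ((\<lambda>l. single l 1) ` shapes n D)"
      unfolding \<tau>(1) transfer_single using columns_shapes by (auto simp: span_single_iff fm.span_zero)
  qed
  then have "transfer x \<in> TE n D" unfolding TE_iff span_single_iff .
  moreover have "box_hom (Sigma {1..m} a) x = 0"
    unfolding L(1) by (rule box_hom_exch[OF _ L(3)]) (use finite_a in auto)
  then have "minor_map D (transfer x) = 0" unfolding minor_map_transfer by simp
  ultimately have "transfer x \<in> exchange_relations n D" by (simp add: exchange_relations_def)
  then show ?thesis unfolding schur_relations_def by (intro fm.span_base) simp
qed

definition tri_map :: "(nat set list \<Rightarrow>\<^sub>0 'k::comm_ring_1) \<Rightarrow> (nat \<times> nat, 'k) poly_ring" where
  "tri_map = lext (\<lambda>l. \<Prod>j<m. mn tri (a (Suc j)) (sorted_list_of_set (l ! j)))"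

lemma flin_tri_map: "flin tri_map"
  unfolding tri_map_def by (rule flin_lext)

lemma tri_map_columns: "tri_map (single (columns m \<tau>) 1) = (psi m a \<tau> :: (nat \<times> nat, 'k::comm_ring_1) poly_ring)"
proof -
  have "tri_map (single (columns m \<tau>) 1) =
      (\<Prod>j<m. mn tri (a (Suc j)) (sorted_list_of_set (colset (Suc j) \<tau>)) :: (nat \<times> nat, 'k) poly_ring)"
    unfolding tri_map_def by simp
  also have "\<dots> = psi m a \<tau>"
    unfolding psi_def by (rule prod_columns[of "\<lambda>j. mn tri (a j) (sorted_list_of_set (colset j \<tau>))"])
  finally show ?thesis .
qed

lemma tri_map_exchange:
  fixes v :: "nat set list \<Rightarrow>\<^sub>0 'k::comm_ring_1"
  assumes "keys v \<subseteq> shapes n D"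
  shows "tri_map v = psubst (case_prod tri) (minor_map D v)"
proof (rule flin_eqI[OF flin_tri_map])
  show "flin (\<lambda>v. psubst (case_prod tri) (minor_map D v))"
    by (rule flinI) (simp_all only: flin_add[OF flin_minor_map] flin_scale[OF flin_minor_map] psubst_add psubst_fm_scale)
  fix L assume "L \<in> keys v"
  then have "L \<in> shapes n D" using assms by blast
  then have L: "length L = m" "\<And>j. j < m \<Longrightarrow> L ! j \<subseteq> {1..n} \<and> card (L ! j) = card (a (Suc j))"
    unfolding shapes_def list_all2_conv_all_nth by auto
  have "psubst (case_prod tri) (generic_minor (D ! j) (L ! j)) =
      (mn tri (a (Suc j)) (sorted_list_of_set (L ! j)) :: (nat \<times> nat, 'k) poly_ring)"
    if "j \<in> {..<m}" for j
  proof -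
    have that: "j < m" using that by simp
    have f: "finite (L ! j)" "card (L ! j) = card (a (Suc j))" using L(2)[OF that] finite_subset by auto
    show ?thesis unfolding nth_D[OF that] generic_minor_eq_mn[OF finite_a f] psubst_mn by simp
  qed
  then have "(\<Prod>j<m. psubst (case_prod tri) (generic_minor (D ! j) (L ! j))) =
      (\<Prod>j<m. mn tri (a (Suc j)) (sorted_list_of_set (L ! j)) :: (nat \<times> nat, 'k) poly_ring)"
    by (rule prod.cong[OF refl])
  then show "tri_map (single L (1 :: 'k)) = psubst (case_prod tri) (minor_map D (single L 1))"
    unfolding minor_map_single length_D psubst_prod tri_map_def lext_single by simp
qed

text \<open>Exchange relations are killed because on tensors of the right shape
  \<open>tri_map\<close> is a specialization of \<open>minor_map\<close>; a flag relation is killed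
  because each of its basis tensors has a minor that vanishes on the triangular matrix.\<close>

lemma tri_map_relations:
  assumes "r \<in> schur_relations n D"
  shows "tri_map r = (0 :: (nat \<times> nat, 'k::field) poly_ring)"
proof -
  have "tri_map r \<in> fm.span {}"
  proof (rule flin_span[OF flin_tri_map assms[unfolded schur_relations_def]])
    fix x :: "nat set list \<Rightarrow>\<^sub>0 'k" assume x: "x \<in> tensor_flag_relations n D \<union> exchange_relations n D"
    have "tri_map x = 0"
    proof (cases "x \<in> exchange_relations n D")
      case True
      then have "keys x \<subseteq> shapes n D" "minor_map D x = 0" by (simp_all add: exchange_relations_def TE_iff)
      then show ?thesis by (simp add: tri_map_exchange)
    next
      case False
      then have "x \<in> tensor_flag_relations n D" using x by blast
      then have kx: "keys x \<subseteq> {l \<in> shapes n D. \<exists>j<length D. \<not> flag_le (l ! j) (D ! j)}"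
        by (simp only: tensor_flag_relations_iff[OF finite_D])
      have "(\<Prod>j<m. mn tri (a (Suc j)) (sorted_list_of_set (L ! j))) = (0 :: (nat \<times> nat, 'k) poly_ring)" if L: "L \<in> keys x" for L
      proof -
        obtain j where j: "L \<in> shapes n D" "j < m" "\<not> flag_le (L ! j) (D ! j)" using subsetD[OF kx L] by auto
        have Lj: "L ! j \<subseteq> {1..n}" "card (L ! j) = card (a (Suc j))"
          using j(1,2) unfolding shapes_def list_all2_conv_all_nth by auto
        then obtain i where i: "card (L ! j \<inter> {..i}) < card (a (Suc j) \<inter> {..i})"
          using j(3) unfolding nth_D[OF j(2)] flag_le_def by (auto simp: not_le)
        have fin: "finite (L ! j)" using Lj(1) finite_subset by auto
        have "length (filter (\<lambda>u. u \<le> i) (sorted_list_of_set (L ! j))) = card {u \<in> L ! j. u \<le> i}"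
          using fin distinct_card[of "filter (\<lambda>u. u \<le> i) (sorted_list_of_set (L ! j))"] by (simp add: distinct_filter)
        also have "{u \<in> L ! j. u \<le> i} = L ! j \<inter> {..i}" by auto
        finally have "mn tri (a (Suc j)) (sorted_list_of_set (L ! j)) = (0 :: (nat \<times> nat, 'k) poly_ring)"
          using i by (intro mn_tri_eq_0[of _ i] finite_a) simp
        then show ?thesis using j(2) by (intro prod_zero) auto
      qed
      then show ?thesis unfolding tri_map_def lext_def by (intro sum.neutral) simp
    qed
    then show "tri_map x \<in> fm.span {}" by simp
  qed
  then show ?thesis by simp
qed

text \<open>The transferred spanning set \<open>S\<close> has at most \<open>c\<close> elements,
  while at least \<open>c\<close> independent polynomials \<open>psi\<close> lie in the span of its
  image under \<open>tri_map\<close>. So \<open>S\<close> has exactly \<open>c\<close> elements,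
  their images are independent, and since \<open>tri_map\<close> kills the relations
  \<open>S\<close> is a basis modulo them.\<close>

lemma coset_dim_weight_space:
  assumes sp: "spans TYPE('k::field) a \<mu> c" and ind: "independent_at TYPE('k) m a \<mu> c" and keys: "keys \<mu> \<subseteq> {1..n}"
  shows "int (coset_dim (schur_relations n D :: (nat set list \<Rightarrow>\<^sub>0 'k) set) (weight_space n D \<mu>)) = c"
proof -
  let ?R = "schur_relations n D :: (nat set list \<Rightarrow>\<^sub>0 'k) set"
  let ?W = "{L \<in> shapes n D. tup_wt L = \<mu>}"
  let ?s = "\<lambda>L. single L (1 :: 'k)"
  obtain B1 where B1: "finite B1" "int (card B1) \<le> c" "\<And>\<tau>. \<tau> \<in> B1 \<Longrightarrow> finite \<tau> \<and> wt \<tau> = \<mu>"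
    "\<And>\<tau>. finite \<tau> \<Longrightarrow> wt \<tau> = \<mu> \<Longrightarrow> single \<tau> (1 :: 'k) \<in> fm.span ((\<lambda>\<tau>. single \<tau> 1) ` B1 \<union> gens a \<mu>)"
    using sp unfolding spans_def by blast
  obtain B2 where B2: "finite B2" "c \<le> int (card B2)" "\<forall>\<tau>\<in>B2. finite \<tau> \<and> wt \<tau> = \<mu> \<and> fst ` \<tau> \<subseteq> {1..m}"
    and ind2: "lin_indep (psi m a :: _ \<Rightarrow> (nat \<times> nat, 'k) poly_ring) B2"
    using ind unfolding independent_at_def lin_indep_def by (elim exE conjE)
  have B2': "finite \<tau>" "wt \<tau> = \<mu>" "fst ` \<tau> \<subseteq> {1..m}" if "\<tau> \<in> B2" for \<tau>
    using bspec[OF B2(3) that] by simp_all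
  define S where "S = columns m ` {\<tau> \<in> B1. fills m a \<tau>}"
  have S: "finite S" "int (card S) \<le> c"
  proof -
    have "card S \<le> card {\<tau> \<in> B1. fills m a \<tau>}" unfolding S_def using B1(1) by (intro card_image_le) simp
    also have "\<dots> \<le> card B1" using B1(1) by (intro card_mono) auto
    finally show "int (card S) \<le> c" using B1(2) by simp
  qed (use B1(1) in \<open>simp add: S_def\<close>)
  have cols: "columns m \<tau> \<in> ?W" if "fills m a \<tau>" "wt \<tau> = \<mu>" for \<tau>
    using columns_shapes[OF that(1)] tup_wt_columns[of \<tau> m] that keys by (simp add: fills_def)
  then have SW: "S \<subseteq> ?W" using B1(3) unfolding S_def by blast
  have span_cols: "?s (columns m \<tau>) \<in> fm.span (?s ` S \<union> ?R)" if \<tau>: "fills m a \<tau>" "wt \<tau> = \<mu>" for \<tau>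
  proof -
    have "transfer (single \<tau> (1 :: 'k)) \<in> fm.span (?s ` S \<union> ?R)"
    proof (rule flin_span[OF flin_transfer B1(4)])
      fix x :: "(nat \<times> nat) set \<Rightarrow>\<^sub>0 'k" assume x: "x \<in> (\<lambda>\<tau>. single \<tau> 1) ` B1 \<union> gens a \<mu>"
      show "transfer x \<in> fm.span (?s ` S \<union> ?R)"
      proof (cases "x \<in> gens a \<mu>")
        case True
        then show ?thesis by (intro fm.span_base UnI2 transfer_gens[OF _ keys])
      next
        case False
        then obtain \<sigma> where "x = single \<sigma> 1" "\<sigma> \<in> B1" using x by blast
        then show ?thesis by (auto simp: transfer_single S_def fm.span_zero intro!: fm.span_base)
      qed
    qed (use \<tau> in \<open>auto simp: fills_def\<close>)
    then show ?thesis using \<tau>(1) by (simp add: transfer_single)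
  qed
  have spW: "?s L \<in> fm.span (?s ` S \<union> ?R)" if L: "L \<in> ?W" for L
  proof -
    have "L \<in> shapes n D" using L by blast
    then obtain \<tau> where \<tau>: "fills m a \<tau>" "L = columns m \<tau>" by (rule shapes_columns)
    then have "wt \<tau> = \<mu>" using L tup_wt_columns[of \<tau> m] by (simp add: fills_def)
    then show ?thesis using span_cols \<tau> by simp
  qed
  have fills: "fills m a \<tau>" if \<tau>: "\<tau> \<in> B2" for \<tau>
  proof (rule ccontr)
    assume "\<not> fills m a \<tau>"
    then obtain j where j: "j \<in> {1..m}" "card (a j) \<noteq> length (sorted_list_of_set (colset j \<tau>))"
      using B2'[OF \<tau>] by (auto simp: fills_def finite_colset)
    then have "psi m a \<tau> = (0 :: (nat \<times> nat, 'k) poly_ring)"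
      unfolding psi_def using finite_a by (intro prod_zero bexI[of _ j] mn_length) auto
    then show False using lin_indep_neq_0[OF ind2 B2(1) \<tau>] by simp
  qed
  have "psi m a ` B2 \<subseteq> fm.span ((\<lambda>L. tri_map (?s L)) ` S)"
  proof (rule image_subsetI)
    fix \<tau> assume \<tau>: "\<tau> \<in> B2"
    have "tri_map (?s (columns m \<tau>)) \<in> fm.span ((\<lambda>L. tri_map (?s L)) ` S)"
    proof (rule flin_span[OF flin_tri_map span_cols[OF fills[OF \<tau>]]])
      fix x assume x: "x \<in> ?s ` S \<union> ?R"
      show "tri_map x \<in> fm.span ((\<lambda>L. tri_map (?s L)) ` S)"
      proof (cases "x \<in> ?R")
        case True
        then show ?thesis by (simp add: tri_map_relations fm.span_zero)
      next
        case False
        then show ?thesis using x by (intro fm.span_base) blast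
      qed
    qed (use B2'[OF \<tau>] in simp)
    then show "psi m a \<tau> \<in> fm.span ((\<lambda>L. tri_map (?s L)) ` S)" by (simp only: tri_map_columns)
  qed
  note sub = this
  have "card S \<le> card B2" using S(2) B2(2) by simp
  from lin_indep_spanning[OF ind2 B2(1) S(1) this sub]
  have indS: "lin_indep (\<lambda>L. tri_map (?s L)) S" .
  have "card B2 \<le> card ((\<lambda>L. tri_map (?s L)) ` S)"
    using S(1) by (intro lin_indep_span_bound[OF ind2 B2(1) _ sub]) simp
  also have "\<dots> \<le> card S" using S(1) by (rule card_image_le)
  finally have card: "int (card S) = c" using S(2) B2(2) by simp
  have "coset_dim ?R (weight_space n D \<mu>) = card S"
  proof (rule coset_dim_eq[OF subspace_schur_relations weight_space_eq[OF finite_D] S(1) SW spW])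
    fix \<alpha> assume "(\<Sum>L\<in>S. fm_scale (\<alpha> L) (?s L)) \<in> ?R"
    then have "tri_map (\<Sum>L\<in>S. fm_scale (\<alpha> L) (?s L)) = 0" by (rule tri_map_relations)
    then have "(\<Sum>L\<in>S. fm_scale (\<alpha> L) (tri_map (?s L))) = 0"
      by (simp only: flin_sum[OF flin_tri_map] flin_scale[OF flin_tri_map])
    then show "\<forall>L\<in>S. \<alpha> L = 0" by (intro ballI lin_indepD[OF indS])
  qed
  then show ?thesis using card by simp
qed

lemma coset_dim_weight_space_0:
  assumes "\<not> keys \<mu> \<subseteq> {1..n}"
  shows "coset_dim (schur_relations n D :: (nat set list \<Rightarrow>\<^sub>0 'k::field) set) (weight_space n D \<mu>) = 0"
proof -
  have "tup_wt L \<noteq> \<mu>" if L: "L \<in> shapes n D" for L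
  proof
    assume wt: "tup_wt L = \<mu>"
    obtain \<tau> where \<tau>: "fills m a \<tau>" "L = columns m \<tau>" using L by (rule shapes_columns)
    have "b \<subseteq> {1..n}" if "b \<in> set L" for b
      using L that unfolding shapes_def list_all2_conv_all_nth by (metis (no_types, lifting) in_set_conv_nth mem_Collect_eq)
    then have rows: "(\<Union>b\<in>set L. b) \<subseteq> {1..n}" by (rule UN_least)
    have sub: "snd ` \<tau> \<subseteq> (\<Union>b\<in>set L. b)"
    proof
      fix u assume "u \<in> snd ` \<tau>"
      then obtain j where j: "(j, u) \<in> \<tau>" by auto
      then have "j \<in> {1..m}" using \<tau>(1) by (force simp: fills_def)
      then have "colset j \<tau> \<in> set L" unfolding \<tau>(2) columns_def by (auto simp del: upt_Suc)
      then show "u \<in> (\<Union>b\<in>set L. b)" using j by (auto simp: colset_def)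
    qed
    have "keys \<mu> = snd ` \<tau>"
      using \<tau> wt tup_wt_columns[of \<tau> m] wt_keys[of \<tau>] by (simp add: fills_def)
    then show False using assms subset_trans[OF sub rows] by simp
  qed
  then have W: "{L \<in> shapes n D. tup_wt L = \<mu>} = {}" by blast
  have "coset_dim (schur_relations n D :: (nat set list \<Rightarrow>\<^sub>0 'k) set) (weight_space n D \<mu>) = card ({} :: nat set list set)"
  proof (rule coset_dim_eq[OF subspace_schur_relations weight_space_eq[OF finite_D]])
    fix L assume "L \<in> {L \<in> shapes n D. tup_wt L = \<mu>}"
    then show "single L (1 :: 'k) \<in> fm.span ((\<lambda>L. single L 1) ` {} \<union> schur_relations n D)" unfolding W by blast
  qed simp_all
  then show ?thesis by simp
qed

end

text \<open>A descent at \<open>k\<close> puts a box into row \<open>k\<close>. If all boxes are in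
  rows up to \<open>n\<close>, there is no descent beyond \<open>n\<close>, and the later variables
  do not occur.\<close>

lemma schubert_coeff_eq_0_rows:
  assumes "fin_perm w" "rothe_diagram w \<subseteq> {1..n} \<times> UNIV" "\<not> keys \<mu> \<subseteq> {1..n}"
  shows "lookup (schubert w) \<mu> = 0"
proof -
  obtain i where i: "i \<in> keys \<mu>" "i \<notin> {1..n}" using assms(3) by blast
  obtain N where N: "w permutes {1..N}" using fin_perm_permutes[OF assms(1)] by blast
  show ?thesis
  proof (cases "i = 0")
    case True
    show ?thesis
    proof (rule ccontr)
      assume "lookup (schubert w) \<mu> \<noteq> 0"
      then show False using schubert_keys[OF N, of \<mu>] i True by (auto simp: in_keys_iff)
    qed
  next
    case False
    have inj: "w permutes {1..}" using assms(1) by (simp add: fin_perm_def)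
    have "w k < w (Suc k)" if "i \<le> k" for k
    proof (rule ccontr)
      assume "\<not> w k < w (Suc k)"
      moreover have "w k \<noteq> w (Suc k)" using permutes_inj[OF inj] by (simp add: inj_eq)
      ultimately have "w (Suc k) < w k" by simp
      moreover have "inv_into UNIV w (w (Suc k)) = Suc k" using permutes_inj[OF inj] by simp
      moreover have "1 \<le> w (Suc k)" using permutes_in_image[OF inj, of "Suc k"] by simp
      ultimately have "(k, w (Suc k)) \<in> rothe_diagram w" using False that by (simp add: rothe_diagram_def)
      then show False using assms(2) i(2) that False by auto
    qed
    then show ?thesis using assms(1) i(1) False
      by (intro schubert_coeff_eq_0_beyond[of w i]) (auto simp: in_keys_iff)
  qed
qed

theorem corollary6p1:
  fixes w :: "nat \<Rightarrow> nat" and n m :: nat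
  assumes "fin_perm w"
    and "rothe_diagram w \<subseteq> {1..n} \<times> {1..m}"
  shows "schur_character TYPE('k::field) n (diagram_columns m (rothe_diagram w)) = schubert w"
proof -
  obtain N where N: "w permutes {1..N}" using fin_perm_permutes[OF assms(1)] by blast
  have cols: "j \<in> {1..m}" if "rcol w j \<noteq> {}" for j using that assms(2) by (auto simp: rcol_def)
  interpret schur_diagram n m "rcol w"
    by unfold_locales (use finite_rcol cols in auto)
  have D: "diagram_columns m (rothe_diagram w) = D"
    unfolding D_def by (simp add: diagram_columns_def rcol_def[abs_def] del: upt_Suc)
  have dim: "int (coset_dim (schur_relations n D :: (nat set list \<Rightarrow>\<^sub>0 'k) set) (weight_space n D \<mu>)) = lookup (schubert w) \<mu>" for \<mu>
  proof (cases "keys \<mu> \<subseteq> {1..n}")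
    case True
    then show ?thesis using schubert_basis[OF N cols] by (intro coset_dim_weight_space) blast+
  next
    case False
    have "lookup (schubert w) \<mu> = 0"
      using assms(2) False by (intro schubert_coeff_eq_0_rows[OF assms(1)]) blast+
    then show ?thesis using coset_dim_weight_space_0[OF False] by simp
  qed
  have "schur_character TYPE('k) n D = Sum_any (\<lambda>l. single l (lookup (schubert w) l))"
    unfolding schur_character_def dim ..
  also have "\<dots> = (\<Sum>l\<in>keys (schubert w). single l (lookup (schubert w) l))"
    by (rule Sum_any.expand_superset) (auto simp: in_keys_iff)
  also have "\<dots> = schubert w" by (rule sum_single_keys)
  finally show ?thesis unfolding D .
qed

end
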